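(* For any Hom-Sabinin algebra $(S,\alpha)$, its universal enveloping algebra $U_{hom}(S,\alpha)$ is a Hom-bialgebra (with coproduct and counit induced from those of the free unitary Hom-algebra generated by $(S,\alpha)$, for which the elements of $S$ are primitive).
   Context: $\mathbb{K}$ is a field of characteristic zero. Hom-bialgebras. A Hom-algebra $(A,\mu,\alpha)$ is a vector space with a bilinear product (juxtaposition, not assumed associative) and an algebra endomorphism $\alpha$; it is unitary if there is a linear $u:\mathbb{K}\to A$ with $u(1)x=xu(1)=\alpha(x)$ for all $x$ and $\alpha\circ u=u$. A coalgebra is a vector space $A$ with a linear map $\Delta:A\to A\otimes A$; a Hom-coalgebra $(A,\Delta,\alpha)$ is a coalgebra with a coalgebra morphism $\alpha$, and it is counitary if there is $\epsilon:A\to\mathbb{K}$ with $\sum\epsilon(x_{(1)})\otimes x_{(2)}=1\otimes x$ and $\sum x_{(1)}\otimes\epsilon(x_{(2)})=x\otimes1$. A Hom-bialgebra is $(A,\mu,u,\Delta,\epsilon,\alpha)$ with $(A,\mu,u,\alpha)$ a unitary Hom-algebra, $(A,\Delta,\epsilon,\alpha)$ a counitary Hom-coalgebra, and $\epsilon:A\to\mathbb{K}$, $\Delta:A\to A\otimes A$ Hom-algebra morphisms ($A\otimes A$ has componentwise product and twisting map $\alpha\otimes\alpha$; $\mathbb{K}$ has identity twisting map). Hom-Sabinin algebras. For a vector space $S$, the tensor algebra $T(S)$ has the coproduct $x\mapsto\sum x_{(1)}\otimes x_{(2)}$ that is an algebra morphism with the elements of $S$ primitive; $|x|$ is the length of a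 word $x$, $[a,b]=ab-ba$ inside $T(S)$, $\sigma_{a,b,c}$ is the cyclic sum over $a,b,c$, and $\langle a,b\rangle=\langle 1;a,b\rangle$. A Hom-Sabinin algebra is a vector space $S$ with multilinear maps $\langle -;-,-\rangle:S^{\otimes n}\otimes S\otimes S\to S$ ($n\ge0$) and $\Phi_{n,m}:S^{\otimes n}\otimes S^{\otimes m}\to S$ ($n>0$, $m>1$), and an endomorphism $\alpha$ of all these operations, such that, for all words $x,y$ and $a,b,c,e\in S$, with $k=|x_{(2)}|+1$: (1) $\langle x;a,b\rangle+\langle x;b,a\rangle=0$; (2) $\langle x[a,b]y;c,e\rangle+\sum\langle\alpha^{k}(x_{(1)})\langle x_{(2)};a,b\rangle\alpha^{k}(y);\alpha^{k}(c),\alpha^{k}(e)\rangle=0$; (3) $\sigma_{a,b,c}\big(\langle xc;a,b\rangle+\sum\langle\alpha^{k}(x_{(1)});\langle x_{(2)};a,b\rangle,\alpha^{k}(c)\rangle\big)=0$; (4) $\Phi_{n,m}(x,y)=\Phi_{n,m}(\tau\cdot x,\sigma\cdot y)$ for $\tau\in S_n$, $\sigma\in S_m$. The operations $q^\alpha$. In a Hom-algebra $(A,\mu,\alpha)$ put $(a,b,c)_\alpha=(ab)\alpha(c)-\alpha(a)(bc)$ and $[x_1\otimes\cdots\otimes x_n]_\alpha=(\cdots((x_1x_2)\alpha(x_3))\cdots)\alpha^{n-2}(x_n)$, $[x_1]_\alpha=x_1$. For $n,m\ge1$, $q^\alpha=q^\alpha_{n,m}:A^{\otimes n}\otimes A^{\otimes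 m}\otimes A\to A$ is defined recursively, for words $u,v$ of lengths $n,m$ (in exponents a word stands for its length, and $u_i$, $v_i$ for the lengths of $u_{(i)}$, $v_{(i)}$), by $$(\alpha^{v-1}[u]_\alpha,\alpha^{u-1}[v]_\alpha,\alpha^{u+v-2}z)_\alpha=q^\alpha(u,v,z)+\sum_{u_1+v_1>0}\alpha^{u_2+v_2}\big(\alpha^{v_1-1}([u_{(1)}]_\alpha)\,\alpha^{u_1-1}([v_{(1)}]_\alpha)\big)\,\alpha^{u_1+v_1-1}\big(q^\alpha(u_{(2)},v_{(2)},z)\big),$$ where $q^\alpha$ is zero if $u_{(2)}$ or $v_{(2)}$ is empty, and if $v_{(1)}$ (resp. $u_{(1)}$) is empty the inner product $\alpha^{v_1-1}([u_{(1)}]_\alpha)\alpha^{u_1-1}([v_{(1)}]_\alpha)$ is read as $[u_{(1)}]_\alpha$ (resp. $[v_{(1)}]_\alpha$). The enveloping algebra. Let $\mathbb{K}\{S\}$ be the free unitary Hom-algebra generated by the vector space with endomorphism $(S,\alpha)$, with twisting map $\hat\alpha$ extending $\alpha$; its coproduct and counit are the Hom-algebra morphisms with $\Delta(s)=u(1)\otimes s+s\otimes u(1)$, $\epsilon(s)=0$ for $s\in S$, $\Delta(u(1))=u(1)\otimes u(1)$, $\epsilon(u(1))=1$. Then $U_{hom}(S,\alpha)=\mathbb{K}\{S\}/I$, where $I$ is the ideal generated by all $\langle w;a,b\rangle+q^\alpha(w,a,b)-q^\alpha(w,b,a)$ ($w\in S^{\otimes n}$, $n\ge1$), all $[a,b]+\langle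 a,b\rangle$ (here $[a,b]=ab-ba$ in $\mathbb{K}\{S\}$), and all $\Phi_{n,m}(w,v)-\sum_{\sigma\in S_n,\tau\in S_m}\frac1{n!m!}q^\alpha_{n,m-1}(w_{\sigma(1)}\cdots w_{\sigma(n)},v_{\tau(1)}\cdots v_{\tau(m-1)},v_{\tau(m)})$, for $a,b\in S$ and $w=w_1\cdots w_n$, $v=v_1\cdots v_m$ words in $S$. The twisting map of $U_{hom}(S,\alpha)$ is induced by $\hat\alpha$. *)

theory Defs
  imports
    "HOL-Algebra.QuotRing"
    "HOL-Algebra.Module"
    "HOL-Algebra.Algebraic_Closure_Type"
    "HOL-Library.Poly_Mapping"
    "HOL-Combinatorics.Permutations"
begin

section \<open>Hom-algebras\<close>

text \<open>
  Vector spaces over a field (given as a type \<open>'k\<close>) are modules over \<^const>\<open>ring_of_type_algebra\<close>.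
  The record \<open>module\<close> extends \<open>ring\<close>, so it already has a slot for a product, which need not be
  associative, and one for a distinguished element; the latter holds \<open>u(1)\<close> when a unit
  \<open>u\<close> is present (the linear map \<open>u\<close> and the vector \<open>u(1)\<close> determine each other).
\<close>

record ('k, 'a) hom_alg = "('k, 'a) module" +
  twist :: "'a \<Rightarrow> 'a"

abbreviation vec_space :: "('k::field, 'a, 'm) module_scheme \<Rightarrow> bool" where
  "vec_space V \<equiv> module (ring_of_type_algebra :: 'k ring) V"

definition linear_map ::
  "('k, 'a, 'm) module_scheme \<Rightarrow> ('k, 'b, 'n) module_scheme \<Rightarrow> ('a \<Rightarrow> 'b) \<Rightarrow> bool" where
  "linear_map V W f \<longleftrightarrow>
     f \<in> carrier V \<rightarrow> carrier W \<and>
     (\<forall>x\<in>carrier V. \<forall>y\<in>carrier V. f (x \<oplus>\<^bsub>V\<^esub> y) = f x \<oplus>\<^bsub>W\<^esub> f y) \<and>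
     (\<forall>c. \<forall>x\<in>carrier V. f (c \<odot>\<^bsub>V\<^esub> x) = c \<odot>\<^bsub>W\<^esub> f x)"

definition multilinear :: "('k, 'a, 'm) module_scheme \<Rightarrow> nat \<Rightarrow> ('a list \<Rightarrow> 'a) \<Rightarrow> bool" where
  "multilinear V n f \<longleftrightarrow>
     (\<forall>xs i. length xs = n \<and> set xs \<subseteq> carrier V \<and> i < n \<longrightarrow>
        linear_map V V (\<lambda>t. f (xs[i := t])))"

definition hom_algebra :: "('k::field, 'a, 'm) hom_alg_scheme \<Rightarrow> bool" where
  "hom_algebra A \<longleftrightarrow>
     vec_space A \<and>
     (\<forall>x\<in>carrier A. linear_map A A (\<lambda>y. x \<otimes>\<^bsub>A\<^esub> y) \<and> linear_map A A (\<lambda>y. y \<otimes>\<^bsub>A\<^esub> x)) \<and>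
     linear_map A A (twist A) \<and>
     (\<forall>x\<in>carrier A. \<forall>y\<in>carrier A. twist A (x \<otimes>\<^bsub>A\<^esub> y) = twist A x \<otimes>\<^bsub>A\<^esub> twist A y)"

definition unitary_hom_algebra :: "('k::field, 'a, 'm) hom_alg_scheme \<Rightarrow> bool" where
  "unitary_hom_algebra A \<longleftrightarrow>
     hom_algebra A \<and> \<one>\<^bsub>A\<^esub> \<in> carrier A \<and>
     (\<forall>x\<in>carrier A. \<one>\<^bsub>A\<^esub> \<otimes>\<^bsub>A\<^esub> x = twist A x \<and> x \<otimes>\<^bsub>A\<^esub> \<one>\<^bsub>A\<^esub> = twist A x) \<and>
     twist A \<one>\<^bsub>A\<^esub> = \<one>\<^bsub>A\<^esub>"

definition hom_alg_morphism ::
  "('k::field, 'a, 'm) hom_alg_scheme \<Rightarrow> ('k, 'b, 'n) hom_alg_scheme \<Rightarrow> ('a \<Rightarrow> 'b) \<Rightarrow> bool" where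
  "hom_alg_morphism A B f \<longleftrightarrow>
     linear_map A B f \<and>
     (\<forall>x\<in>carrier A. \<forall>y\<in>carrier A. f (x \<otimes>\<^bsub>A\<^esub> y) = f x \<otimes>\<^bsub>B\<^esub> f y) \<and>
     (\<forall>x\<in>carrier A. f (twist A x) = twist B (f x))"

definition ground_alg :: "('k::field, 'k) hom_alg" where
  "ground_alg =
     \<lparr>carrier = UNIV, monoid.mult = (*), one = 1, ring.zero = 0, add = (+), module.smult = (*), twist = id\<rparr>"


section \<open>Ideals and quotients\<close>

text \<open>
  Closure under the twisting map is not required of an ideal: in a unitary Hom-algebra it follows
  from \<open>u(1)x = \<alpha>(x)\<close>.
\<close>

definition hom_alg_ideal :: "('k::field, 'a, 'm) hom_alg_scheme \<Rightarrow> 'a set \<Rightarrow> bool" where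
  "hom_alg_ideal A I \<longleftrightarrow>
     submodule I (ring_of_type_algebra :: 'k ring) A \<and>
     (\<forall>a\<in>carrier A. \<forall>x\<in>I. a \<otimes>\<^bsub>A\<^esub> x \<in> I \<and> x \<otimes>\<^bsub>A\<^esub> a \<in> I)"

text \<open>
  The additive and multiplicative part is that of \<^const>\<open>FactRing\<close>. All sets united below are one
  and the same coset whenever the operation is compatible with \<open>I\<close>.
\<close>

definition quot_alg :: "('k, 'a, 'm) hom_alg_scheme \<Rightarrow> 'a set \<Rightarrow> ('k, 'a set) hom_alg" where
  "quot_alg A I =
     \<lparr>carrier = a_rcosets\<^bsub>A\<^esub> I, monoid.mult = rcoset_mult A I, one = I +>\<^bsub>A\<^esub> \<one>\<^bsub>A\<^esub>,
      ring.zero = I, add = set_add A,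
      module.smult = (\<lambda>c P. \<Union>x\<in>P. I +>\<^bsub>A\<^esub> (c \<odot>\<^bsub>A\<^esub> x)),
      twist = (\<lambda>P. \<Union>x\<in>P. I +>\<^bsub>A\<^esub> twist A x)\<rparr>"


section \<open>The algebra with a given basis\<close>

text \<open>
  The vector space with basis \<open>B\<close>, with the bilinear product, the unit vector and the linear twisting
  map that are given on the basis by \<open>f\<close>, \<open>e\<close> and \<open>t\<close>.
\<close>

definition basis_map :: "('x \<Rightarrow> 'y) \<Rightarrow> ('x \<Rightarrow>\<^sub>0 'k) \<Rightarrow> ('y \<Rightarrow>\<^sub>0 'k::field)" where
  "basis_map h p = (\<Sum>x\<in>Poly_Mapping.keys p. Poly_Mapping.single (h x) (Poly_Mapping.lookup p x))"

definition basis_alg ::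
  "'x set \<Rightarrow> ('x \<Rightarrow> 'x \<Rightarrow> 'x) \<Rightarrow> 'x \<Rightarrow> ('x \<Rightarrow> 'x) \<Rightarrow> ('k::field, 'x \<Rightarrow>\<^sub>0 'k) hom_alg" where
  "basis_alg B f e t =
     \<lparr>carrier = {p. Poly_Mapping.keys p \<subseteq> B},
      monoid.mult = (\<lambda>p r. \<Sum>x\<in>Poly_Mapping.keys p. \<Sum>y\<in>Poly_Mapping.keys r.
                Poly_Mapping.single (f x y) (Poly_Mapping.lookup p x * Poly_Mapping.lookup r y)),
      one = Poly_Mapping.single e 1, ring.zero = 0, add = (+),
      module.smult = (\<lambda>c. Poly_Mapping.map ((*) c)),
      twist = basis_map t\<rparr>"

abbreviation basis_vec :: "'x \<Rightarrow> ('x \<Rightarrow>\<^sub>0 'k::field)" where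
  "basis_vec x \<equiv> Poly_Mapping.single x 1"


section \<open>Tensor products\<close>

definition pair_alg ::
  "('k::field, 'a, 'm) hom_alg_scheme \<Rightarrow> ('k, 'b, 'n) hom_alg_scheme
     \<Rightarrow> ('k, ('a \<times> 'b) \<Rightarrow>\<^sub>0 'k) hom_alg" where
  "pair_alg A B =
     basis_alg (carrier A \<times> carrier B)
       (\<lambda>(a, b) (c, d). (a \<otimes>\<^bsub>A\<^esub> c, b \<otimes>\<^bsub>B\<^esub> d)) (\<one>\<^bsub>A\<^esub>, \<one>\<^bsub>B\<^esub>) (map_prod (twist A) (twist B))"

definition bilinear_relations ::
  "('k::field, 'a, 'm) hom_alg_scheme \<Rightarrow> ('k, 'b, 'n) hom_alg_scheme
     \<Rightarrow> (('a \<times> 'b) \<Rightarrow>\<^sub>0 'k) set" where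
  "bilinear_relations A B =
     {basis_vec (a \<oplus>\<^bsub>A\<^esub> a', b) - basis_vec (a, b) - basis_vec (a', b) | a a' b.
        a \<in> carrier A \<and> a' \<in> carrier A \<and> b \<in> carrier B} \<union>
     {basis_vec (a, b \<oplus>\<^bsub>B\<^esub> b') - basis_vec (a, b) - basis_vec (a, b') | a b b'.
        a \<in> carrier A \<and> b \<in> carrier B \<and> b' \<in> carrier B} \<union>
     {basis_vec (c \<odot>\<^bsub>A\<^esub> a, b) - Poly_Mapping.single (a, b) c | c a b.
        a \<in> carrier A \<and> b \<in> carrier B} \<union>
     {basis_vec (a, c \<odot>\<^bsub>B\<^esub> b) - Poly_Mapping.single (a, b) c | c a b.
        a \<in> carrier A \<and> b \<in> carrier B}"

definition tensor_null ::
  "('k::field, 'a, 'm) hom_alg_scheme \<Rightarrow> ('k, 'b, 'n) hom_alg_scheme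
     \<Rightarrow> (('a \<times> 'b) \<Rightarrow>\<^sub>0 'k) set" where
  "tensor_null A B =
     (\<lambda>N. submodule N (ring_of_type_algebra :: 'k ring) (pair_alg A B)) hull bilinear_relations A B"

definition tensor_alg ::
  "('k::field, 'a, 'm) hom_alg_scheme \<Rightarrow> ('k, 'b, 'n) hom_alg_scheme
     \<Rightarrow> ('k, (('a \<times> 'b) \<Rightarrow>\<^sub>0 'k) set) hom_alg" where
  "tensor_alg A B = quot_alg (pair_alg A B) (tensor_null A B)"

definition tensor ::
  "('k::field, 'a, 'm) hom_alg_scheme \<Rightarrow> ('k, 'b, 'n) hom_alg_scheme
     \<Rightarrow> 'a \<Rightarrow> 'b \<Rightarrow> (('a \<times> 'b) \<Rightarrow>\<^sub>0 'k) set" where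
  "tensor A B a b = tensor_null A B +>\<^bsub>pair_alg A B\<^esub> basis_vec (a, b)"

text \<open>\<open>tensor_map C D f g\<close> is \<open>f \<otimes> g\<close>, with values in \<open>C \<otimes> D\<close>.\<close>

definition tensor_map ::
  "('k::field, 'c, 'm) hom_alg_scheme \<Rightarrow> ('k, 'd, 'n) hom_alg_scheme
     \<Rightarrow> ('a \<Rightarrow> 'c) \<Rightarrow> ('b \<Rightarrow> 'd) \<Rightarrow> (('a \<times> 'b) \<Rightarrow>\<^sub>0 'k) set \<Rightarrow> (('c \<times> 'd) \<Rightarrow>\<^sub>0 'k) set" where
  "tensor_map C D f g P =
     (\<Union>p\<in>P. tensor_null C D +>\<^bsub>pair_alg C D\<^esub> basis_map (map_prod f g) p)"


section \<open>Hom-bialgebras\<close>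

definition hom_coalgebra ::
  "('k::field, 'a, 'm) hom_alg_scheme \<Rightarrow> ('a \<Rightarrow> (('a \<times> 'a) \<Rightarrow>\<^sub>0 'k) set) \<Rightarrow> bool" where
  "hom_coalgebra A \<Delta> \<longleftrightarrow>
     vec_space A \<and> linear_map A (tensor_alg A A) \<Delta> \<and> linear_map A A (twist A) \<and>
     (\<forall>x\<in>carrier A. \<Delta> (twist A x) = tensor_map A A (twist A) (twist A) (\<Delta> x))"

definition counitary_hom_coalgebra ::
  "('k::field, 'a, 'm) hom_alg_scheme \<Rightarrow> ('a \<Rightarrow> (('a \<times> 'a) \<Rightarrow>\<^sub>0 'k) set) \<Rightarrow> ('a \<Rightarrow> 'k) \<Rightarrow> bool" where
  "counitary_hom_coalgebra A \<Delta> \<epsilon> \<longleftrightarrow>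
     hom_coalgebra A \<Delta> \<and> linear_map A ground_alg \<epsilon> \<and>
     (\<forall>x\<in>carrier A.
        tensor_map ground_alg A \<epsilon> id (\<Delta> x) = tensor ground_alg A 1 x \<and>
        tensor_map A ground_alg id \<epsilon> (\<Delta> x) = tensor A ground_alg x 1)"

definition hom_bialgebra ::
  "('k::field, 'a, 'm) hom_alg_scheme \<Rightarrow> ('a \<Rightarrow> (('a \<times> 'a) \<Rightarrow>\<^sub>0 'k) set) \<Rightarrow> ('a \<Rightarrow> 'k) \<Rightarrow> bool" where
  "hom_bialgebra A \<Delta> \<epsilon> \<longleftrightarrow>
     unitary_hom_algebra A \<and> counitary_hom_coalgebra A \<Delta> \<epsilon> \<and>
     hom_alg_morphism A ground_alg \<epsilon> \<and> hom_alg_morphism A (tensor_alg A A) \<Delta>"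


section \<open>Hom-Sabinin algebras\<close>

text \<open>
  The coproduct of the tensor algebra on a word, as a formal sum (a list, with multiplicities) of
  pairs \<open>x\<^sub>(\<^sub>1\<^sub>) \<otimes> x\<^sub>(\<^sub>2\<^sub>)\<close>. The second equation is \<open>\<Delta>(s w) = (s \<otimes> 1 + 1 \<otimes> s) \<Delta>(w)\<close>.
\<close>

fun word_coprod :: "'a list \<Rightarrow> ('a list \<times> 'a list) list" where
  "word_coprod [] = [([], [])]"
| "word_coprod (s # w) =
     map (\<lambda>(x, y). (s # x, y)) (word_coprod w) @ map (\<lambda>(x, y). (x, s # y)) (word_coprod w)"

definition sum_terms :: "('a, 'm) ring_scheme \<Rightarrow> 'a list \<Rightarrow> 'a" where
  "sum_terms V xs = foldr (\<oplus>\<^bsub>V\<^esub>) xs \<zero>\<^bsub>V\<^esub>"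

text \<open>
  \<open>bracket S x a b\<close> is \<open>\<langle>x; a, b\<rangle>\<close>. The inherited product and unit slots of the record play no role.
\<close>

record ('k, 's) hom_sabinin = "('k, 's) hom_alg" +
  bracket :: "'s list \<Rightarrow> 's \<Rightarrow> 's \<Rightarrow> 's"
  Phi :: "'s list \<Rightarrow> 's list \<Rightarrow> 's"

definition sabinin_cyclic_term ::
  "('k, 's, 'm) hom_sabinin_scheme \<Rightarrow> 's list \<Rightarrow> 's \<Rightarrow> 's \<Rightarrow> 's \<Rightarrow> 's" where
  "sabinin_cyclic_term S x a b c =
     bracket S (x @ [c]) a b \<oplus>\<^bsub>S\<^esub>
     sum_terms S (map (\<lambda>(x1, x2).
         let k = length x2 + 1 in
         bracket S (map (twist S ^^ k) x1) (bracket S x2 a b) ((twist S ^^ k) c))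
       (word_coprod x))"

definition hom_sabinin_algebra :: "('k::field, 's, 'm) hom_sabinin_scheme \<Rightarrow> bool" where
  "hom_sabinin_algebra S \<longleftrightarrow>
     vec_space S \<and>
     (\<forall>n. multilinear S (n + 2) (\<lambda>xs. bracket S (take n xs) (xs ! n) (xs ! (n + 1)))) \<and>
     (\<forall>n>0. \<forall>m>1. multilinear S (n + m) (\<lambda>xs. Phi S (take n xs) (drop n xs))) \<and>
     linear_map S S (twist S) \<and>
     (\<forall>x a b. set x \<subseteq> carrier S \<and> a \<in> carrier S \<and> b \<in> carrier S \<longrightarrow>
        twist S (bracket S x a b) = bracket S (map (twist S) x) (twist S a) (twist S b)) \<and>
     (\<forall>x y. set x \<subseteq> carrier S \<and> set y \<subseteq> carrier S \<and> length x > 0 \<and> length y > 1 \<longrightarrow>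
        twist S (Phi S x y) = Phi S (map (twist S) x) (map (twist S) y)) \<and>
     (\<forall>x a b. set x \<subseteq> carrier S \<and> a \<in> carrier S \<and> b \<in> carrier S \<longrightarrow>
        bracket S x a b \<oplus>\<^bsub>S\<^esub> bracket S x b a = \<zero>\<^bsub>S\<^esub>) \<and>
     (\<forall>x y a b c e. set x \<subseteq> carrier S \<and> set y \<subseteq> carrier S \<and> {a, b, c, e} \<subseteq> carrier S \<longrightarrow>
        (bracket S (x @ [a, b] @ y) c e \<ominus>\<^bsub>S\<^esub> bracket S (x @ [b, a] @ y) c e) \<oplus>\<^bsub>S\<^esub>
        sum_terms S (map (\<lambda>(x1, x2).
            let k = length x2 + 1 in
            bracket S (map (twist S ^^ k) x1 @ [bracket S x2 a b] @ map (twist S ^^ k) y)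
              ((twist S ^^ k) c) ((twist S ^^ k) e))
          (word_coprod x)) = \<zero>\<^bsub>S\<^esub>) \<and>
     (\<forall>x a b c. set x \<subseteq> carrier S \<and> {a, b, c} \<subseteq> carrier S \<longrightarrow>
        sabinin_cyclic_term S x a b c \<oplus>\<^bsub>S\<^esub> sabinin_cyclic_term S x b c a \<oplus>\<^bsub>S\<^esub>
        sabinin_cyclic_term S x c a b = \<zero>\<^bsub>S\<^esub>) \<and>
     (\<forall>x y \<tau> \<sigma>. set x \<subseteq> carrier S \<and> set y \<subseteq> carrier S \<and> length x > 0 \<and> length y > 1 \<and>
        \<tau> permutes {..<length x} \<and> \<sigma> permutes {..<length y} \<longrightarrow>
        Phi S x y = Phi S (permute_list \<tau> x) (permute_list \<sigma> y))"


section \<open>The operations q in a Hom-algebra\<close>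

definition hom_assoc :: "('k, 'a, 'm) hom_alg_scheme \<Rightarrow> 'a \<Rightarrow> 'a \<Rightarrow> 'a \<Rightarrow> 'a" where
  "hom_assoc A a b c =
     ((a \<otimes>\<^bsub>A\<^esub> b) \<otimes>\<^bsub>A\<^esub> twist A c) \<ominus>\<^bsub>A\<^esub> (twist A a \<otimes>\<^bsub>A\<^esub> (b \<otimes>\<^bsub>A\<^esub> c))"

text \<open>The left-normed product of a nonempty word; the value on the empty word is irrelevant.\<close>

fun left_prod :: "('k, 'a, 'm) hom_alg_scheme \<Rightarrow> 'a list \<Rightarrow> 'a" where
  "left_prod A xs =
     (if length xs \<le> 1 then hd xs
      else left_prod A (butlast xs) \<otimes>\<^bsub>A\<^esub> (twist A ^^ (length xs - 2)) (last xs))"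

declare left_prod.simps [simp del]

definition inner_prod :: "('k, 'a, 'm) hom_alg_scheme \<Rightarrow> 'a list \<Rightarrow> 'a list \<Rightarrow> 'a" where
  "inner_prod A u v =
     (if v = [] then left_prod A u
      else if u = [] then left_prod A v
      else (twist A ^^ (length v - 1)) (left_prod A u) \<otimes>\<^bsub>A\<^esub>
           (twist A ^^ (length u - 1)) (left_prod A v))"

lemma length_word_coprod:
  "(x, y) \<in> set (word_coprod w) \<Longrightarrow> length x + length y = length w"
  by (induction w arbitrary: x y) fastforce+

text \<open>
  The defining identity is solved for \<open>q(u, v, z)\<close>; the sum runs over the pairs of splittings with
  \<open>|u\<^sub>(\<^sub>1\<^sub>)| + |v\<^sub>(\<^sub>1\<^sub>)| > 0\<close>.
\<close>

function q_op :: "('k, 'a, 'm) hom_alg_scheme \<Rightarrow> 'a list \<Rightarrow> 'a list \<Rightarrow> 'a \<Rightarrow> 'a" where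
  "q_op A u v z =
     (if u = [] \<or> v = [] then \<zero>\<^bsub>A\<^esub>
      else
        hom_assoc A ((twist A ^^ (length v - 1)) (left_prod A u))
                    ((twist A ^^ (length u - 1)) (left_prod A v))
                    ((twist A ^^ (length u + length v - 2)) z)
        \<ominus>\<^bsub>A\<^esub>
        sum_terms A
          [(twist A ^^ (length u2 + length v2)) (inner_prod A u1 v1) \<otimes>\<^bsub>A\<^esub>
           (twist A ^^ (length u1 + length v1 - 1)) (q_op A u2 v2 z).
             (u1, u2) \<leftarrow> word_coprod u, (v1, v2) \<leftarrow> word_coprod v, length u1 + length v1 > 0])"
  by pat_completeness auto

termination
  by (relation "measure (\<lambda>(A, u, v, z). length u + length v)")
     (auto dest!: length_word_coprod simp flip: length_greater_0_conv)

declare q_op.simps [simp del]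


section \<open>The free unitary Hom-algebra\<close>

datatype 's hom_term = Unit | Gen 's | Mul "'s hom_term" "'s hom_term"

definition terms_over :: "'s set \<Rightarrow> 's hom_term set" where
  "terms_over B = {t. set_hom_term t \<subseteq> B}"

definition term_alg ::
  "('k::field, 's, 'm) hom_alg_scheme \<Rightarrow> ('k, 's hom_term \<Rightarrow>\<^sub>0 'k) hom_alg" where
  "term_alg S = basis_alg (terms_over (carrier S)) Mul Unit (map_hom_term (twist S))"

text \<open>
  The relations make \<^const>\<open>Gen\<close> linear and impose \<open>u(1)x = xu(1) = \<alpha>(x)\<close>; the latter
  suffices for terms \<open>x\<close>, by linearity. The set of relations is stable under the twisting map, hence
  so is the ideal it generates.
\<close>

definition free_relations ::
  "('k::field, 's, 'm) hom_alg_scheme \<Rightarrow> ('s hom_term \<Rightarrow>\<^sub>0 'k) set" where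
  "free_relations S =
     {basis_vec (Gen (a \<oplus>\<^bsub>S\<^esub> b)) - basis_vec (Gen a) - basis_vec (Gen b) | a b.
        a \<in> carrier S \<and> b \<in> carrier S} \<union>
     {basis_vec (Gen (c \<odot>\<^bsub>S\<^esub> a)) - Poly_Mapping.single (Gen a) c | c a. a \<in> carrier S} \<union>
     {basis_vec (Mul Unit t) - basis_vec (map_hom_term (twist S) t) | t.
        t \<in> terms_over (carrier S)} \<union>
     {basis_vec (Mul t Unit) - basis_vec (map_hom_term (twist S) t) | t.
        t \<in> terms_over (carrier S)}"

definition free_null ::
  "('k::field, 's, 'm) hom_alg_scheme \<Rightarrow> ('s hom_term \<Rightarrow>\<^sub>0 'k) set" where
  "free_null S = hom_alg_ideal (term_alg S) hull free_relations S"

definition free_hom_alg ::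
  "('k::field, 's, 'm) hom_alg_scheme \<Rightarrow> ('k, ('s hom_term \<Rightarrow>\<^sub>0 'k) set) hom_alg" where
  "free_hom_alg S = quot_alg (term_alg S) (free_null S)"

definition free_gen ::
  "('k::field, 's, 'm) hom_alg_scheme \<Rightarrow> 's \<Rightarrow> ('s hom_term \<Rightarrow>\<^sub>0 'k) set" where
  "free_gen S s = free_null S +>\<^bsub>term_alg S\<^esub> basis_vec (Gen s)"

definition free_coproduct ::
  "('k::field, 's, 'm) hom_alg_scheme
     \<Rightarrow> (('s hom_term \<Rightarrow>\<^sub>0 'k) set
          \<Rightarrow> ((('s hom_term \<Rightarrow>\<^sub>0 'k) set \<times> ('s hom_term \<Rightarrow>\<^sub>0 'k) set) \<Rightarrow>\<^sub>0 'k) set) \<Rightarrow> bool" where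
  "free_coproduct S \<Delta> \<longleftrightarrow> (let F = free_hom_alg S in
     hom_alg_morphism F (tensor_alg F F) \<Delta> \<and>
     \<Delta> \<one>\<^bsub>F\<^esub> = tensor F F \<one>\<^bsub>F\<^esub> \<one>\<^bsub>F\<^esub> \<and>
     (\<forall>s\<in>carrier S. \<Delta> (free_gen S s) =
        tensor F F \<one>\<^bsub>F\<^esub> (free_gen S s) \<oplus>\<^bsub>tensor_alg F F\<^esub> tensor F F (free_gen S s) \<one>\<^bsub>F\<^esub>))"

definition free_counit ::
  "('k::field, 's, 'm) hom_alg_scheme \<Rightarrow> (('s hom_term \<Rightarrow>\<^sub>0 'k) set \<Rightarrow> 'k) \<Rightarrow> bool" where
  "free_counit S \<epsilon> \<longleftrightarrow> (let F = free_hom_alg S in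
     hom_alg_morphism F ground_alg \<epsilon> \<and> \<epsilon> \<one>\<^bsub>F\<^esub> = 1 \<and>
     (\<forall>s\<in>carrier S. \<epsilon> (free_gen S s) = 0))"


section \<open>The universal enveloping algebra\<close>

definition enveloping_relations ::
  "('k::field_char_0, 's, 'm) hom_sabinin_scheme \<Rightarrow> ('s hom_term \<Rightarrow>\<^sub>0 'k) set set" where
  "enveloping_relations S = (let F = free_hom_alg S; \<iota> = free_gen S in
     {\<iota> (bracket S w a b) \<oplus>\<^bsub>F\<^esub> q_op F (map \<iota> w) [\<iota> a] (\<iota> b) \<ominus>\<^bsub>F\<^esub> q_op F (map \<iota> w) [\<iota> b] (\<iota> a)
        | w a b. w \<noteq> [] \<and> set w \<subseteq> carrier S \<and> a \<in> carrier S \<and> b \<in> carrier S} \<union>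
     {(\<iota> a \<otimes>\<^bsub>F\<^esub> \<iota> b \<ominus>\<^bsub>F\<^esub> \<iota> b \<otimes>\<^bsub>F\<^esub> \<iota> a) \<oplus>\<^bsub>F\<^esub> \<iota> (bracket S [] a b)
        | a b. a \<in> carrier S \<and> b \<in> carrier S} \<union>
     {\<iota> (Phi S w v) \<ominus>\<^bsub>F\<^esub>
        (\<Oplus>\<^bsub>F\<^esub>\<sigma>\<in>{\<sigma>. \<sigma> permutes {..<length w}}. \<Oplus>\<^bsub>F\<^esub>\<tau>\<in>{\<tau>. \<tau> permutes {..<length v}}.
           (1 / (fact (length w) * fact (length v))) \<odot>\<^bsub>F\<^esub>
           q_op F (permute_list \<sigma> (map \<iota> w))
             (butlast (permute_list \<tau> (map \<iota> v))) (last (permute_list \<tau> (map \<iota> v))))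
        | w v. length w > 0 \<and> length v > 1 \<and> set w \<subseteq> carrier S \<and> set v \<subseteq> carrier S})"

definition enveloping_ideal ::
  "('k::field_char_0, 's, 'm) hom_sabinin_scheme \<Rightarrow> ('s hom_term \<Rightarrow>\<^sub>0 'k) set set" where
  "enveloping_ideal S = hom_alg_ideal (free_hom_alg S) hull enveloping_relations S"

definition U_hom ::
  "('k::field_char_0, 's, 'm) hom_sabinin_scheme \<Rightarrow> ('k, ('s hom_term \<Rightarrow>\<^sub>0 'k) set set) hom_alg" where
  "U_hom S = quot_alg (free_hom_alg S) (enveloping_ideal S)"

definition U_proj ::
  "('k::field_char_0, 's, 'm) hom_sabinin_scheme
     \<Rightarrow> ('s hom_term \<Rightarrow>\<^sub>0 'k) set \<Rightarrow> ('s hom_term \<Rightarrow>\<^sub>0 'k) set set" where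
  "U_proj S x = enveloping_ideal S +>\<^bsub>free_hom_alg S\<^esub> x"

end

theory Submission
  imports Defs
begin

text \<open>
  Write \<open>F\<close> for the free unitary Hom-algebra on \<open>(S, \<alpha>)\<close> and \<open>\<pi>\<close> for its projection onto the enveloping
  algebra \<open>U\<close>. The universal property of \<open>F\<close> (lemma \<open>free_lift\<close>) gives the coproduct \<open>\<Delta>\<close> and the
  counit \<open>\<epsilon>\<close> as morphisms, and every identity between morphisms out of \<open>F\<close> only has to be checked on
  \<open>u(1)\<close> and on \<open>S\<close> (lemma \<open>free_unique\<close>). So everything comes down to passing to the quotient: the
  kernels of \<open>(\<pi> \<otimes> \<pi>) \<circ> \<Delta>\<close> and \<open>\<epsilon>\<close> are ideals, and they have to contain the relations that define \<open>U\<close>.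
  A relation \<open>r\<close> which is primitive, that is \<open>\<Delta>(r) = u(1) \<otimes> r + r \<otimes> u(1)\<close>, is killed by \<open>(\<pi> \<otimes> \<pi>) \<circ> \<Delta>\<close>
  because \<open>\<pi>(r) = 0\<close>. Every relation is a linear combination of generators, commutators of generators
  and values of \<open>q\<close> on generators; hence the heart of the matter is that \<open>q(u, v, z)\<close> is
  primitive if \<open>z\<close> and all letters of \<open>u\<close> and \<open>v\<close> are (lemma \<open>primitive_q\<close>).

  Let \<open>p = (u, v)\<close> be a pair of words and \<open>|p|\<close> the sum of their lengths. Put \<open>P(p)\<close> for the inner
  product in the recursion for \<open>q\<close>, with \<open>P = u(1)\<close> on the pair of empty words, \<open>A(p)\<close> for the
  associator on the left-hand side of that recursion, and
  \<open>t(x, y) = \<alpha>\<^bsup>|y|\<^esup>(P(x)) \<alpha>\<^bsup>|x|-1\<^esup>(q(y))\<close>, read as \<open>q(y)\<close> if \<open>x\<close> is empty. The recursion then says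
  \<open>A(p) = \<Sum> t(x, y)\<close>, the sum running over all splittings \<open>(x, y)\<close> of \<open>p\<close>. If all letters are
  primitive, multiplicativity of \<open>\<Delta>\<close> yields \<open>\<Delta>(P(p)) = \<Sum> \<alpha>\<^bsup>|y|\<^esup>(P(x)) \<otimes> \<alpha>\<^bsup>|x|\<^esup>(P(y))\<close> and, as an associator
  vanishes as soon as one of its first two arguments is \<open>u(1)\<close>,
  \<open>\<Delta>(A(p)) = \<Sum> \<alpha>\<^bsup>|y|+1\<^esup>(P(x)) \<otimes> \<alpha>\<^bsup>|x|\<^esup>(A(y))\<close> plus the sum with the two tensor factors exchanged. On the other
  hand, if \<open>q(y)\<close> is primitive, then
  \<open>\<Delta>(t(r, y)) = \<Sum> \<alpha>\<^bsup>|x'|+|y|+1\<^esup>(P(x)) \<otimes> \<alpha>\<^bsup>|x|\<^esup>(t(x', y))\<close> plus the exchanged sum, over the splittings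
  \<open>(x, x')\<close> of \<open>r\<close>. Insert \<open>A(y) = \<Sum> t\<close> into the formula for \<open>\<Delta>(A(p))\<close>. By coassociativity of the
  splitting of words, the result is the sum over the splittings \<open>(r, y)\<close> of \<open>p\<close> of the right-hand
  sides for \<open>\<Delta>(t(r, y))\<close>. By induction on \<open>|p|\<close> all summands with \<open>r\<close> nonempty really equal
  \<open>\<Delta>(t(r, y))\<close>; cancelling them leaves \<open>\<Delta>(q(p)) = u(1) \<otimes> q(p) + q(p) \<otimes> u(1)\<close>.
\<close>

section \<open>Vector spaces, Hom-algebras and their morphisms\<close>

lemma ring_of_type_algebra_simps [simp]:
  "carrier (ring_of_type_algebra :: 'k::field ring) = UNIV"
  "a \<oplus>\<^bsub>(ring_of_type_algebra :: 'k::field ring)\<^esub> b = a + b"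
  "a \<otimes>\<^bsub>(ring_of_type_algebra :: 'k::field ring)\<^esub> b = a * b"
  "\<one>\<^bsub>(ring_of_type_algebra :: 'k::field ring)\<^esub> = 1"
  "\<zero>\<^bsub>(ring_of_type_algebra :: 'k::field ring)\<^esub> = 0"
  by (simp_all add: ring_of_type_algebra_def)

lemma a_inv_ring_of_type_algebra [simp]:
  "\<ominus>\<^bsub>(ring_of_type_algebra :: 'k::field ring)\<^esub> a = - a"
proof -
  interpret cring "ring_of_type_algebra :: 'k ring" by (rule cring_from_type_algebra)
  show ?thesis by (rule sum_zero_eq_neg[symmetric]) auto
qed

text \<open>
  Inside this locale the facts of the locale \<open>module\<close> become available without membership
  conditions on scalars, since the carrier of the scalar ring is the whole type.
\<close>

locale vect = module "ring_of_type_algebra :: 'k::field ring" V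
  for V :: "('k::field, 'a, 'm) module_scheme" (structure)
begin

lemma smult_closed' [simp]: "x \<in> carrier V \<Longrightarrow> c \<odot> x \<in> carrier V"
  by (rule smult_closed) auto

lemma smult_add_left: "x \<in> carrier V \<Longrightarrow> (c + d) \<odot> x = c \<odot> x \<oplus> d \<odot> x"
  using smult_l_distr[of c d x] by simp

lemma smult_add_right: "x \<in> carrier V \<Longrightarrow> y \<in> carrier V \<Longrightarrow> c \<odot> (x \<oplus> y) = c \<odot> x \<oplus> c \<odot> y"
  using smult_r_distr[of c x y] by simp

lemma smult_smult: "x \<in> carrier V \<Longrightarrow> c \<odot> (d \<odot> x) = (c * d) \<odot> x"
  using smult_assoc1[of c d x] by simp

lemma smult_1 [simp]: "x \<in> carrier V \<Longrightarrow> 1 \<odot> x = x"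
  using smult_one[of x] by simp

lemma smult_0 [simp]: "x \<in> carrier V \<Longrightarrow> 0 \<odot> x = \<zero>"
  using smult_l_null[of x] by simp

lemma smult_zero [simp]: "c \<odot> \<zero> = \<zero>"
  using smult_r_null[of c] by simp

lemma minus_as_smult: "x \<in> carrier V \<Longrightarrow> \<ominus> x = (- 1) \<odot> x"
  using smult_l_minus[of 1 x] by simp

lemma diff_as_smult: "x \<in> carrier V \<Longrightarrow> y \<in> carrier V \<Longrightarrow> x \<ominus> y = x \<oplus> (- 1) \<odot> y"
  by (simp add: M.minus_eq minus_as_smult)

lemma submodule_iff:
  "submodule N (ring_of_type_algebra :: 'k ring) V \<longleftrightarrow>
     N \<subseteq> carrier V \<and> \<zero> \<in> N \<and> (\<forall>x\<in>N. \<forall>y\<in>N. x \<oplus> y \<in> N) \<and> (\<forall>c. \<forall>x\<in>N. c \<odot> x \<in> N)"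
    (is "?L \<longleftrightarrow> ?R")
proof
  assume ?L
  then interpret N: submodule N "ring_of_type_algebra :: 'k ring" V .
  show ?R using N.subset N.m_closed N.one_closed N.smult_closed by auto
next
  assume ?R
  then show ?L by (intro submoduleI) (auto simp: subset_iff minus_as_smult)
qed

lemma diff_eq_zero_iff: "x \<in> carrier V \<Longrightarrow> y \<in> carrier V \<Longrightarrow> x \<ominus> y = \<zero> \<longleftrightarrow> x = y"
  by (metis M.add.inv_closed M.add.inv_unique' M.add.l_inv M.minus_eq M.r_neg M.a_comm M.minus_minus M.minus_equality)

lemma submodule_diff:
  assumes "submodule N ring_of_type_algebra V" "x \<in> N" "y \<in> N" shows "x \<ominus> y \<in> N"
proof -
  have "x \<oplus> (- 1) \<odot> y \<in> N" "x \<in> carrier V" "y \<in> carrier V" using assms by (auto simp: submodule_iff)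
  then show ?thesis by (simp add: diff_as_smult)
qed

lemma diff_self: "x \<in> carrier V \<Longrightarrow> x \<ominus> x = \<zero>"
  by (simp add: M.minus_eq M.r_neg)

lemma submodule_finsum:
  assumes N: "submodule N ring_of_type_algebra V" and f: "\<And>x. x \<in> Y \<Longrightarrow> f x \<in> N"
  shows "(\<Oplus>x\<in>Y. f x) \<in> N"
  using f
proof (induction Y rule: infinite_finite_induct)
  case (insert x Y)
  then have "f x \<in> carrier V" "f \<in> Y \<rightarrow> carrier V" using N by (auto simp: submodule_iff)
  then show ?case using insert N by (simp add: submodule_iff)
qed (use N in \<open>simp_all add: submodule_iff M.finsum_infinite\<close>)

lemma submodule_hull:
  assumes "R \<subseteq> carrier V"
  shows "submodule ((\<lambda>N. submodule N (ring_of_type_algebra :: 'k ring) V) hull R)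
    (ring_of_type_algebra :: 'k ring) V"
proof -
  let ?F = "{N. submodule N (ring_of_type_algebra :: 'k ring) V \<and> R \<subseteq> N}"
  \<comment> \<open>The empty intersection is \<open>UNIV\<close>, which may exceed the carrier; so some member of the family is needed.\<close>
  have "carrier V \<in> ?F" using assms carrier_is_submodule by simp
  then have "\<Inter>?F \<subseteq> carrier V" by (rule Inter_lower)
  then have "submodule (\<Inter>?F) (ring_of_type_algebra :: 'k ring) V"
    unfolding submodule_iff by (intro conjI ballI allI) auto
  then show ?thesis by (simp add: hull_def)
qed

end

lemma vect_iff: "vect V \<longleftrightarrow> vec_space V"
  by (simp add: vect_def)

lemma linear_mapD:
  assumes "linear_map V W f"
  shows "x \<in> carrier V \<Longrightarrow> f x \<in> carrier W"
    and "x \<in> carrier V \<Longrightarrow> y \<in> carrier V \<Longrightarrow> f (x \<oplus>\<^bsub>V\<^esub> y) = f x \<oplus>\<^bsub>W\<^esub> f y"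
    and "x \<in> carrier V \<Longrightarrow> f (c \<odot>\<^bsub>V\<^esub> x) = c \<odot>\<^bsub>W\<^esub> f x"
  using assms by (auto simp: linear_map_def)

lemma linear_map_comp:
  "linear_map U V f \<Longrightarrow> linear_map V W g \<Longrightarrow> linear_map U W (\<lambda>x. g (f x))"
  by (auto simp: linear_map_def Pi_iff)

locale linear = V: vect V + W: vect W
  for V :: "('k::field, 'a, 'm) module_scheme" and W :: "('k::field, 'b, 'n) module_scheme" +
  fixes f assumes linear: "linear_map V W f"
begin

lemmas closed = linear_mapD(1)[OF linear]
lemmas add = linear_mapD(2)[OF linear]
lemmas smult = linear_mapD(3)[OF linear]

lemma zero: "f \<zero>\<^bsub>V\<^esub> = \<zero>\<^bsub>W\<^esub>"
  using smult[of "\<zero>\<^bsub>V\<^esub>" 0] closed[of "\<zero>\<^bsub>V\<^esub>"] by simp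

lemma minus: "x \<in> carrier V \<Longrightarrow> y \<in> carrier V \<Longrightarrow> f (x \<ominus>\<^bsub>V\<^esub> y) = f x \<ominus>\<^bsub>W\<^esub> f y"
  by (simp add: V.diff_as_smult W.diff_as_smult add smult closed)

lemma submodule_kernel: "submodule {x \<in> carrier V. f x = \<zero>\<^bsub>W\<^esub>} ring_of_type_algebra V"
  unfolding V.submodule_iff by (auto simp: zero add smult)

lemma submodule_vimage:
  "submodule N ring_of_type_algebra W \<Longrightarrow> submodule {x \<in> carrier V. f x \<in> N} ring_of_type_algebra V"
  unfolding V.submodule_iff W.submodule_iff by (auto simp: zero add smult)

end

lemma linearI: "vec_space V \<Longrightarrow> vec_space W \<Longrightarrow> linear_map V W f \<Longrightarrow> linear V W f"
  by (simp add: linear_def linear_axioms_def vect_iff)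

locale homalg =
  fixes A :: "('k::field, 'a, 'm) hom_alg_scheme" (structure)
  assumes hom_algebra: "hom_algebra A"

sublocale homalg \<subseteq> vect A
  using hom_algebra by (simp add: hom_algebra_def vect_iff)

context homalg begin

lemma vec_space: "vec_space A" using hom_algebra by (simp add: hom_algebra_def)

lemma linear_mult_left: "x \<in> carrier A \<Longrightarrow> linear_map A A (\<lambda>y. x \<otimes> y)"
  and linear_mult_right: "x \<in> carrier A \<Longrightarrow> linear_map A A (\<lambda>y. y \<otimes> x)"
  and linear_twist: "linear_map A A (twist A)"
  and twist_mult: "x \<in> carrier A \<Longrightarrow> y \<in> carrier A \<Longrightarrow> twist A (x \<otimes> y) = twist A x \<otimes> twist A y"
  using hom_algebra by (auto simp: hom_algebra_def)

lemmas linear_left = linearI[OF vec_space vec_space linear_mult_left]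
lemmas linear_right = linearI[OF vec_space vec_space linear_mult_right]

sublocale tw: linear A A "twist A"
  by (rule linearI[OF vec_space vec_space linear_twist])

declare tw.closed [simp] tw.zero [simp]

lemma mult_closed [simp]: "x \<in> carrier A \<Longrightarrow> y \<in> carrier A \<Longrightarrow> x \<otimes> y \<in> carrier A"
  using linear_mult_left linear_mapD(1) by metis

lemma mult_add_left: "\<lbrakk>x \<in> carrier A; y \<in> carrier A; z \<in> carrier A\<rbrakk> \<Longrightarrow> (x \<oplus> y) \<otimes> z = x \<otimes> z \<oplus> y \<otimes> z"
  using linear.add[OF linear_right] .
lemma mult_add_right: "\<lbrakk>x \<in> carrier A; y \<in> carrier A; z \<in> carrier A\<rbrakk> \<Longrightarrow> z \<otimes> (x \<oplus> y) = z \<otimes> x \<oplus> z \<otimes> y"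
  using linear.add[OF linear_left] .
lemma mult_smult_left: "\<lbrakk>x \<in> carrier A; z \<in> carrier A\<rbrakk> \<Longrightarrow> (c \<odot> x) \<otimes> z = c \<odot> (x \<otimes> z)"
  using linear.smult[OF linear_right] .
lemma mult_smult_right: "\<lbrakk>x \<in> carrier A; z \<in> carrier A\<rbrakk> \<Longrightarrow> z \<otimes> (c \<odot> x) = c \<odot> (z \<otimes> x)"
  using linear.smult[OF linear_left] .
lemma mult_zero_left [simp]: "z \<in> carrier A \<Longrightarrow> \<zero> \<otimes> z = \<zero>"
  using linear.zero[OF linear_right] .
lemma mult_zero_right [simp]: "z \<in> carrier A \<Longrightarrow> z \<otimes> \<zero> = \<zero>"
  using linear.zero[OF linear_left] .

lemma idealD:
  assumes "hom_alg_ideal A I"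
  shows "I \<subseteq> carrier A" and "\<zero> \<in> I" and "x \<in> I \<Longrightarrow> y \<in> I \<Longrightarrow> x \<oplus> y \<in> I" and "x \<in> I \<Longrightarrow> c \<odot> x \<in> I"
    and "a \<in> carrier A \<Longrightarrow> x \<in> I \<Longrightarrow> a \<otimes> x \<in> I" and "a \<in> carrier A \<Longrightarrow> x \<in> I \<Longrightarrow> x \<otimes> a \<in> I"
  using assms by (auto simp: hom_alg_ideal_def submodule_iff)

lemma hom_alg_ideal_hull:
  assumes "R \<subseteq> carrier A"
  shows "hom_alg_ideal A (hom_alg_ideal A hull R)"
proof -
  let ?F = "{N. hom_alg_ideal A N \<and> R \<subseteq> N}"
  have "carrier A \<in> ?F" using assms carrier_is_submodule by (simp add: hom_alg_ideal_def)
  then have "\<Inter>?F \<subseteq> carrier A" by (rule Inter_lower)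
  then have "hom_alg_ideal A (\<Inter>?F)"
    unfolding hom_alg_ideal_def submodule_iff by (intro conjI ballI allI) auto
  then show ?thesis by (simp add: hull_def)
qed

end

locale unital_homalg = fixes A :: "('k::field, 'a, 'm) hom_alg_scheme" (structure)
  assumes unitary: "unitary_hom_algebra A"

sublocale unital_homalg \<subseteq> homalg A
  using unitary by unfold_locales (simp add: unitary_hom_algebra_def)

context unital_homalg begin

lemma unit_closed [simp]: "\<one> \<in> carrier A"
  and unit_left [simp]: "x \<in> carrier A \<Longrightarrow> \<one> \<otimes> x = twist A x"
  and unit_right [simp]: "x \<in> carrier A \<Longrightarrow> x \<otimes> \<one> = twist A x"
  and twist_unit [simp]: "twist A \<one> = \<one>"
  using unitary by (auto simp: unitary_hom_algebra_def)

text \<open>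
  The twisting map is multiplication by the unit.
\<close>

lemma ideal_twist_closed: "hom_alg_ideal A I \<Longrightarrow> x \<in> I \<Longrightarrow> twist A x \<in> I"
  using unit_left[of x] idealD(1,5)[of I] unit_closed by (metis subsetD)

end

lemma hom_alg_morphismD:
  assumes "hom_alg_morphism A B f"
  shows "linear_map A B f"
    and "x \<in> carrier A \<Longrightarrow> f x \<in> carrier B"
    and "x \<in> carrier A \<Longrightarrow> y \<in> carrier A \<Longrightarrow> f (x \<otimes>\<^bsub>A\<^esub> y) = f x \<otimes>\<^bsub>B\<^esub> f y"
    and "x \<in> carrier A \<Longrightarrow> f (twist A x) = twist B (f x)"
  using assms by (auto simp: hom_alg_morphism_def linear_map_def)

lemma hom_alg_morphism_comp:
  "hom_alg_morphism A B f \<Longrightarrow> hom_alg_morphism B C g \<Longrightarrow> hom_alg_morphism A C (\<lambda>x. g (f x))"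
  by (auto simp: hom_alg_morphism_def linear_map_def Pi_iff)

text \<open>
  Together with the minimality of a hull, this reduces the vanishing of a morphism on a generated ideal
  to its vanishing on the generators.
\<close>

lemma ideal_kernel:
  assumes A: "hom_algebra A" and B: "hom_algebra B" and f: "hom_alg_morphism A B f"
  shows "hom_alg_ideal A {x \<in> carrier A. f x = \<zero>\<^bsub>B\<^esub>}"
proof -
  interpret A: homalg A by (rule homalg.intro[OF A])
  interpret B: homalg B by (rule homalg.intro[OF B])
  interpret linear A B f by (rule linearI[OF A.vec_space B.vec_space hom_alg_morphismD(1)[OF f]])
  show ?thesis
    using submodule_kernel by (simp add: hom_alg_ideal_def hom_alg_morphismD[OF f] closed)
qed

section \<open>Quotients by ideals\<close>

locale quotient = homalg A for A :: "('k::field, 'a, 'm) hom_alg_scheme" (structure) +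
  fixes I assumes ideal: "hom_alg_ideal A I" and ideal_twist: "x \<in> I \<Longrightarrow> twist A x \<in> I"
begin

lemmas ideal_subset = idealD(1)[OF ideal]

lemma ideal_carrier [simp]: "x \<in> I \<Longrightarrow> x \<in> carrier A"
  using ideal_subset by auto

sublocale abelian_subgroup I A
proof (rule abelian_subgroupI3)
  have "subgroup I (add_monoid A)"
    using ideal by (simp add: hom_alg_ideal_def submodule_def)
  then show "additive_subgroup I A" by (rule additive_subgroup.intro)
qed (rule M.abelian_group_axioms)

lemma coset_eq_iff: "x \<in> carrier A \<Longrightarrow> y \<in> carrier A \<Longrightarrow> I +> x = I +> y \<longleftrightarrow> x \<ominus> y \<in> I"
  using a_rcos_module[of y x] a_repr_independence[of x I y] a_rcos_self[of x] a_subgroup by (auto simp: M.minus_eq)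

lemma coset_zero_iff: "x \<in> carrier A \<Longrightarrow> I +> x = I \<longleftrightarrow> x \<in> I"
  by (metis a_coset_join1 a_coset_join2 a_subgroup)

lemma coset_add_ideal: "h \<in> I \<Longrightarrow> x \<in> carrier A \<Longrightarrow> I +> (h \<oplus> x) = I +> x"
  by (metis a_repr_independence a_rcosI ideal_subset a_subgroup)

text \<open>
  The operations of a quotient are unions over cosets; the union collapses to a single coset when the
  operation is compatible with the ideal.
\<close>

lemma UN_coset:
  assumes "x \<in> carrier A" and "\<And>h. h \<in> I \<Longrightarrow> g (h \<oplus> x) = g x"
  shows "(\<Union>y\<in>I +> x. g y) = g x"
proof -
  have "g y = g x" if "y \<in> I +> x" for y
    using that assms(2) by (auto simp: a_r_coset_def')
  then show ?thesis using a_rcos_self[OF assms(1)] by blast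
qed

lemma quot_carrier: "carrier (quot_alg A I) = (\<lambda>x. I +> x) ` carrier A"
  by (auto simp: quot_alg_def A_RCOSETS_def')

lemma quot_add: "x \<in> carrier A \<Longrightarrow> y \<in> carrier A \<Longrightarrow>
    (I +> x) \<oplus>\<^bsub>quot_alg A I\<^esub> (I +> y) = I +> (x \<oplus> y)"
  by (simp add: quot_alg_def a_rcos_sum)

lemma quot_zero: "\<zero>\<^bsub>quot_alg A I\<^esub> = I"
  by (simp add: quot_alg_def)

lemma quot_one: "\<one>\<^bsub>quot_alg A I\<^esub> = I +> \<one>"
  by (simp add: quot_alg_def)

lemma quot_smult: "x \<in> carrier A \<Longrightarrow> c \<odot>\<^bsub>quot_alg A I\<^esub> (I +> x) = I +> (c \<odot> x)"
  by (simp add: quot_alg_def UN_coset smult_add_right coset_add_ideal idealD(4)[OF ideal])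

lemma quot_twist: "x \<in> carrier A \<Longrightarrow> twist (quot_alg A I) (I +> x) = I +> twist A x"
  by (simp add: quot_alg_def UN_coset tw.add coset_add_ideal ideal_twist)

lemma quot_mult:
  assumes "x \<in> carrier A" "y \<in> carrier A"
  shows "(I +> x) \<otimes>\<^bsub>quot_alg A I\<^esub> (I +> y) = I +> (x \<otimes> y)"
proof -
  \<comment> \<open>A product of cosets is a union over two representatives; each of them is replaced in turn.\<close>
  have 1: "I +> ((h \<oplus> x) \<otimes> b) = I +> (x \<otimes> b)" if "h \<in> I" "b \<in> carrier A" for h b
    using that assms by (simp add: mult_add_left coset_add_ideal idealD(6)[OF ideal])
  have 2: "I +> (x \<otimes> (k \<oplus> y)) = I +> (x \<otimes> y)" if "k \<in> I" for k
    using that assms by (simp add: mult_add_right coset_add_ideal idealD(5)[OF ideal])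
  have "(\<Union>b\<in>I +> y. I +> (a \<otimes> b)) = I +> (x \<otimes> y)" if a: "a \<in> I +> x" for a
  proof -
    obtain h where h: "h \<in> I" "a = h \<oplus> x" using a by (auto simp: a_r_coset_def')
    have "(\<Union>b\<in>I +> y. I +> (a \<otimes> b)) = (\<Union>b\<in>I +> y. I +> (x \<otimes> b))"
    proof (rule SUP_cong[OF refl])
      fix b assume "b \<in> I +> y"
      then have "b \<in> carrier A" using assms(2) a_r_coset_subset_G ideal_subset by blast
      then show "I +> (a \<otimes> b) = I +> (x \<otimes> b)" using h 1 by simp
    qed
    also have "\<dots> = I +> (x \<otimes> y)" by (rule UN_coset[OF assms(2)]) (rule 2)
    finally show ?thesis .
  qed
  then have "(\<Union>a\<in>I +> x. \<Union>b\<in>I +> y. I +> (a \<otimes> b)) = (\<Union>a\<in>I +> x. I +> (x \<otimes> y))"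
    by (rule SUP_cong[OF refl])
  also have "\<dots> = I +> (x \<otimes> y)" by (rule UN_coset[OF assms(1)]) (rule refl)
  finally show ?thesis by (simp add: quot_alg_def rcoset_mult_def)
qed

lemmas quot_ops = quot_add quot_smult quot_twist quot_mult

lemma hom_algebra_quot: "hom_algebra (quot_alg A I)"
proof -
  let ?Q = "quot_alg A I"
  have zero: "\<zero>\<^bsub>?Q\<^esub> = I +> \<zero>" by (metis quot_zero M.zero_closed coset_zero_iff idealD(2)[OF ideal])
  have "abelian_group ?Q"
  proof (rule abelian_groupI)
    fix P assume "P \<in> carrier ?Q"
    then obtain x where x: "x \<in> carrier A" "P = I +> x" by (auto simp: quot_carrier)
    have "(I +> \<ominus> x) \<oplus>\<^bsub>?Q\<^esub> P = \<zero>\<^bsub>?Q\<^esub>" using x by (simp add: quot_add zero M.l_neg)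
    then show "\<exists>y\<in>carrier ?Q. y \<oplus>\<^bsub>?Q\<^esub> P = \<zero>\<^bsub>?Q\<^esub>" using x by (auto simp: quot_carrier)
  qed (auto simp: quot_carrier quot_add zero M.a_ac)
  then have vec: "vec_space ?Q"
    by (intro moduleI cring_from_type_algebra)
       (auto simp: quot_carrier quot_ops smult_add_left smult_add_right smult_smult)
  then show ?thesis
    by (auto simp: hom_algebra_def linear_map_def quot_carrier quot_ops mult_add_left mult_add_right
        mult_smult_left mult_smult_right tw.add tw.smult twist_mult)
qed

lemma hom_alg_morphism_proj: "hom_alg_morphism A (quot_alg A I) (\<lambda>x. I +> x)"
  by (auto simp: hom_alg_morphism_def linear_map_def quot_carrier quot_ops)

lemma unitary_quot:
  assumes "unitary_hom_algebra A"
  shows "unitary_hom_algebra (quot_alg A I)"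
proof -
  interpret unital_homalg A by (rule unital_homalg.intro[OF assms])
  show ?thesis using hom_algebra_quot
    by (auto simp: unitary_hom_algebra_def quot_carrier quot_one quot_ops)
qed

lemma quot_lift_morphism:
  assumes g: "\<And>x. x \<in> carrier A \<Longrightarrow> g (I +> x) = f x" and f: "hom_alg_morphism A W f"
  shows "hom_alg_morphism (quot_alg A I) W g"
  using f by (auto simp: hom_alg_morphism_def linear_map_def quot_carrier quot_ops g)

lemma quot_lift:
  assumes W: "hom_algebra W" and f: "hom_alg_morphism A W f" and 0: "\<And>x. x \<in> I \<Longrightarrow> f x = \<zero>\<^bsub>W\<^esub>"
  obtains g where "hom_alg_morphism (quot_alg A I) W g" "\<And>x. x \<in> carrier A \<Longrightarrow> g (I +> x) = f x"
proof -
  interpret W: homalg W by (rule homalg.intro[OF W])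
  interpret f: linear A W f by (rule linearI[OF vec_space W.vec_space hom_alg_morphismD(1)[OF f]])
  \<comment> \<open>A morphism that kills the ideal is constant on every coset.\<close>
  define g where "g P = the_elem (f ` P)" for P
  have g: "g (I +> x) = f x" if x: "x \<in> carrier A" for x
  proof -
    have "f ` (I +> x) = {f x}"
      using a_rcos_self[OF x] x by (force simp: a_r_coset_def' f.add 0 f.closed)
    then show ?thesis by (simp add: g_def)
  qed
  show thesis using that quot_lift_morphism[OF g f] g by blast
qed

end

text \<open>
  The union in this statement has the shape of \<^const>\<open>tensor_map\<close>, so that maps between tensor
  products are an instance.
\<close>

lemma quot_map:
  assumes "quotient A I" "quotient A' I'" and h: "hom_alg_morphism A A' h"
    and sub: "\<And>x. x \<in> I \<Longrightarrow> h x \<in> I'"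
  defines "g \<equiv> \<lambda>P. \<Union>x\<in>P. I' +>\<^bsub>A'\<^esub> h x"
  shows "x \<in> carrier A \<Longrightarrow> g (I +>\<^bsub>A\<^esub> x) = I' +>\<^bsub>A'\<^esub> h x"
    and "hom_alg_morphism (quot_alg A I) (quot_alg A' I') g"
proof -
  interpret A: quotient A I by fact
  interpret A': quotient A' I' by fact
  interpret h: linear A A' h by (rule linearI[OF A.vec_space A'.vec_space hom_alg_morphismD(1)[OF h]])
  show g: "g (I +>\<^bsub>A\<^esub> x) = I' +>\<^bsub>A'\<^esub> h x" if "x \<in> carrier A" for x
    unfolding g_def using that by (intro A.UN_coset) (auto simp: h.add h.closed A'.coset_add_ideal sub)
  show "hom_alg_morphism (quot_alg A I) (quot_alg A' I') g"
    by (rule A.quot_lift_morphism[OF g hom_alg_morphism_comp[OF h A'.hom_alg_morphism_proj]])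
qed

section \<open>Algebras with a given basis\<close>

abbreviation keys where "keys \<equiv> Poly_Mapping.keys"
abbreviation lookup where "lookup \<equiv> Poly_Mapping.lookup"
abbreviation single where "single \<equiv> Poly_Mapping.single"

text \<open>
  Identities of additive maps only have to be checked on multiples of basis vectors; this replaces
  manipulations of double sums over supports.
\<close>

lemma keys_induct:
  fixes p :: "'x \<Rightarrow>\<^sub>0 'k::field"
  assumes "keys p \<subseteq> B" and zero: "P 0" and single: "\<And>x c. x \<in> B \<Longrightarrow> P (single x c)"
    and plus: "\<And>p q. keys p \<subseteq> B \<Longrightarrow> keys q \<subseteq> B \<Longrightarrow> P p \<Longrightarrow> P q \<Longrightarrow> P (p + q)"
  shows "P p"
proof -
  have "keys p \<subseteq> F \<Longrightarrow> P p" if "finite F" "F \<subseteq> B" for F p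
    using that
  proof (induction F arbitrary: p)
    case empty
    then show ?case using zero by simp
  next
    case (insert x F)
    define q where "q = p - single x (lookup p x)"
    have lq: "lookup q y = (if y = x then 0 else lookup p y)" for y
      by (auto simp: q_def lookup_minus lookup_single when_def)
    have "y \<in> keys p" if "y \<in> keys q" for y
      using that by (auto simp: in_keys_iff lq split: if_splits)
    moreover have "x \<notin> keys q" by (simp add: in_keys_iff lq)
    ultimately have q: "keys q \<subseteq> F" using insert.prems by auto
    have "P (q + single x (lookup p x))"
      using insert q by (intro plus single) auto
    then show ?case by (simp add: q_def)
  qed
  from this[of "keys p" p] assms(1) show ?thesis by simp
qed

definition basis_mult where
  "basis_mult f p r = (\<Sum>x\<in>keys p. \<Sum>y\<in>keys r.
     single (f x y) (lookup p x * lookup r y :: 'k::field))"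

lemma basis_mult_add_left: "basis_mult f (p + q) r = basis_mult f p r + basis_mult f q r"
  unfolding basis_mult_def
  by (rule setsum_keys_plus_distrib) (auto simp: distrib_right single_add sum.distrib)

lemma basis_mult_add_right: "basis_mult f r (p + q) = basis_mult f r p + basis_mult f r q"
  unfolding basis_mult_def sum.distrib[symmetric]
  by (intro sum.cong refl setsum_keys_plus_distrib) (auto simp: distrib_left single_add)

lemma basis_mult_zero [simp]: "basis_mult f 0 r = 0" "basis_mult f p 0 = 0"
  by (auto simp: basis_mult_def)

lemma basis_mult_single [simp]: "basis_mult f (single x a) (single y b) = single (f x y) (a * b)"
  by (auto simp: basis_mult_def)

lemma keys_basis_mult:
  assumes "keys p \<subseteq> B" "keys r \<subseteq> B" and f: "\<And>x y. x \<in> B \<Longrightarrow> y \<in> B \<Longrightarrow> f x y \<in> B"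
  shows "keys (basis_mult f p r) \<subseteq> B"
  unfolding basis_mult_def using assms
  by (intro subset_trans[OF keys_sum] UN_least subset_trans[OF keys_sum]) (auto split: if_splits)

lemma basis_map_add: "basis_map h (p + q) = basis_map h p + basis_map h q"
  unfolding basis_map_def by (rule setsum_keys_plus_distrib) (auto simp: single_add)

lemma basis_map_diff: "basis_map h (p - q) = basis_map h p - basis_map h q"
  using basis_map_add[of h "p - q" q] by (simp add: algebra_simps)

lemma basis_map_zero [simp]: "basis_map h 0 = 0"
  by (simp add: basis_map_def)

lemma basis_map_single [simp]: "basis_map h (single x a) = single (h x) a"
  by (auto simp: basis_map_def)

lemma keys_basis_map: "keys p \<subseteq> B \<Longrightarrow> h ` B \<subseteq> B' \<Longrightarrow> keys (basis_map h p) \<subseteq> B'"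
  unfolding basis_map_def by (intro subset_trans[OF keys_sum] UN_least) (auto split: if_splits)

lemma keys_add_subset: "keys p \<subseteq> B \<Longrightarrow> keys q \<subseteq> B \<Longrightarrow> keys (p + q) \<subseteq> B"
  using keys_add[of p q] by blast

lemma keys_diff_subset: "keys p \<subseteq> B \<Longrightarrow> keys q \<subseteq> B \<Longrightarrow> keys (p - q) \<subseteq> B"
  using keys_diff[of p q] by blast

abbreviation scale :: "'k::field \<Rightarrow> ('x \<Rightarrow>\<^sub>0 'k) \<Rightarrow> ('x \<Rightarrow>\<^sub>0 'k)" where
  "scale c \<equiv> Poly_Mapping.map ((*) c)"

lemma lookup_scale [simp]: "lookup (scale c p) x = c * lookup p x"
  by (simp add: Poly_Mapping.map.rep_eq when_def)

lemma keys_scale: "keys p \<subseteq> B \<Longrightarrow> keys (scale c p) \<subseteq> B"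
  by (auto simp: in_keys_iff subset_iff)

lemma scale_add: "scale c (p + q) = scale c p + scale c q"
  by (rule poly_mapping_eqI) (simp add: lookup_add distrib_left)

lemma scale_single [simp]: "scale c (single x a) = single x (c * a)"
  by (rule poly_mapping_eqI) (auto simp: lookup_single when_def)

lemma scale_zero [simp]: "scale c 0 = 0"
  by (rule poly_mapping_eqI) simp

lemma basis_mult_scale_left: "basis_mult f (scale c p) r = scale c (basis_mult f p r)"
proof (rule keys_induct[of p UNIV]; simp add: basis_mult_add_left scale_add)
  fix x a show "basis_mult f (single x (c * a)) r = scale c (basis_mult f (single x a) r)"
    by (rule keys_induct[of r UNIV]) (simp_all add: basis_mult_add_right scale_add mult.assoc)
qed

lemma basis_mult_scale_right: "basis_mult f r (scale c p) = scale c (basis_mult f r p)"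
proof (rule keys_induct[of p UNIV]; simp add: basis_mult_add_right scale_add)
  fix x a show "basis_mult f r (single x (c * a)) = scale c (basis_mult f r (single x a))"
    by (rule keys_induct[of r UNIV]) (simp_all add: basis_mult_add_left scale_add mult.left_commute)
qed

lemma basis_map_scale: "basis_map h (scale c p) = scale c (basis_map h p)"
  by (rule keys_induct[of p UNIV]) (simp_all add: basis_map_add scale_add)

lemma basis_map_mult:
  assumes "keys p \<subseteq> B" "keys r \<subseteq> B" and h: "\<And>x y. x \<in> B \<Longrightarrow> y \<in> B \<Longrightarrow> h (f x y) = f' (h x) (h y)"
  shows "basis_map h (basis_mult f p r) = basis_mult f' (basis_map h p) (basis_map h r)"
  using assms(1)
proof (rule keys_induct; simp add: basis_mult_add_left basis_map_add)
  fix x a assume x: "x \<in> B"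
  show "basis_map h (basis_mult f (single x a) r) = basis_mult f' (single (h x) a) (basis_map h r)"
    using assms(2) by (rule keys_induct) (simp_all add: basis_mult_add_right basis_map_add x h)
qed

lemma basis_map_comp: "basis_map g (basis_map h p) = basis_map (\<lambda>x. g (h x)) p"
  by (rule keys_induct[of p UNIV]) (simp_all add: basis_map_add)

lemma basis_map_cong:
  assumes "keys p \<subseteq> B" and "\<And>x. x \<in> B \<Longrightarrow> g x = h x" shows "basis_map g p = basis_map h p"
  using assms(1) by (rule keys_induct) (simp_all add: basis_map_add assms(2))

lemma basis_alg_simps [simp]:
  "carrier (basis_alg B f e t) = {p. keys p \<subseteq> B}"
  "p \<otimes>\<^bsub>basis_alg B f e t\<^esub> r = basis_mult f p r"
  "\<one>\<^bsub>basis_alg B f e t\<^esub> = basis_vec e"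
  "\<zero>\<^bsub>basis_alg B f e t\<^esub> = 0"
  "p \<oplus>\<^bsub>basis_alg B f e t\<^esub> r = p + r"
  "c \<odot>\<^bsub>basis_alg B f e t\<^esub> p = scale c p"
  "twist (basis_alg B f e t) = basis_map t"
  by (simp_all add: basis_alg_def basis_mult_def)

lemma hom_algebra_basis_alg:
  assumes f: "\<And>x y. x \<in> B \<Longrightarrow> y \<in> B \<Longrightarrow> f x y \<in> B" and t: "\<And>x. x \<in> B \<Longrightarrow> t x \<in> B"
    and hom: "\<And>x y. x \<in> B \<Longrightarrow> y \<in> B \<Longrightarrow> t (f x y) = f (t x) (t y)"
  shows "hom_algebra (basis_alg B f e t :: ('k::field, _) hom_alg)"
proof -
  let ?A = "basis_alg B f e t :: ('k, _) hom_alg"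
  have "abelian_group ?A"
    by (rule abelian_groupI)
       (auto simp: keys_add_subset add_ac intro!: exI[of _ "- _"])
  then have "vec_space ?A"
    by (intro moduleI cring_from_type_algebra)
       (auto simp: keys_scale scale_add intro!: poly_mapping_eqI simp: lookup_add algebra_simps)
  moreover have "basis_map t (basis_mult f p r) = basis_mult f (basis_map t p) (basis_map t r)"
    if "keys p \<subseteq> B" "keys r \<subseteq> B" for p r :: "_ \<Rightarrow>\<^sub>0 'k"
    using that by (rule basis_map_mult) (rule hom)
  ultimately show ?thesis using f t
    by (auto simp: hom_algebra_def linear_map_def keys_basis_mult basis_mult_add_left basis_mult_add_right
        basis_mult_scale_left basis_mult_scale_right keys_basis_map basis_map_add basis_map_scale
        image_subset_iff)
qed

lemma basis_alg_minus:
  assumes "hom_algebra (basis_alg B f e t :: ('k::field, _) hom_alg)" "keys p \<subseteq> B" "keys q \<subseteq> B"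
  shows "p \<ominus>\<^bsub>basis_alg B f e t :: ('k, _) hom_alg\<^esub> q = p - q"
proof -
  interpret homalg "basis_alg B f e t :: ('k, _) hom_alg" by (rule homalg.intro) fact
  show ?thesis using assms
    by (simp add: diff_as_smult) (rule poly_mapping_eqI, simp add: lookup_add lookup_minus)
qed

lemma basis_map_morphism:
  assumes "\<And>x. x \<in> B \<Longrightarrow> h x \<in> B'"
    and "\<And>x y. x \<in> B \<Longrightarrow> y \<in> B \<Longrightarrow> h (f x y) = f' (h x) (h y)"
    and "\<And>x. x \<in> B \<Longrightarrow> h (t x) = t' (h x)"
  shows "hom_alg_morphism (basis_alg B f e t :: ('k::field, _) hom_alg) (basis_alg B' f' e' t') (basis_map h)"
proof -
  have "keys (basis_map h p) \<subseteq> B'" "basis_map h (basis_map t p) = basis_map t' (basis_map h p)"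
    if "keys p \<subseteq> B" for p :: "_ \<Rightarrow>\<^sub>0 'k"
    using assms basis_map_cong[OF that, of "\<lambda>x. h (t x)" "\<lambda>x. t' (h x)"]
    by (simp_all add: basis_map_comp keys_basis_map[OF that] image_subset_iff)
  moreover have "basis_map h (basis_mult f p r) = basis_mult f' (basis_map h p) (basis_map h r)"
    if "keys p \<subseteq> B" "keys r \<subseteq> B" for p r :: "_ \<Rightarrow>\<^sub>0 'k"
    using that by (rule basis_map_mult) (rule assms(2))
  ultimately show ?thesis
    by (auto simp: hom_alg_morphism_def linear_map_def basis_map_add basis_map_scale)
qed

definition basis_lift :: "('k::field, 'b, 'm) module_scheme \<Rightarrow> ('x \<Rightarrow> 'b) \<Rightarrow> ('x \<Rightarrow>\<^sub>0 'k) \<Rightarrow> 'b" where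
  "basis_lift W g p = (\<Oplus>\<^bsub>W\<^esub>x\<in>keys p. lookup p x \<odot>\<^bsub>W\<^esub> g x)"

context vect begin

text \<open>
  A summation range that is independent of the support makes additivity visible.
\<close>

lemma basis_lift_superset:
  assumes "finite F" "keys p \<subseteq> F" "g ` F \<subseteq> carrier V"
  shows "basis_lift V g p = (\<Oplus>x\<in>F. lookup p x \<odot> g x)"
  unfolding basis_lift_def using assms
  by (intro M.add.finprod_mono_neutral_cong_left) (auto simp: in_keys_iff image_subset_iff)

lemma basis_lift_closed:
  assumes "keys p \<subseteq> B" "g ` B \<subseteq> carrier V" shows "basis_lift V g p \<in> carrier V"
  unfolding basis_lift_def using assms by (intro M.finsum_closed) (auto simp: subset_iff image_subset_iff)

lemma basis_lift_add:
  assumes "keys p \<subseteq> B" "keys q \<subseteq> B" "g ` B \<subseteq> carrier V"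
  shows "basis_lift V g (p + q) = basis_lift V g p \<oplus> basis_lift V g q"
proof -
  let ?F = "keys p \<union> keys q"
  have g: "g ` ?F \<subseteq> carrier V" using assms by auto
  have "basis_lift V g (p + q) = (\<Oplus>x\<in>?F. lookup p x \<odot> g x \<oplus> lookup q x \<odot> g x)"
    using g keys_add[of p q] basis_lift_superset[of ?F "p + q" g]
    by (simp add: lookup_add)
       (intro M.finsum_cong', auto simp: smult_add_left image_subset_iff)
  also have "\<dots> = (\<Oplus>x\<in>?F. lookup p x \<odot> g x) \<oplus> (\<Oplus>x\<in>?F. lookup q x \<odot> g x)"
    using g by (intro M.finsum_addf) auto
  finally show ?thesis using g basis_lift_superset[of ?F p g] basis_lift_superset[of ?F q g] by simp
qed

lemma basis_lift_single: "g x \<in> carrier V \<Longrightarrow> basis_lift V g (single x c) = c \<odot> g x"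
  using basis_lift_superset[of "{x}" "single x c" g] by simp

lemma basis_lift_scale:
  assumes "keys p \<subseteq> B" "g ` B \<subseteq> carrier V"
  shows "basis_lift V g (scale c p) = c \<odot> basis_lift V g p"
  using assms(1)
proof (rule keys_induct)
  fix p q :: "_ \<Rightarrow>\<^sub>0 'k"
  assume pq: "keys p \<subseteq> B" "keys q \<subseteq> B" and IH: "basis_lift V g (scale c p) = c \<odot> basis_lift V g p"
    "basis_lift V g (scale c q) = c \<odot> basis_lift V g q"
  show "basis_lift V g (scale c (p + q)) = c \<odot> basis_lift V g (p + q)"
    using pq keys_scale[OF pq(1), of c] keys_scale[OF pq(2), of c]
    by (simp add: scale_add basis_lift_add[OF _ _ assms(2)] IH smult_add_right
        basis_lift_closed[OF _ assms(2)])
next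
  show "basis_lift V g (scale c 0) = c \<odot> basis_lift V g 0"
    by (simp add: basis_lift_def)
next
  fix x a assume "x \<in> B"
  then show "basis_lift V g (scale c (single x a)) = c \<odot> basis_lift V g (single x a)"
    using assms(2) by (auto simp: basis_lift_single smult_smult)
qed

end

lemma basis_lift_morphism:
  assumes W: "hom_algebra W" and g: "g ` B \<subseteq> carrier W"
    and f: "\<And>x y. x \<in> B \<Longrightarrow> y \<in> B \<Longrightarrow> f x y \<in> B \<and> g (f x y) = g x \<otimes>\<^bsub>W\<^esub> g y"
    and t: "\<And>x. x \<in> B \<Longrightarrow> t x \<in> B \<and> g (t x) = twist W (g x)"
  shows "hom_alg_morphism (basis_alg B f e t :: ('k::field, _) hom_alg) W (basis_lift W g)"
proof -
  interpret homalg W by (rule homalg.intro[OF W])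
  note c = basis_lift_closed[OF _ g]
  note a = basis_lift_add[OF _ _ g]
  have gc: "x \<in> B \<Longrightarrow> g x \<in> carrier W" for x using g by auto
  have 0: "basis_lift W g 0 = \<zero>\<^bsub>W\<^esub>" by (simp add: basis_lift_def)
  have ft: "\<And>x y. x \<in> B \<Longrightarrow> y \<in> B \<Longrightarrow> f x y \<in> B" "\<And>x. x \<in> B \<Longrightarrow> t x \<in> B" using f t by auto
  have tw: "basis_lift W g (basis_map t p) = twist W (basis_lift W g p)" if "keys p \<subseteq> B" for p
    using that
    by (rule keys_induct)
       (use ft in \<open>simp_all add: 0 basis_map_add a c keys_basis_map image_subset_iff
          tw.add basis_lift_single tw.smult gc t\<close>)
  have mult: "basis_lift W g (basis_mult f p q) = basis_lift W g p \<otimes>\<^bsub>W\<^esub> basis_lift W g q"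
    if p: "keys p \<subseteq> B" and q: "keys q \<subseteq> B" for p q
    using p
  proof (rule keys_induct)
    fix p p' assume "keys p \<subseteq> B" "keys p' \<subseteq> B"
      "basis_lift W g (basis_mult f p q) = basis_lift W g p \<otimes>\<^bsub>W\<^esub> basis_lift W g q"
      "basis_lift W g (basis_mult f p' q) = basis_lift W g p' \<otimes>\<^bsub>W\<^esub> basis_lift W g q"
    then show "basis_lift W g (basis_mult f (p + p') q) = basis_lift W g (p + p') \<otimes>\<^bsub>W\<^esub> basis_lift W g q"
      using q ft by (simp add: basis_mult_add_left a c keys_basis_mult mult_add_left)
  next
    fix x b assume x: "x \<in> B"
    show "basis_lift W g (basis_mult f (single x b) q) = basis_lift W g (single x b) \<otimes>\<^bsub>W\<^esub> basis_lift W g q"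
      using q
    proof (rule keys_induct)
      fix p p' assume "keys p \<subseteq> B" "keys p' \<subseteq> B"
        "basis_lift W g (basis_mult f (single x b) p) = basis_lift W g (single x b) \<otimes>\<^bsub>W\<^esub> basis_lift W g p"
        "basis_lift W g (basis_mult f (single x b) p') = basis_lift W g (single x b) \<otimes>\<^bsub>W\<^esub> basis_lift W g p'"
      moreover have "keys (single x b) \<subseteq> B" using x by simp
      ultimately show "basis_lift W g (basis_mult f (single x b) (p + p'))
          = basis_lift W g (single x b) \<otimes>\<^bsub>W\<^esub> basis_lift W g (p + p')"
        using ft by (simp add: basis_mult_add_right a c keys_basis_mult mult_add_right)
    qed (use x ft in \<open>simp_all add: 0 basis_lift_single gc f mult_smult_left mult_smult_right smult_smult mult.commute\<close>)
  qed (simp add: 0 c q)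
  show ?thesis
    by (auto simp: hom_alg_morphism_def linear_map_def c a basis_lift_scale[OF _ g] mult tw)
qed

section \<open>Tensor products\<close>

lemma pair_alg_basis_mult: "p \<otimes>\<^bsub>pair_alg A B\<^esub> r =
    basis_mult (\<lambda>(a, b) (c, d). (a \<otimes>\<^bsub>A\<^esub> c, b \<otimes>\<^bsub>B\<^esub> d)) p r"
  by (simp add: pair_alg_def)

lemma pair_alg_simps [simp]:
  "carrier (pair_alg A B) = {p. keys p \<subseteq> carrier A \<times> carrier B}"
  "\<one>\<^bsub>pair_alg A B\<^esub> = basis_vec (\<one>\<^bsub>A\<^esub>, \<one>\<^bsub>B\<^esub>)"
  "\<zero>\<^bsub>pair_alg A B\<^esub> = 0"
  "p \<oplus>\<^bsub>pair_alg A B\<^esub> r = p + r"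
  "c \<odot>\<^bsub>pair_alg A B\<^esub> p = scale c p"
  "twist (pair_alg A B) = basis_map (map_prod (twist A) (twist B))"
  by (simp_all add: pair_alg_def)

lemma hom_algebra_pair_alg:
  assumes "hom_algebra A" "hom_algebra B"
  shows "hom_algebra (pair_alg A B)"
proof -
  interpret A: homalg A by (rule homalg.intro) fact
  interpret B: homalg B by (rule homalg.intro) fact
  show ?thesis unfolding pair_alg_def
    by (rule hom_algebra_basis_alg) (auto simp: A.twist_mult B.twist_mult)
qed

text \<open>
  The bilinear relations are natural in a pair of linear maps. Taking for \<open>\<phi>\<close> and \<open>\<psi>\<close> left or right
  multiplications, the twisting maps, or two morphisms, the same fact makes the product, the twisting
  map and the maps \<open>\<phi> \<otimes> \<psi>\<close> well defined on tensor products.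
\<close>

lemma bilinear_relations_map:
  assumes A: "hom_algebra A" and B: "hom_algebra B"
    and h: "linear_map (pair_alg A B) (pair_alg C D) h"
    and h_basis: "\<And>a b. a \<in> carrier A \<Longrightarrow> b \<in> carrier B \<Longrightarrow> h (basis_vec (a, b)) = basis_vec (\<phi> a, \<psi> b)"
    and \<phi>: "linear_map A C \<phi>" and \<psi>: "linear_map B D \<psi>"
    and x: "x \<in> bilinear_relations A B"
  shows "h x \<in> bilinear_relations C D"
proof -
  interpret A: homalg A by (rule homalg.intro) fact
  interpret B: homalg B by (rule homalg.intro) fact
  have diff: "h (p - q) = h p - h q"
    if "keys p \<subseteq> carrier A \<times> carrier B" "keys q \<subseteq> carrier A \<times> carrier B" for p q
  proof -
    have "keys (p - q) \<subseteq> carrier A \<times> carrier B"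
      using that by (rule keys_diff_subset)
    then have "h ((p - q) + q) = h (p - q) + h q"
      using linear_mapD(2)[OF h, of "p - q" q] that by simp
    then show ?thesis by (simp add: algebra_simps)
  qed
  have single: "h (single (a, b) c) = single (\<phi> a, \<psi> b) c" if "a \<in> carrier A" "b \<in> carrier B" for a b c
    using linear_mapD(3)[OF h, of "basis_vec (a, b)" c] h_basis that by simp
  show ?thesis using x unfolding bilinear_relations_def
  proof (elim UnE CollectE exE conjE, goal_cases)
    case (1 a a' b)
    then have "h x = basis_vec (\<phi> a \<oplus>\<^bsub>C\<^esub> \<phi> a', \<psi> b) - basis_vec (\<phi> a, \<psi> b) - basis_vec (\<phi> a', \<psi> b)"
      by (simp add: diff keys_diff_subset h_basis linear_mapD[OF \<phi>])
    then show ?case using 1 linear_mapD(1)[OF \<phi>] linear_mapD(1)[OF \<psi>] by blast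
  next
    case (2 a b b')
    then have "h x = basis_vec (\<phi> a, \<psi> b \<oplus>\<^bsub>D\<^esub> \<psi> b') - basis_vec (\<phi> a, \<psi> b) - basis_vec (\<phi> a, \<psi> b')"
      by (simp add: diff keys_diff_subset h_basis linear_mapD[OF \<psi>])
    then show ?case using 2 linear_mapD(1)[OF \<phi>] linear_mapD(1)[OF \<psi>] by blast
  next
    case (3 c a b)
    then have "h x = basis_vec (c \<odot>\<^bsub>C\<^esub> \<phi> a, \<psi> b) - single (\<phi> a, \<psi> b) c"
      by (simp add: diff h_basis single linear_mapD[OF \<phi>])
    then show ?case using 3 linear_mapD(1)[OF \<phi>] linear_mapD(1)[OF \<psi>] by blast
  next
    case (4 c a b)
    then have "h x = basis_vec (\<phi> a, c \<odot>\<^bsub>D\<^esub> \<psi> b) - single (\<phi> a, \<psi> b) c"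
      by (simp add: diff h_basis single linear_mapD[OF \<psi>])
    then show ?case using 4 linear_mapD(1)[OF \<phi>] linear_mapD(1)[OF \<psi>] by blast
  qed
qed

lemma bilinear_relations_carrier:
  assumes "hom_algebra A" "hom_algebra B"
  shows "bilinear_relations A B \<subseteq> carrier (pair_alg A B)"
proof -
  interpret A: homalg A by (rule homalg.intro) fact
  interpret B: homalg B by (rule homalg.intro) fact
  have "keys x \<subseteq> carrier A \<times> carrier B" if "x \<in> bilinear_relations A B" for x
    using that unfolding bilinear_relations_def by (auto del: subsetI intro!: keys_diff_subset)
  then show ?thesis by auto
qed

lemma submodule_tensor_null:
  assumes "hom_algebra A" "hom_algebra B"
  shows "submodule (tensor_null A B) ring_of_type_algebra (pair_alg A B)"
proof -
  interpret P: homalg "pair_alg A B" by (intro homalg.intro hom_algebra_pair_alg assms)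
  show ?thesis unfolding tensor_null_def
    by (rule P.submodule_hull[OF bilinear_relations_carrier[OF assms]])
qed

lemma tensor_null_map:
  assumes A: "hom_algebra A" and B: "hom_algebra B" and C: "hom_algebra C" and D: "hom_algebra D"
    and h: "linear_map (pair_alg A B) (pair_alg C D) h"
    and h_basis: "\<And>a b. a \<in> carrier A \<Longrightarrow> b \<in> carrier B \<Longrightarrow> h (basis_vec (a, b)) = basis_vec (\<phi> a, \<psi> b)"
    and \<phi>: "linear_map A C \<phi>" and \<psi>: "linear_map B D \<psi>"
    and x: "x \<in> tensor_null A B"
  shows "h x \<in> tensor_null C D"
proof -
  interpret P: homalg "pair_alg A B" by (intro homalg.intro hom_algebra_pair_alg A B)
  interpret P': homalg "pair_alg C D" by (intro homalg.intro hom_algebra_pair_alg C D)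
  interpret h: linear "pair_alg A B" "pair_alg C D" h by (rule linearI[OF P.vec_space P'.vec_space h])
  have "tensor_null A B \<subseteq> {x \<in> carrier (pair_alg A B). h x \<in> tensor_null C D}"
    unfolding tensor_null_def[of A B]
  proof (rule hull_minimal)
    show "submodule {x \<in> carrier (pair_alg A B). h x \<in> tensor_null C D} ring_of_type_algebra (pair_alg A B)"
      by (rule h.submodule_vimage[OF submodule_tensor_null[OF C D]])
    show "bilinear_relations A B \<subseteq> {x \<in> carrier (pair_alg A B). h x \<in> tensor_null C D}"
      using bilinear_relations_carrier[OF A B] bilinear_relations_map[OF A B h h_basis \<phi> \<psi>]
      unfolding tensor_null_def by (blast intro: hull_inc)
  qed
  with x show ?thesis by blast
qed

text \<open>
  Multiplication by a multiple of a basis vector is induced by a pair of linear maps, so it preserves the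
  null space by naturality; a general factor is a sum of such multiples.
\<close>

lemma quotient_tensor_null:
  assumes A: "hom_algebra A" and B: "hom_algebra B"
  shows "quotient (pair_alg A B) (tensor_null A B)"
proof -
  interpret A: homalg A by (rule homalg.intro) fact
  interpret B: homalg B by (rule homalg.intro) fact
  interpret P: homalg "pair_alg A B" by (intro homalg.intro hom_algebra_pair_alg A B)
  let ?N = "tensor_null A B"
  let ?f = "\<lambda>(a, b) (c, d). (a \<otimes>\<^bsub>A\<^esub> c, b \<otimes>\<^bsub>B\<^esub> d)"
  note N = submodule_tensor_null[OF A B, unfolded P.submodule_iff, simplified]
  note map = tensor_null_map[OF A B A B]
  have "basis_mult ?f p x \<in> ?N \<and> basis_mult ?f x p \<in> ?N"
    if p: "keys p \<subseteq> carrier A \<times> carrier B" and x: "x \<in> ?N" for p x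
    using p
  proof (rule keys_induct)
    fix ab c assume ab: "ab \<in> carrier A \<times> carrier B"
    then obtain a b where [simp]: "ab = (a, b)" and a: "a \<in> carrier A" and b: "b \<in> carrier B" by auto
    have v: "basis_vec (a, b) \<in> carrier (pair_alg A B)" using a b by simp
    have "basis_mult ?f (basis_vec (a, b)) x \<in> ?N"
      by (rule map[OF P.linear_mult_left[OF v, unfolded pair_alg_basis_mult] _
            A.linear_mult_left[OF a] B.linear_mult_left[OF b] x]) simp
    moreover have "basis_mult ?f x (basis_vec (a, b)) \<in> ?N"
      by (rule map[OF P.linear_mult_right[OF v, unfolded pair_alg_basis_mult] _
            A.linear_mult_right[OF a] B.linear_mult_right[OF b] x]) simp
    ultimately have "scale c (basis_mult ?f (basis_vec (a, b)) x) \<in> ?N \<and>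
        scale c (basis_mult ?f x (basis_vec (a, b))) \<in> ?N"
      using N by blast
    then show "basis_mult ?f (single ab c) x \<in> ?N \<and> basis_mult ?f x (single ab c) \<in> ?N"
      using basis_mult_scale_left[of ?f c "basis_vec (a, b)" x]
        basis_mult_scale_right[of ?f x c "basis_vec (a, b)"] by simp
  qed (use N in \<open>auto simp: basis_mult_add_left basis_mult_add_right\<close>)
  then have "hom_alg_ideal (pair_alg A B) ?N"
    using submodule_tensor_null[OF A B] by (simp add: hom_alg_ideal_def pair_alg_basis_mult)
  moreover have "twist (pair_alg A B) x \<in> ?N" if "x \<in> ?N" for x
    by (rule map[OF P.linear_twist _ A.linear_twist B.linear_twist that]) simp
  ultimately show ?thesis by unfold_locales
qed

locale tensor_product =
  fixes A :: "('k::field, 'a, 'm) hom_alg_scheme" and B :: "('k, 'b, 'n) hom_alg_scheme"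
  assumes A: "hom_algebra A" and B: "hom_algebra B"
begin

sublocale A: homalg A by (rule homalg.intro[OF A])
sublocale B: homalg B by (rule homalg.intro[OF B])
sublocale P: quotient "pair_alg A B" "tensor_null A B" by (rule quotient_tensor_null[OF A B])

lemma relation_zero: "x \<in> bilinear_relations A B \<Longrightarrow> x \<in> tensor_null A B"
  unfolding tensor_null_def by (rule hull_inc)

lemma coset_eqI:
  assumes "keys p \<subseteq> carrier A \<times> carrier B" "keys q \<subseteq> carrier A \<times> carrier B" "p - q \<in> tensor_null A B"
  shows "tensor_null A B +>\<^bsub>pair_alg A B\<^esub> p = tensor_null A B +>\<^bsub>pair_alg A B\<^esub> q"
  using P.coset_add_ideal[of "p - q" q] assms by simp

lemma bilinear_relationsI:
  assumes "a \<in> carrier A" "b \<in> carrier B"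
  shows "a' \<in> carrier A \<Longrightarrow> basis_vec (a \<oplus>\<^bsub>A\<^esub> a', b) - (basis_vec (a, b) + basis_vec (a', b)) \<in> tensor_null A B"
    and "b' \<in> carrier B \<Longrightarrow> basis_vec (a, b \<oplus>\<^bsub>B\<^esub> b') - (basis_vec (a, b) + basis_vec (a, b')) \<in> tensor_null A B"
    and "basis_vec (c \<odot>\<^bsub>A\<^esub> a, b) - single (a, b) c \<in> tensor_null A B"
    and "basis_vec (a, c \<odot>\<^bsub>B\<^esub> b) - single (a, b) c \<in> tensor_null A B"
  using assms unfolding diff_diff_eq[symmetric]
  by (intro relation_zero; unfold bilinear_relations_def; blast)+

context fixes a b assumes a [simp]: "a \<in> carrier A" and b [simp]: "b \<in> carrier B"
begin

lemma tensor_closed [simp]: "tensor A B a b \<in> carrier (tensor_alg A B)"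
  unfolding tensor_def tensor_alg_def P.quot_carrier by (rule imageI) simp

lemma tensor_add_left:
  "a' \<in> carrier A \<Longrightarrow> tensor A B (a \<oplus>\<^bsub>A\<^esub> a') b = tensor A B a b \<oplus>\<^bsub>tensor_alg A B\<^esub> tensor A B a' b"
  unfolding tensor_def tensor_alg_def
  by (subst P.quot_add, simp, simp, rule coset_eqI) (simp_all add: keys_add_subset bilinear_relationsI)

lemma tensor_add_right:
  "b' \<in> carrier B \<Longrightarrow> tensor A B a (b \<oplus>\<^bsub>B\<^esub> b') = tensor A B a b \<oplus>\<^bsub>tensor_alg A B\<^esub> tensor A B a b'"
  unfolding tensor_def tensor_alg_def
  by (subst P.quot_add, simp, simp, rule coset_eqI) (simp_all add: keys_add_subset bilinear_relationsI)

lemma tensor_smult_left: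
  "tensor A B (c \<odot>\<^bsub>A\<^esub> a) b = c \<odot>\<^bsub>tensor_alg A B\<^esub> tensor A B a b"
  unfolding tensor_def tensor_alg_def
  by (subst P.quot_smult, simp, rule coset_eqI) (simp_all add: bilinear_relationsI)

lemma tensor_smult_right:
  "tensor A B a (c \<odot>\<^bsub>B\<^esub> b) = c \<odot>\<^bsub>tensor_alg A B\<^esub> tensor A B a b"
  unfolding tensor_def tensor_alg_def
  by (subst P.quot_smult, simp, rule coset_eqI) (simp_all add: bilinear_relationsI)

lemma tensor_twist:
  "twist (tensor_alg A B) (tensor A B a b) = tensor A B (twist A a) (twist B b)"
  unfolding tensor_def tensor_alg_def by (subst P.quot_twist) simp_all

lemma tensor_mult:
  "c \<in> carrier A \<Longrightarrow> d \<in> carrier B \<Longrightarrow>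
   tensor A B a b \<otimes>\<^bsub>tensor_alg A B\<^esub> tensor A B c d = tensor A B (a \<otimes>\<^bsub>A\<^esub> c) (b \<otimes>\<^bsub>B\<^esub> d)"
  unfolding tensor_def tensor_alg_def by (subst P.quot_mult) (simp_all add: pair_alg_basis_mult)

end

lemma tensor_one: "\<one>\<^bsub>tensor_alg A B\<^esub> = tensor A B \<one>\<^bsub>A\<^esub> \<one>\<^bsub>B\<^esub>"
  by (simp add: tensor_alg_def tensor_def P.quot_one)

lemma linear_tensor_left: "b \<in> carrier B \<Longrightarrow> linear_map A (tensor_alg A B) (\<lambda>a. tensor A B a b)"
  by (auto simp: linear_map_def tensor_add_left tensor_smult_left)

lemma linear_tensor_right: "a \<in> carrier A \<Longrightarrow> linear_map B (tensor_alg A B) (\<lambda>b. tensor A B a b)"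
  by (auto simp: linear_map_def tensor_add_right tensor_smult_right)

end

lemma unitary_pair_alg:
  fixes A :: "('k::field, 'a, 'm) hom_alg_scheme" and B :: "('k, 'b, 'n) hom_alg_scheme"
  assumes "unitary_hom_algebra A" "unitary_hom_algebra B"
  shows "unitary_hom_algebra (pair_alg A B)"
proof -
  interpret A: unital_homalg A by (rule unital_homalg.intro) fact
  interpret B: unital_homalg B by (rule unital_homalg.intro) fact
  let ?f = "\<lambda>(a, b) (c, d). (a \<otimes>\<^bsub>A\<^esub> c, b \<otimes>\<^bsub>B\<^esub> d)"
  have "basis_mult ?f (basis_vec (\<one>\<^bsub>A\<^esub>, \<one>\<^bsub>B\<^esub>)) p = basis_map (map_prod (twist A) (twist B)) p \<and>
      basis_mult ?f p (basis_vec (\<one>\<^bsub>A\<^esub>, \<one>\<^bsub>B\<^esub>)) = basis_map (map_prod (twist A) (twist B)) p"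
    if "keys p \<subseteq> carrier A \<times> carrier B" for p :: "_ \<Rightarrow>\<^sub>0 'k"
    using that
    by (rule keys_induct) (auto simp: basis_mult_add_left basis_mult_add_right basis_map_add)
  then show ?thesis
    using hom_algebra_pair_alg[OF A.hom_algebra B.hom_algebra]
    by (simp add: unitary_hom_algebra_def pair_alg_basis_mult)
qed

lemma unitary_tensor_alg:
  assumes "unitary_hom_algebra A" "unitary_hom_algebra B"
  shows "unitary_hom_algebra (tensor_alg A B)"
proof -
  interpret A: unital_homalg A by (rule unital_homalg.intro) fact
  interpret B: unital_homalg B by (rule unital_homalg.intro) fact
  interpret tensor_product A B by (rule tensor_product.intro[OF A.hom_algebra B.hom_algebra])
  show ?thesis unfolding tensor_alg_def
    by (rule P.unitary_quot[OF unitary_pair_alg[OF assms]])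
qed

lemma tensor_map_morphism:
  assumes A: "hom_algebra A" and B: "hom_algebra B" and C: "hom_algebra C" and D: "hom_algebra D"
    and f: "hom_alg_morphism A C f" and g: "hom_alg_morphism B D g"
  shows "hom_alg_morphism (tensor_alg A B) (tensor_alg C D) (tensor_map C D f g)"
    and "a \<in> carrier A \<Longrightarrow> b \<in> carrier B \<Longrightarrow> tensor_map C D f g (tensor A B a b) = tensor C D (f a) (g b)"
proof -
  interpret A: homalg A by (rule homalg.intro) fact
  interpret B: homalg B by (rule homalg.intro) fact
  let ?h = "basis_map (map_prod f g)"
  have h: "hom_alg_morphism (pair_alg A B) (pair_alg C D) ?h"
    unfolding pair_alg_def
    by (rule basis_map_morphism) (auto simp: hom_alg_morphismD[OF f] hom_alg_morphismD[OF g])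
  have "?h x \<in> tensor_null C D" if "x \<in> tensor_null A B" for x
    by (rule tensor_null_map[OF A B C D hom_alg_morphismD(1)[OF h] _
          hom_alg_morphismD(1)[OF f] hom_alg_morphismD(1)[OF g] that]) simp
  note quot_map[OF quotient_tensor_null[OF A B] quotient_tensor_null[OF C D] h this]
  then show "hom_alg_morphism (tensor_alg A B) (tensor_alg C D) (tensor_map C D f g)"
    and "a \<in> carrier A \<Longrightarrow> b \<in> carrier B \<Longrightarrow> tensor_map C D f g (tensor A B a b) = tensor C D (f a) (g b)"
    unfolding tensor_alg_def tensor_map_def[abs_def] tensor_def by simp_all
qed

text \<open>
  Compatibility of a coproduct with the twisting maps is thus part of its being a morphism.
\<close>

lemma tensor_map_twist: "tensor_map A B (twist A) (twist B) P = twist (tensor_alg A B) P"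
  by (simp add: tensor_map_def tensor_alg_def quot_alg_def)

section \<open>The free unitary Hom-algebra\<close>

lemma terms_over_simps [simp]:
  "Unit \<in> terms_over B"
  "Gen s \<in> terms_over B \<longleftrightarrow> s \<in> B"
  "Mul x y \<in> terms_over B \<longleftrightarrow> x \<in> terms_over B \<and> y \<in> terms_over B"
  by (auto simp: terms_over_def)

lemma map_terms_over: "t \<in> terms_over B \<Longrightarrow> (\<And>s. s \<in> B \<Longrightarrow> h s \<in> C) \<Longrightarrow> map_hom_term h t \<in> terms_over C"
  by (auto simp: terms_over_def hom_term.set_map)

primrec eval_term :: "('k, 'b, 'm) hom_alg_scheme \<Rightarrow> ('s \<Rightarrow> 'b) \<Rightarrow> 's hom_term \<Rightarrow> 'b" where
  "eval_term W g Unit = \<one>\<^bsub>W\<^esub>"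
| "eval_term W g (Gen s) = g s"
| "eval_term W g (Mul x y) = eval_term W g x \<otimes>\<^bsub>W\<^esub> eval_term W g y"

text \<open>
  The generators of a free unitary Hom-algebra: a vector space with an endomorphism.
\<close>

locale generators = vect S for S :: "('k::field, 's, 'm) hom_alg_scheme" (structure) +
  assumes linear_alpha: "linear_map S S (twist S)"
begin

lemmas alpha = linear_mapD[OF linear_alpha]

abbreviation (input) T where "T \<equiv> term_alg S"

lemma term_alg_simps [simp]:
  "carrier (term_alg S) = {p. keys p \<subseteq> terms_over (carrier S)}"
  "p \<otimes>\<^bsub>term_alg S\<^esub> r = basis_mult Mul p r"
  "\<one>\<^bsub>term_alg S\<^esub> = basis_vec Unit"
  "\<zero>\<^bsub>term_alg S\<^esub> = 0"
  "p \<oplus>\<^bsub>term_alg S\<^esub> r = p + r"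
  "c \<odot>\<^bsub>term_alg S\<^esub> p = scale c p"
  "twist (term_alg S) = basis_map (map_hom_term (twist S))"
  by (simp_all add: term_alg_def)

lemma hom_algebra_term_alg: "hom_algebra (term_alg S)"
  unfolding term_alg_def by (rule hom_algebra_basis_alg) (auto intro: map_terms_over alpha)

sublocale T: homalg "term_alg S" by (rule homalg.intro[OF hom_algebra_term_alg])

lemma term_alg_minus:
  "p \<in> carrier (term_alg S) \<Longrightarrow> q \<in> carrier (term_alg S) \<Longrightarrow> p \<ominus>\<^bsub>term_alg S\<^esub> q = p - q"
  using basis_alg_minus hom_algebra_term_alg unfolding term_alg_def by auto

lemma free_relations_carrier: "free_relations S \<subseteq> carrier (term_alg S)"
proof -
  have "keys x \<subseteq> terms_over (carrier S)" if "x \<in> free_relations S" for x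
    using that unfolding free_relations_def
    by (auto del: subsetI intro!: keys_diff_subset simp: map_terms_over alpha)
  then show ?thesis by auto
qed

lemma ideal_free_null: "hom_alg_ideal (term_alg S) (free_null S)"
  unfolding free_null_def by (rule T.hom_alg_ideal_hull[OF free_relations_carrier])

lemma free_relation_zero: "x \<in> free_relations S \<Longrightarrow> x \<in> free_null S"
  unfolding free_null_def by (rule hull_inc)

lemma twist_free_relations:
  assumes "x \<in> free_relations S" shows "twist (term_alg S) x \<in> free_relations S"
  using assms unfolding free_relations_def
proof (elim UnE CollectE exE conjE, goal_cases)
  case (1 a b)
  then have "twist T x = basis_vec (Gen (twist S a \<oplus> twist S b)) - basis_vec (Gen (twist S a)) - basis_vec (Gen (twist S b))"
    by (simp add: basis_map_diff alpha)
  then show ?case using 1 alpha(1) by blast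
next
  case (2 c a)
  then have "twist T x = basis_vec (Gen (c \<odot> twist S a)) - single (Gen (twist S a)) c"
    by (simp add: basis_map_diff alpha)
  then show ?case using 2 alpha(1) by blast
next
  case (3 t)
  moreover have "map_hom_term (twist S) t \<in> terms_over (carrier S)"
    using 3 by (simp add: map_terms_over alpha)
  moreover have "twist T x = basis_vec (Mul Unit (map_hom_term (twist S) t))
      - basis_vec (map_hom_term (twist S) (map_hom_term (twist S) t))"
    using 3 by (simp add: basis_map_diff)
  ultimately show ?case by blast
next
  case (4 t)
  moreover have "map_hom_term (twist S) t \<in> terms_over (carrier S)"
    using 4 by (simp add: map_terms_over alpha)
  moreover have "twist T x = basis_vec (Mul (map_hom_term (twist S) t) Unit)
      - basis_vec (map_hom_term (twist S) (map_hom_term (twist S) t))"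
    using 4 by (simp add: basis_map_diff)
  ultimately show ?case by blast
qed

text \<open>
  The relations are stable under the twisting map, and the preimage of an ideal under this
  multiplicative map is an ideal again.
\<close>

lemma twist_free_null:
  assumes "x \<in> free_null S" shows "twist (term_alg S) x \<in> free_null S"
proof -
  note N = ideal_free_null
  let ?J = "{x \<in> carrier (term_alg S). twist (term_alg S) x \<in> free_null S}"
  have "free_null S \<subseteq> ?J" unfolding free_null_def[of S, THEN arg_cong[where f = "\<lambda>N. N \<subseteq> _"]]
  proof (rule hull_minimal)
    show "free_relations S \<subseteq> ?J"
      using free_relations_carrier twist_free_relations free_relation_zero by blast
    show "hom_alg_ideal (term_alg S) ?J"
      unfolding hom_alg_ideal_def
    proof (intro conjI ballI)
      show "submodule ?J ring_of_type_algebra (term_alg S)"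
        using N by (intro T.tw.submodule_vimage) (simp add: hom_alg_ideal_def)
    qed (use T.idealD(5,6)[OF N] T.twist_mult T.mult_closed T.tw.closed in auto)
  qed
  with assms show ?thesis by blast
qed

sublocale T: quotient "term_alg S" "free_null S"
  by unfold_locales (rule ideal_free_null, rule twist_free_null)

abbreviation (input) F where "F \<equiv> free_hom_alg S"

text \<open>
  The relations impose \<open>u(1)x = xu(1) = \<alpha>(x)\<close> for terms \<open>x\<close> only; both sides are additive in \<open>x\<close>.
\<close>

lemma unit_times_term:
  assumes "keys p \<subseteq> terms_over (carrier S)"
  shows "free_null S +>\<^bsub>T\<^esub> basis_mult Mul (basis_vec Unit) p = free_null S +>\<^bsub>T\<^esub> twist T p"
    and "free_null S +>\<^bsub>T\<^esub> basis_mult Mul p (basis_vec Unit) = free_null S +>\<^bsub>T\<^esub> twist T p"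
proof -
  let ?t = "basis_map (map_hom_term (twist S))"
  note N = ideal_free_null[unfolded hom_alg_ideal_def T.submodule_iff, simplified]
  have "basis_mult Mul (basis_vec Unit) p - ?t p \<in> free_null S \<and>
      basis_mult Mul p (basis_vec Unit) - ?t p \<in> free_null S"
    using assms
  proof (rule keys_induct)
    fix p q :: "'s hom_term \<Rightarrow>\<^sub>0 'k"
    let ?e = "basis_vec Unit :: 's hom_term \<Rightarrow>\<^sub>0 'k"
    assume "basis_mult Mul ?e p - ?t p \<in> free_null S \<and> basis_mult Mul p ?e - ?t p \<in> free_null S"
      "basis_mult Mul ?e q - ?t q \<in> free_null S \<and> basis_mult Mul q ?e - ?t q \<in> free_null S"
    then have "(basis_mult Mul ?e p - ?t p) + (basis_mult Mul ?e q - ?t q) \<in> free_null S"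
      "(basis_mult Mul p ?e - ?t p) + (basis_mult Mul q ?e - ?t q) \<in> free_null S"
      using N by blast+
    then show "basis_mult Mul ?e (p + q) - ?t (p + q) \<in> free_null S \<and>
        basis_mult Mul (p + q) ?e - ?t (p + q) \<in> free_null S"
      by (simp add: basis_mult_add_left basis_mult_add_right basis_map_add algebra_simps)
  next
    fix t and c :: 'k
    let ?e = "basis_vec Unit :: 's hom_term \<Rightarrow>\<^sub>0 'k"
    assume t: "t \<in> terms_over (carrier S)"
    have "basis_vec (Mul Unit t) - basis_vec (map_hom_term (twist S) t) \<in> free_null S"
      "basis_vec (Mul t Unit) - basis_vec (map_hom_term (twist S) t) \<in> free_null S"
      using t by (intro free_relation_zero; unfold free_relations_def; blast)+
    then have "scale c (basis_vec (Mul Unit t) - basis_vec (map_hom_term (twist S) t)) \<in> free_null S"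
      "scale c (basis_vec (Mul t Unit) - basis_vec (map_hom_term (twist S) t)) \<in> free_null S"
      using N by blast+
    moreover have "scale c (p - q) = scale c p - scale c q" for p q :: "'s hom_term \<Rightarrow>\<^sub>0 'k"
      using scale_add[of c "p - q" q] by (simp add: algebra_simps)
    ultimately show "basis_mult Mul ?e (single t c) - ?t (single t c) \<in> free_null S \<and>
        basis_mult Mul (single t c) ?e - ?t (single t c) \<in> free_null S"
      by simp
  qed (use N in auto)
  moreover have "keys (basis_mult Mul (basis_vec Unit) p) \<subseteq> terms_over (carrier S)"
    "keys (basis_mult Mul p (basis_vec Unit)) \<subseteq> terms_over (carrier S)"
    "keys (?t p) \<subseteq> terms_over (carrier S)"
    using assms T.tw.closed[of p] T.mult_closed[of "basis_vec Unit" p] T.mult_closed[of p "basis_vec Unit"]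
    by simp_all
  ultimately show "free_null S +>\<^bsub>T\<^esub> basis_mult Mul (basis_vec Unit) p = free_null S +>\<^bsub>T\<^esub> twist T p"
    and "free_null S +>\<^bsub>T\<^esub> basis_mult Mul p (basis_vec Unit) = free_null S +>\<^bsub>T\<^esub> twist T p"
    by (auto simp: T.coset_eq_iff term_alg_minus)
qed

lemma unitary_free_hom_alg: "unitary_hom_algebra (free_hom_alg S)"
proof -
  have "hom_algebra (free_hom_alg S)" unfolding free_hom_alg_def by (rule T.hom_algebra_quot)
  moreover have "basis_vec Unit \<in> carrier T" by simp
  ultimately show ?thesis
    unfolding unitary_hom_algebra_def free_hom_alg_def T.quot_carrier T.quot_one
    using T.quot_mult T.quot_twist unit_times_term by auto
qed

sublocale F: unital_homalg "free_hom_alg S"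
  by (rule unital_homalg.intro[OF unitary_free_hom_alg])

lemma free_gen_closed [simp]: "s \<in> carrier S \<Longrightarrow> free_gen S s \<in> carrier (free_hom_alg S)"
  unfolding free_gen_def free_hom_alg_def T.quot_carrier by (rule imageI) simp

lemma linear_free_gen: "linear_map S (free_hom_alg S) (free_gen S)"
proof -
  have "free_gen S (a \<oplus> b) = free_gen S a \<oplus>\<^bsub>free_hom_alg S\<^esub> free_gen S b"
    if "a \<in> carrier S" "b \<in> carrier S" for a b
  proof -
    have "basis_vec (Gen (a \<oplus> b)) - basis_vec (Gen a) - basis_vec (Gen b) \<in> free_null S"
      using that by (intro free_relation_zero; unfold free_relations_def; blast)
    then show ?thesis using that
      by (simp add: free_gen_def free_hom_alg_def T.quot_add T.coset_eq_iff term_alg_minus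
          keys_add_subset diff_diff_eq)
  qed
  moreover have "free_gen S (c \<odot> a) = c \<odot>\<^bsub>free_hom_alg S\<^esub> free_gen S a" if "a \<in> carrier S" for a c
  proof -
    have "basis_vec (Gen (c \<odot> a)) - single (Gen a) c \<in> free_null S"
      using that by (intro free_relation_zero; unfold free_relations_def; blast)
    then show ?thesis using that
      by (simp add: free_gen_def free_hom_alg_def T.quot_smult T.coset_eq_iff term_alg_minus)
  qed
  ultimately show ?thesis by (simp add: linear_map_def)
qed

lemma twist_free_gen: "s \<in> carrier S \<Longrightarrow> twist (free_hom_alg S) (free_gen S s) = free_gen S (twist S s)"
  by (simp add: free_gen_def free_hom_alg_def T.quot_twist)

lemma free_induct [consumes 1, case_names unit gen mult add smult]:
  assumes x: "x \<in> carrier F"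
    and unit: "P \<one>\<^bsub>F\<^esub>" and gen: "\<And>s. s \<in> carrier S \<Longrightarrow> P (free_gen S s)"
    and mult: "\<And>x y. \<lbrakk>x \<in> carrier F; y \<in> carrier F; P x; P y\<rbrakk> \<Longrightarrow> P (x \<otimes>\<^bsub>F\<^esub> y)"
    and add: "\<And>x y. \<lbrakk>x \<in> carrier F; y \<in> carrier F; P x; P y\<rbrakk> \<Longrightarrow> P (x \<oplus>\<^bsub>F\<^esub> y)"
    and smult: "\<And>c x. \<lbrakk>x \<in> carrier F; P x\<rbrakk> \<Longrightarrow> P (c \<odot>\<^bsub>F\<^esub> x)"
  shows "P x"
proof -
  let ?\<pi> = "\<lambda>p. free_null S +>\<^bsub>T\<^esub> p"
  have \<pi>: "?\<pi> p \<in> carrier F" if "keys p \<subseteq> terms_over (carrier S)" for p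
    unfolding free_hom_alg_def T.quot_carrier using that by (intro imageI) simp
  have tm: "P (?\<pi> (basis_vec t))" if "t \<in> terms_over (carrier S)" for t
    using that
  proof (induction t)
    case Unit
    then show ?case using unit by (simp add: free_hom_alg_def T.quot_one)
  next
    case (Gen s)
    then show ?case using gen[of s] by (simp add: free_gen_def)
  next
    case (Mul t u)
    then have "?\<pi> (basis_vec (Mul t u)) = ?\<pi> (basis_vec t) \<otimes>\<^bsub>F\<^esub> ?\<pi> (basis_vec u)"
      by (simp add: free_hom_alg_def T.quot_mult)
    then show ?case using Mul by (auto intro!: mult \<pi>)
  qed
  have "P (?\<pi> p)" if "keys p \<subseteq> terms_over (carrier S)" for p
    using that
  proof (rule keys_induct)
    fix t c assume t: "t \<in> terms_over (carrier S)"
    then have "?\<pi> (single t c) = c \<odot>\<^bsub>F\<^esub> ?\<pi> (basis_vec t)"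
      by (simp add: free_hom_alg_def T.quot_smult)
    then show "P (?\<pi> (single t c))" using t by (auto intro!: smult \<pi> tm)
  next
    have "0 \<odot>\<^bsub>F\<^esub> \<one>\<^bsub>F\<^esub> = ?\<pi> 0"
      by (simp add: free_hom_alg_def T.quot_smult T.quot_one)
    then show "P (?\<pi> 0)" using smult[of "\<one>\<^bsub>F\<^esub>" 0] unit by simp
  next
    fix p q assume pq: "keys p \<subseteq> terms_over (carrier S)" "keys q \<subseteq> terms_over (carrier S)"
      "P (?\<pi> p)" "P (?\<pi> q)"
    then have "?\<pi> (p + q) = ?\<pi> p \<oplus>\<^bsub>F\<^esub> ?\<pi> q"
      by (simp add: free_hom_alg_def T.quot_add)
    then show "P (?\<pi> (p + q))" using pq by (auto intro!: add \<pi>)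
  qed
  moreover obtain p where "keys p \<subseteq> terms_over (carrier S)" "x = ?\<pi> p"
    using x by (auto simp: free_hom_alg_def T.quot_carrier)
  ultimately show ?thesis by simp
qed

text \<open>
  The linear extension of term evaluation is a morphism on the algebra of terms, and its kernel is
  an ideal that contains the relations.
\<close>

lemma free_lift:
  assumes W: "unitary_hom_algebra W" and g: "linear_map S W g"
    and tw: "\<And>s. s \<in> carrier S \<Longrightarrow> g (twist S s) = twist W (g s)"
  obtains \<phi> where "hom_alg_morphism (free_hom_alg S) W \<phi>" "\<phi> \<one>\<^bsub>free_hom_alg S\<^esub> = \<one>\<^bsub>W\<^esub>"
    "\<And>s. s \<in> carrier S \<Longrightarrow> \<phi> (free_gen S s) = g s"
proof -
  interpret W: unital_homalg W by (rule unital_homalg.intro) fact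
  let ?e = "eval_term W g"
  let ?E = "basis_lift W ?e"
  have ec: "?e t \<in> carrier W" if "t \<in> terms_over (carrier S)" for t
    using that by (induction t) (auto simp: linear_mapD[OF g])
  have et: "?e (map_hom_term (twist S) t) = twist W (?e t)" if "t \<in> terms_over (carrier S)" for t
    using that by (induction t) (auto simp: tw W.twist_mult ec)
  have E: "hom_alg_morphism T W ?E"
    unfolding term_alg_def
    by (rule basis_lift_morphism[OF W.hom_algebra]) (auto simp: ec et map_terms_over alpha)
  interpret E: linear T W ?E by (rule linearI[OF T.vec_space W.vec_space hom_alg_morphismD(1)[OF E]])
  have diff: "?E (p - q) = ?E p \<ominus>\<^bsub>W\<^esub> ?E q" if "p \<in> carrier T" "q \<in> carrier T" for p q
    using E.minus[OF that] that by (simp add: term_alg_minus)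
  have single: "?E (single t c) = c \<odot>\<^bsub>W\<^esub> ?e t" if "t \<in> terms_over (carrier S)" for t c
    by (rule W.basis_lift_single) (rule ec[OF that])
  have "free_null S \<subseteq> {p \<in> carrier T. ?E p = \<zero>\<^bsub>W\<^esub>}"
    unfolding free_null_def
  proof (rule hull_minimal)
    show "hom_alg_ideal T {p \<in> carrier T. ?E p = \<zero>\<^bsub>W\<^esub>}"
      by (rule ideal_kernel[OF hom_algebra_term_alg W.hom_algebra E])
    have "?E p = \<zero>\<^bsub>W\<^esub>" if p: "p \<in> free_relations S" for p
      using p unfolding free_relations_def
    proof (elim UnE CollectE exE conjE, goal_cases)
      case (1 a b)
      moreover have "?E (p + q) = ?E p \<oplus>\<^bsub>W\<^esub> ?E q" if "p \<in> carrier T" "q \<in> carrier T" for p q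
        using E.add[OF that] by simp
      ultimately show ?case
        by (simp add: diff_diff_eq diff keys_add_subset single linear_mapD[OF g] W.diff_eq_zero_iff)
    next
      case (2 c a)
      then show ?case by (simp add: diff single linear_mapD[OF g] W.diff_eq_zero_iff)
    next
      case (3 t)
      then show ?case by (simp add: diff single map_terms_over alpha ec et W.diff_eq_zero_iff)
    next
      case (4 t)
      then show ?case by (simp add: diff single map_terms_over alpha ec et W.diff_eq_zero_iff)
    qed
    then show "free_relations S \<subseteq> {p \<in> carrier T. ?E p = \<zero>\<^bsub>W\<^esub>}"
      using free_relations_carrier by blast
  qed
  then obtain \<phi> where \<phi>: "hom_alg_morphism (free_hom_alg S) W \<phi>"
      "\<And>p. p \<in> carrier T \<Longrightarrow> \<phi> (free_null S +>\<^bsub>T\<^esub> p) = ?E p"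
    using T.quot_lift[OF W.hom_algebra E] unfolding free_hom_alg_def by blast
  show thesis
  proof (rule that[OF \<phi>(1)])
    show "\<phi> \<one>\<^bsub>free_hom_alg S\<^esub> = \<one>\<^bsub>W\<^esub>"
      by (simp add: free_hom_alg_def T.quot_one \<phi>(2) single)
    show "\<phi> (free_gen S s) = g s" if "s \<in> carrier S" for s
      using that by (simp add: free_gen_def \<phi>(2) single linear_mapD[OF g])
  qed
qed

end

section \<open>Splittings of words\<close>

lemma sum_list_swap:
  "(\<Sum>x\<leftarrow>xs. \<Sum>y\<leftarrow>ys. f x y) = (\<Sum>y\<leftarrow>ys. \<Sum>x\<leftarrow>xs. f x y :: 'c::comm_monoid_add)"
  by (induction xs) (simp_all add: sum_list_addf)

lemma sum_list_product:
  "(\<Sum>p\<leftarrow>List.product xs ys. f p) = (\<Sum>x\<leftarrow>xs. \<Sum>y\<leftarrow>ys. f (x, y) :: 'c::comm_monoid_add)"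
  by (induction xs) (simp_all add: o_def)

lemma mset_map_sum_list: "mset (map g ys) = (\<Sum>y\<leftarrow>ys. {#g y#})"
  by (induction ys) simp_all

text \<open>
  The splitting with empty left part occurs exactly once. It belongs to the summand \<open>q(u, v, z)\<close> for
  which the defining recursion is solved.
\<close>

lemma word_coprod_last:
  "\<exists>ps. word_coprod w = ps @ [([], w)] \<and> (\<forall>(x, y)\<in>set ps. x \<noteq> [])"
proof (induction w)
  case (Cons s w)
  then obtain ps where ps: "word_coprod w = ps @ [([], w)]" "\<forall>(x, y)\<in>set ps. x \<noteq> []" by blast
  let ?ps = "map (\<lambda>(x, y). (s # x, y)) (word_coprod w) @ map (\<lambda>(x, y). (x, s # y)) ps"
  have "word_coprod (s # w) = ?ps @ [([], s # w)]" using ps(1) by simp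
  moreover have "\<forall>(x, y)\<in>set ?ps. x \<noteq> []" using ps(2) by auto
  ultimately show ?case by blast
qed simp

lemma word_coprod_swap: "mset (map prod.swap (word_coprod w)) = mset (word_coprod w)"
proof (induction w)
  case (Cons s w)
  have "mset (map prod.swap (word_coprod (s # w)))
      = image_mset (\<lambda>(x, y). (x, s # y)) (mset (map prod.swap (word_coprod w)))
        + image_mset (\<lambda>(x, y). (s # x, y)) (mset (map prod.swap (word_coprod w)))"
    by (simp add: image_mset.compositionality o_def case_prod_unfold)
  then show ?case unfolding Cons.IH by simp
qed simp

text \<open>
  \<^const>\<open>word_coprod\<close> recurses on the first letter, while left-normed products grow at the last one.
\<close>

lemma word_coprod_snoc:
  "mset (word_coprod (w @ [s])) =
     mset (map (\<lambda>(x, y). (x @ [s], y)) (word_coprod w) @ map (\<lambda>(x, y). (x, y @ [s])) (word_coprod w))"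
proof (induction w)
  case (Cons r w)
  have "mset (word_coprod ((r # w) @ [s])) =
      image_mset (\<lambda>(x, y). (r # x, y)) (mset (word_coprod (w @ [s]))) +
      image_mset (\<lambda>(x, y). (x, r # y)) (mset (word_coprod (w @ [s])))"
    by simp
  also have "\<dots> = mset (map (\<lambda>(x, y). (x @ [s], y)) (word_coprod (r # w)) @
      map (\<lambda>(x, y). (x, y @ [s])) (word_coprod (r # w)))"
    unfolding Cons.IH by (simp add: image_mset.compositionality o_def case_prod_unfold)
  finally show ?case .
qed simp

text \<open>
  Since \<open>f\<close> is arbitrary, this says that both iterated splittings list the same triples with the same
  multiplicities.
\<close>

lemma word_coprod_coassoc:
  "(\<Sum>(x, z)\<leftarrow>word_coprod w. \<Sum>(x', y)\<leftarrow>word_coprod x. f x' y z) =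
   (\<Sum>(x, r)\<leftarrow>word_coprod w. \<Sum>(y, z)\<leftarrow>word_coprod r. f x y z :: 'c::comm_monoid_add)"
proof (induction w arbitrary: f)
  case (Cons s w)
  show ?case
    using Cons[of "\<lambda>x y z. f (s # x) y z"] Cons[of "\<lambda>x y z. f x (s # y) z"]
      Cons[of "\<lambda>x y z. f x y (s # z)"]
    by (simp add: o_def case_prod_unfold sum_list_addf add_ac)
qed simp

lemma set_word_coprod: "(x, y) \<in> set (word_coprod w) \<Longrightarrow> set x \<subseteq> set w \<and> set y \<subseteq> set w"
  by (induction w arbitrary: x y) fastforce+

section \<open>Splitting pairs of words\<close>

type_synonym 'a words = "'a list \<times> 'a list"

text \<open>
  The coproduct of \<open>T(S) \<otimes> T(S)\<close> on \<open>u \<otimes> v\<close>. Splitting both words simultaneously gives the sums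
  in the recursion for \<open>q\<close> the form of sums for a single word.
\<close>

definition pair_coprod :: "'a words \<Rightarrow> ('a words \<times> 'a words) list" where
  "pair_coprod p = map (\<lambda>((u1, u2), (v1, v2)). ((u1, v1), (u2, v2)))
     (List.product (word_coprod (fst p)) (word_coprod (snd p)))"

definition pair_size :: "'a words \<Rightarrow> nat" where
  "pair_size p = length (fst p) + length (snd p)"

definition words_over :: "'a set \<Rightarrow> 'a words set" where
  "words_over C = {p. set (fst p) \<union> set (snd p) \<subseteq> C}"

lemma pair_size_simps [simp]: "pair_size (u, v) = length u + length v"
  by (simp add: pair_size_def)

lemma words_over_iff [simp]: "(u, v) \<in> words_over C \<longleftrightarrow> set u \<subseteq> C \<and> set v \<subseteq> C"
  by (auto simp: words_over_def)

lemma set_pair_coprod: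
  "(x, y) \<in> set (pair_coprod p) \<longleftrightarrow>
     (fst x, fst y) \<in> set (word_coprod (fst p)) \<and> (snd x, snd y) \<in> set (word_coprod (snd p))"
  by (cases x; cases y) (force simp: pair_coprod_def)

lemma pair_coprod_size: "(x, y) \<in> set (pair_coprod p) \<Longrightarrow> pair_size x + pair_size y = pair_size p"
  by (auto simp: set_pair_coprod pair_size_def dest!: length_word_coprod)

lemma pair_coprod_over:
  assumes "(x, y) \<in> set (pair_coprod p)" "p \<in> words_over C"
  shows "x \<in> words_over C" "y \<in> words_over C"
  using assms set_word_coprod[of "fst x" "fst y" "fst p"] set_word_coprod[of "snd x" "snd y" "snd p"]
  by (cases x; cases y; cases p; auto simp: set_pair_coprod)+

lemma pair_coprod_Nil [simp]: "pair_coprod ([], []) = [(([], []), ([], []))]"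
  by (simp add: pair_coprod_def)

lemma pair_coprod_last:
  "\<exists>ps. pair_coprod p = ps @ [(([], []), p)] \<and> (\<forall>(x, y)\<in>set ps. x \<noteq> ([], []))"
proof -
  obtain us where us: "word_coprod (fst p) = us @ [([], fst p)]" "\<forall>(x, y)\<in>set us. x \<noteq> []"
    using word_coprod_last by blast
  obtain vs where vs: "word_coprod (snd p) = vs @ [([], snd p)]" "\<forall>(x, y)\<in>set vs. x \<noteq> []"
    using word_coprod_last by blast
  let ?f = "\<lambda>((u1, u2), (v1, v2)). ((u1, v1), (u2, v2))"
  have "List.product (us @ [([], fst p)]) zs = List.product us zs @ map (Pair ([], fst p)) zs"
    for zs :: "('a list \<times> 'a list) list"
    by (induction us) auto
  then have "pair_coprod p = (map ?f (List.product us (vs @ [([], snd p)])) @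
      map (?f \<circ> Pair ([], fst p)) vs) @ [(([], []), p)]"
    by (simp add: pair_coprod_def us(1) vs(1))
  moreover have "\<forall>(x, y)\<in>set (map ?f (List.product us (vs @ [([], snd p)])) @
      map (?f \<circ> Pair ([], fst p)) vs). x \<noteq> ([], [])"
    using us(2) vs(2) by fastforce
  ultimately show ?thesis by blast
qed

lemma pair_coprod_sum_list:
  "(\<Sum>(x, y)\<leftarrow>pair_coprod (u, v). f x y) =
   (\<Sum>(u1, u2)\<leftarrow>word_coprod u. \<Sum>(v1, v2)\<leftarrow>word_coprod v. f (u1, v1) (u2, v2) :: 'c::comm_monoid_add)"
  by (simp add: pair_coprod_def sum_list_product o_def case_prod_unfold)

lemma mset_pair_coprod: "mset (pair_coprod (u, v)) =
   (\<Sum>(u1, u2)\<leftarrow>word_coprod u. \<Sum>(v1, v2)\<leftarrow>word_coprod v. {#((u1, v1), (u2, v2))#})"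
  using mset_map_sum_list[of id "pair_coprod (u, v)"] pair_coprod_sum_list[of "\<lambda>x y. {#(x, y)#}" u v]
  by (simp add: case_prod_unfold)

lemma pair_coprod_swap: "mset (map prod.swap (pair_coprod p)) = mset (pair_coprod p)"
proof (cases p)
  case (Pair u v)
  let ?sw = "\<lambda>w. map prod.swap (word_coprod w)"
  have *: "sum_list (map g (?sw w)) = sum_list (map g (word_coprod w))"
    for g :: "'a list \<times> 'a list \<Rightarrow> ('a words \<times> 'a words) multiset" and w
    using word_coprod_swap[of w] by (metis mset_map sum_mset_sum_list)
  have "mset (map prod.swap (pair_coprod (u, v))) =
      (\<Sum>(x, y)\<leftarrow>pair_coprod (u, v). {#(y, x)#})"
    by (subst mset_map_sum_list) (simp add: case_prod_unfold prod.swap_def)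
  also have "\<dots> = (\<Sum>(u1, u2)\<leftarrow>?sw u. \<Sum>(v1, v2)\<leftarrow>?sw v. {#((u1, v1), (u2, v2))#})"
    unfolding pair_coprod_sum_list by (simp add: o_def case_prod_unfold)
  also have "\<dots> = mset (pair_coprod (u, v))"
    unfolding mset_pair_coprod * ..
  finally show ?thesis by (simp add: Pair)
qed

text \<open>
  Coassociativity in each word; the sums over the two words are independent and may be interchanged.
\<close>

lemma pair_coprod_coassoc_sum:
  "(\<Sum>(a, z)\<leftarrow>pair_coprod p. \<Sum>(x, y)\<leftarrow>pair_coprod a. f x y z) =
   (\<Sum>(x, r)\<leftarrow>pair_coprod p. \<Sum>(y, z)\<leftarrow>pair_coprod r. f x y z :: 'c::comm_monoid_add)"
proof (cases p)
  case (Pair u v)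
  let ?S = "\<lambda>w g. \<Sum>(x, y)\<leftarrow>word_coprod w. g x y"
  have swap: "?S w (\<lambda>x y. ?S w' (\<lambda>x' y'. g x y x' y')) = ?S w' (\<lambda>x' y'. ?S w (\<lambda>x y. g x y x' y'))"
    for w w' and g :: "_ \<Rightarrow> _ \<Rightarrow> _ \<Rightarrow> _ \<Rightarrow> 'c"
    unfolding case_prod_unfold by (rule sum_list_swap)
  have "(\<Sum>(a, z)\<leftarrow>pair_coprod p. \<Sum>(x, y)\<leftarrow>pair_coprod a. f x y z)
      = ?S u (\<lambda>u1 u3. ?S v (\<lambda>v1 v3. ?S u1 (\<lambda>u1 u2. ?S v1 (\<lambda>v1 v2. f (u1, v1) (u2, v2) (u3, v3)))))"
    unfolding Pair pair_coprod_sum_list ..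
  also have "\<dots> = ?S u (\<lambda>u1 u3. ?S u1 (\<lambda>u1 u2. ?S v (\<lambda>v1 v3. ?S v1 (\<lambda>v1 v2. f (u1, v1) (u2, v2) (u3, v3)))))"
    by (subst swap) (rule refl)
  also have "\<dots> = ?S u (\<lambda>u1 u3. ?S u1 (\<lambda>u1 u2. ?S v (\<lambda>v1 v3. ?S v3 (\<lambda>v2 v3. f (u1, v1) (u2, v2) (u3, v3)))))"
    by (subst word_coprod_coassoc) (rule refl)
  also have "\<dots> = ?S u (\<lambda>u1 u3. ?S u3 (\<lambda>u2 u3. ?S v (\<lambda>v1 v3. ?S v3 (\<lambda>v2 v3. f (u1, v1) (u2, v2) (u3, v3)))))"
    by (rule word_coprod_coassoc)
  also have "\<dots> = ?S u (\<lambda>u1 u3. ?S v (\<lambda>v1 v3. ?S u3 (\<lambda>u2 u3. ?S v3 (\<lambda>v2 v3. f (u1, v1) (u2, v2) (u3, v3)))))"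
    by (subst (2) swap) (rule refl)
  also have "\<dots> = (\<Sum>(x, r)\<leftarrow>pair_coprod p. \<Sum>(y, z)\<leftarrow>pair_coprod r. f x y z)"
    unfolding Pair pair_coprod_sum_list ..
  finally show ?thesis .
qed

lemma pair_coprod_coassoc:
  "mset (concat (map (\<lambda>(a, z). map (\<lambda>(x, y). (x, y, z)) (pair_coprod a)) (pair_coprod p))) =
   mset (concat (map (\<lambda>(x, r). map (\<lambda>(y, z). (x, y, z)) (pair_coprod r)) (pair_coprod p)))"
  using pair_coprod_coassoc_sum[of "\<lambda>x y z. {#(x, y, z)#}" p]
  by (simp add: mset_concat o_def case_prod_unfold mset_map_sum_list del: mset_map)

section \<open>Sums along lists\<close>

abbreviation lsum :: "('a, 'm) ring_scheme \<Rightarrow> ('x \<Rightarrow> 'a) \<Rightarrow> 'x list \<Rightarrow> 'a" where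
  "lsum V f xs \<equiv> sum_terms V (map f xs)"

lemma sum_terms_simps [simp]:
  "sum_terms V [] = \<zero>\<^bsub>V\<^esub>" "sum_terms V (x # xs) = x \<oplus>\<^bsub>V\<^esub> sum_terms V xs"
  by (simp_all add: sum_terms_def)

context vect begin

lemma sum_terms_closed [simp]: "set xs \<subseteq> carrier V \<Longrightarrow> sum_terms V xs \<in> carrier V"
  by (induction xs) auto

lemma lsum_closed: "(\<And>x. x \<in> set xs \<Longrightarrow> f x \<in> carrier V) \<Longrightarrow> lsum V f xs \<in> carrier V"
  by (rule sum_terms_closed) auto

lemma sum_terms_append:
  "set xs \<subseteq> carrier V \<Longrightarrow> set ys \<subseteq> carrier V \<Longrightarrow> sum_terms V (xs @ ys) = sum_terms V xs \<oplus> sum_terms V ys"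
  by (induction xs) (auto simp: M.a_assoc)

lemma lsum_append:
  assumes "\<And>x. x \<in> set xs \<union> set ys \<Longrightarrow> f x \<in> carrier V"
  shows "lsum V f (xs @ ys) = lsum V f xs \<oplus> lsum V f ys"
  using assms by (simp add: image_subset_iff sum_terms_append)

text \<open>
  A formal sum of splittings is only determined up to the order of its terms, so this is how
  symmetry and coassociativity of the splittings enter computations in an algebra.
\<close>

lemma sum_terms_mset:
  "mset xs = mset ys \<Longrightarrow> set xs \<subseteq> carrier V \<Longrightarrow> sum_terms V xs = sum_terms V ys"
proof (induction xs arbitrary: ys)
  case (Cons x xs)
  then have "x \<in> set ys" by (metis list.set_intros(1) set_mset_mset)
  then obtain as bs where ys: "ys = as @ x # bs" by (meson split_list)
  have "mset xs = mset (as @ bs)" using Cons.prems(1) by (simp add: ys)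
  moreover have "set as \<subseteq> carrier V" "set bs \<subseteq> carrier V" "x \<in> carrier V"
    using Cons.prems mset_eq_setD[OF Cons.prems(1)] by (auto simp: ys)
  ultimately show ?case using Cons.IH[of "as @ bs"] Cons.prems(2)
    by (simp add: ys sum_terms_append M.a_ac)
qed simp

lemma lsum_mset:
  assumes "mset xs = mset ys" "\<And>x. x \<in> set xs \<Longrightarrow> f x \<in> carrier V"
  shows "lsum V f xs = lsum V f ys"
  using assms by (intro sum_terms_mset) (auto intro: arg_cong[where f = "image_mset f"])

lemma lsum_add:
  assumes "\<And>x. x \<in> set xs \<Longrightarrow> f x \<in> carrier V" "\<And>x. x \<in> set xs \<Longrightarrow> g x \<in> carrier V"
  shows "lsum V (\<lambda>x. f x \<oplus> g x) xs = lsum V f xs \<oplus> lsum V g xs"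
  using assms by (induction xs) (auto simp: M.a_ac lsum_closed)

lemma sum_terms_concat:
  assumes "\<And>x. x \<in> set xs \<Longrightarrow> set (F x) \<subseteq> carrier V"
  shows "sum_terms V (concat (map F xs)) = lsum V (\<lambda>x. sum_terms V (F x)) xs"
  using assms by (induction xs) (simp_all add: sum_terms_append UN_subset_iff)

lemma lsum_zero: "(\<And>x. x \<in> set xs \<Longrightarrow> f x = \<zero>) \<Longrightarrow> lsum V f xs = \<zero>"
  by (induction xs) auto

end

lemma lsum_cong: "(\<And>x. x \<in> set xs \<Longrightarrow> f x = g x) \<Longrightarrow> lsum V f xs = lsum V g xs"
  by (metis map_cong)

lemma (in linear) lsum_image:
  "(\<And>x. x \<in> set xs \<Longrightarrow> g x \<in> carrier V) \<Longrightarrow> f (lsum V g xs) = lsum W (\<lambda>x. f (g x)) xs"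
  by (induction xs) (auto simp: zero add V.lsum_closed)

lemma (in vect) lsum_product:
  assumes "\<And>x y. x \<in> set xs \<Longrightarrow> y \<in> set ys \<Longrightarrow> f (x, y) \<in> carrier V"
  shows "lsum V f (List.product xs ys) = lsum V (\<lambda>x. lsum V (\<lambda>y. f (x, y)) ys) xs"
  using assms
proof (induction xs)
  case (Cons x xs)
  then show ?case by (simp add: lsum_append[simplified] sum_terms_append image_subset_iff o_def)
qed simp

section \<open>Powers of the twisting map\<close>

abbreviation tpow :: "('k, 'a, 'm) hom_alg_scheme \<Rightarrow> nat \<Rightarrow> 'a \<Rightarrow> 'a" where
  "tpow A n \<equiv> twist A ^^ n"

lemma tpow_tpow: "tpow A m (tpow A n x) = tpow A (m + n) x"
  by (simp add: funpow_add)

lemma twist_tpow: "twist A (tpow A n x) = tpow A (Suc n) x"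
  by simp

context homalg begin

lemma linear_tpow: "linear_map A A (tpow A n)"
  by (induction n) (auto simp: linear_map_def tw.add tw.smult Pi_iff)

sublocale tp: linear A A "tpow A n" for n
  by (rule linearI[OF vec_space vec_space linear_tpow])

declare tp.closed [simp] tp.zero [simp]

lemma tpow_mult: "x \<in> carrier A \<Longrightarrow> y \<in> carrier A \<Longrightarrow> tpow A n (x \<otimes> y) = tpow A n x \<otimes> tpow A n y"
  by (induction n) (auto simp: twist_mult)

lemma hom_assoc_closed [simp]:
  "a \<in> carrier A \<Longrightarrow> b \<in> carrier A \<Longrightarrow> c \<in> carrier A \<Longrightarrow> hom_assoc A a b c \<in> carrier A"
  by (simp add: hom_assoc_def)

lemma tpow_hom_assoc:
  "a \<in> carrier A \<Longrightarrow> b \<in> carrier A \<Longrightarrow> c \<in> carrier A \<Longrightarrow>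
    tpow A n (hom_assoc A a b c) = hom_assoc A (tpow A n a) (tpow A n b) (tpow A n c)"
  by (simp add: hom_assoc_def tp.minus tpow_mult funpow_swap1)

lemma add_diff_add:
  assumes "a \<in> carrier A" "b \<in> carrier A" "c \<in> carrier A" "d \<in> carrier A"
  shows "(a \<oplus> b) \<ominus> (c \<oplus> d) = (a \<ominus> c) \<oplus> (b \<ominus> d)"
  using assms by (simp add: diff_as_smult smult_add_right M.a_ac)

lemma smult_diff:
  "a \<in> carrier A \<Longrightarrow> b \<in> carrier A \<Longrightarrow> c \<odot> a \<ominus> c \<odot> b = c \<odot> (a \<ominus> b)"
  by (simp add: diff_as_smult smult_add_right smult_smult mult.commute)

lemma linear_hom_assoc:
  shows "b \<in> carrier A \<Longrightarrow> c \<in> carrier A \<Longrightarrow> linear_map A A (\<lambda>x. hom_assoc A x b c)"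
    and "a \<in> carrier A \<Longrightarrow> c \<in> carrier A \<Longrightarrow> linear_map A A (\<lambda>x. hom_assoc A a x c)"
    and "a \<in> carrier A \<Longrightarrow> b \<in> carrier A \<Longrightarrow> linear_map A A (\<lambda>x. hom_assoc A a b x)"
  by (auto simp: linear_map_def hom_assoc_def tw.add tw.smult mult_add_left mult_add_right
      mult_smult_left mult_smult_right add_diff_add smult_diff)

lemma hom_assoc_lsum:
  assumes f: "\<And>x. x \<in> set xs \<Longrightarrow> f x \<in> carrier A" and g: "\<And>y. y \<in> set ys \<Longrightarrow> g y \<in> carrier A"
    and c: "c \<in> carrier A"
  shows "hom_assoc A (lsum A f xs) (lsum A g ys) c =
    lsum A (\<lambda>(x, y). hom_assoc A (f x) (g y) c) (List.product xs ys)"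
proof -
  note lin = linearI[OF vec_space vec_space linear_hom_assoc(1)] linearI[OF vec_space vec_space linear_hom_assoc(2)]
  have "hom_assoc A (lsum A f xs) (lsum A g ys) c = lsum A (\<lambda>x. hom_assoc A (f x) (lsum A g ys) c) xs"
    by (rule linear.lsum_image[OF lin(1)]) (auto intro: f g c lsum_closed simp del: sum_terms_closed)
  also have "\<dots> = lsum A (\<lambda>x. lsum A (\<lambda>y. hom_assoc A (f x) (g y) c) ys) xs"
    by (intro lsum_cong linear.lsum_image[OF lin(2)] f g c)
  also have "\<dots> = lsum A (\<lambda>(x, y). hom_assoc A (f x) (g y) c) (List.product xs ys)"
    using f g c by (subst lsum_product) auto
  finally show ?thesis .
qed

lemma mult_lsum_lsum:
  assumes f: "\<And>x. x \<in> set xs \<Longrightarrow> f x \<in> carrier A" and g: "\<And>y. y \<in> set ys \<Longrightarrow> g y \<in> carrier A"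
  shows "lsum A f xs \<otimes> lsum A g ys = lsum A (\<lambda>(x, y). f x \<otimes> g y) (List.product xs ys)"
proof -
  have "lsum A f xs \<otimes> lsum A g ys = lsum A (\<lambda>x. f x \<otimes> lsum A g ys) xs"
    by (rule linear.lsum_image[OF linear_right]) (auto intro: f g lsum_closed simp del: sum_terms_closed)
  also have "\<dots> = lsum A (\<lambda>x. lsum A (\<lambda>y. f x \<otimes> g y) ys) xs"
    by (intro lsum_cong linear.lsum_image[OF linear_left] f g)
  also have "\<dots> = lsum A (\<lambda>(x, y). f x \<otimes> g y) (List.product xs ys)"
    using f g by (subst lsum_product) auto
  finally show ?thesis .
qed

end

lemma (in unital_homalg) tpow_unit [simp]: "tpow A n \<one> = \<one>"
  by (induction n) auto

lemma hom_alg_morphism_tpow: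
  assumes "hom_alg_morphism A B f" "x \<in> carrier A" "hom_algebra A"
  shows "f (tpow A n x) = tpow B n (f x)"
proof -
  interpret homalg A by (rule homalg.intro) fact
  show ?thesis using assms by (induction n) (auto simp: hom_alg_morphismD)
qed

section \<open>Left-normed products of primitive elements\<close>

text \<open>
  The setting for primitive elements: a unitary Hom-algebra with a morphism \<open>\<Delta>\<close> to its tensor square
  that preserves the unit. Pure tensors are written with \<open>\<bowtie>\<close>.
\<close>

locale coproduct = unital_homalg A for A :: "('k::field, 'a, 'm) hom_alg_scheme" (structure) +
  fixes \<Delta> assumes \<Delta>: "hom_alg_morphism A (tensor_alg A A) \<Delta>"
    and \<Delta>_unit: "\<Delta> \<one> = tensor A A \<one> \<one>"
begin

abbreviation AA where "AA \<equiv> tensor_alg A A"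
abbreviation tens (infixl "\<bowtie>" 75) where "x \<bowtie> y \<equiv> tensor A A x y"

sublocale TP: tensor_product A A
  by (rule tensor_product.intro[OF hom_algebra hom_algebra])
sublocale T: unital_homalg AA
  by (rule unital_homalg.intro[OF unitary_tensor_alg[OF unitary unitary]])
sublocale D: linear A AA \<Delta>
  by (rule linearI[OF vec_space T.vec_space hom_alg_morphismD(1)[OF \<Delta>]])

lemma \<Delta>_mult: "x \<in> carrier A \<Longrightarrow> y \<in> carrier A \<Longrightarrow> \<Delta> (x \<otimes> y) = \<Delta> x \<otimes>\<^bsub>AA\<^esub> \<Delta> y"
  using hom_alg_morphismD(3)[OF \<Delta>] .

lemma \<Delta>_tpow: "x \<in> carrier A \<Longrightarrow> \<Delta> (tpow A n x) = tpow AA n (\<Delta> x)"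
  by (rule hom_alg_morphism_tpow[OF \<Delta> _ hom_algebra])

lemma tensor_tpow: "x \<in> carrier A \<Longrightarrow> y \<in> carrier A \<Longrightarrow> tpow AA n (x \<bowtie> y) = tpow A n x \<bowtie> tpow A n y"
  by (induction n) (auto simp: TP.tensor_twist)

lemma linear_tens_left: "y \<in> carrier A \<Longrightarrow> linear A AA (\<lambda>x. x \<bowtie> y)"
  by (rule linearI[OF vec_space T.vec_space TP.linear_tensor_left])
lemma linear_tens_right: "x \<in> carrier A \<Longrightarrow> linear A AA (\<lambda>y. x \<bowtie> y)"
  by (rule linearI[OF vec_space T.vec_space TP.linear_tensor_right])

lemma tens_zero [simp]: "x \<in> carrier A \<Longrightarrow> x \<bowtie> \<zero> = \<zero>\<^bsub>AA\<^esub>" "x \<in> carrier A \<Longrightarrow> \<zero> \<bowtie> x = \<zero>\<^bsub>AA\<^esub>"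
  using linear.zero[OF linear_tens_left] linear.zero[OF linear_tens_right] by auto

definition primitives :: "'a set" where
  "primitives = {x \<in> carrier A. \<Delta> x = \<one> \<bowtie> x \<oplus>\<^bsub>AA\<^esub> x \<bowtie> \<one>}"

lemma primitives_carrier: "x \<in> primitives \<Longrightarrow> x \<in> carrier A"
  by (simp add: primitives_def)

lemma \<Delta>_primitive: "x \<in> primitives \<Longrightarrow> \<Delta> x = \<one> \<bowtie> x \<oplus>\<^bsub>AA\<^esub> x \<bowtie> \<one>"
  by (simp add: primitives_def)

lemma submodule_primitives: "submodule primitives ring_of_type_algebra A"
  unfolding submodule_iff
proof (intro conjI ballI allI)
  fix x y assume "x \<in> primitives" "y \<in> primitives"
  then show "x \<oplus> y \<in> primitives"
    by (simp add: primitives_def D.add TP.tensor_add_left TP.tensor_add_right T.M.a_ac)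
next
  fix c x assume "x \<in> primitives"
  then show "c \<odot> x \<in> primitives"
    by (simp add: primitives_def D.smult TP.tensor_smult_left TP.tensor_smult_right T.smult_add_right)
qed (auto simp: primitives_def D.zero)

lemma primitive_tpow:
  assumes "x \<in> primitives" shows "tpow A n x \<in> primitives"
  using assms by (simp add: primitives_def \<Delta>_tpow T.tp.add tensor_tpow)

declare primitives_carrier [simp]

text \<open>
  Left-normed products, with \<open>u(1)\<close> for the empty word: then splittings with an empty part need no separate formula.
\<close>

definition lprod :: "'a list \<Rightarrow> 'a" where
  "lprod u = (if u = [] then \<one> else left_prod A u)"

text \<open>
  The inner product of the recursion for \<open>q\<close>, with \<open>u(1)\<close> for the pair of empty words.
\<close>

definition pprod :: "'a words \<Rightarrow> 'a" where
  "pprod p = (if p = ([], []) then \<one> else inner_prod A (fst p) (snd p))"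

lemma lprod_Nil [simp]: "lprod [] = \<one>" by (simp add: lprod_def)

lemma lprod_snoc: "lprod (u @ [x]) = (if u = [] then x else lprod u \<otimes> tpow A (length u - 1) x)"
  by (simp add: lprod_def left_prod.simps[of A "u @ [x]"] numeral_2_eq_2 Suc_le_eq)

lemma lprod_single [simp]: "lprod [x] = x"
  using lprod_snoc[of "[]" x] by simp

lemma lprod_closed [simp]: "set u \<subseteq> carrier A \<Longrightarrow> lprod u \<in> carrier A"
  by (induction u rule: rev_induct) (auto simp: lprod_snoc)

lemma pprod_simps [simp]:
  "pprod (u, []) = lprod u"
  "pprod ([], v) = lprod v"
  by (auto simp: pprod_def lprod_def inner_prod_def)

lemma pprod_nonempty:
  "u \<noteq> [] \<Longrightarrow> v \<noteq> [] \<Longrightarrow> pprod (u, v) = tpow A (length v - 1) (lprod u) \<otimes> tpow A (length u - 1) (lprod v)"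
  by (auto simp: pprod_def lprod_def inner_prod_def)

lemma pprod_closed [simp]: "p \<in> words_over (carrier A) \<Longrightarrow> pprod p \<in> carrier A"
  by (cases p; cases "fst p = []"; cases "snd p = []") (auto simp: pprod_nonempty)

text \<open>
  If \<open>u\<close> is empty, the left factor is \<open>u(1)\<close>, and multiplication by it supplies the missing power of the
  twisting map.
\<close>

lemma tpow_lprod_snoc:
  assumes "set u \<subseteq> carrier A" "x \<in> carrier A" "length u + k > 0"
  shows "tpow A k (lprod u) \<otimes> tpow A (length u + k - 1) x = tpow A k (lprod (u @ [x]))"
proof (cases "u = []")
  case True
  then show ?thesis using assms by (cases k) (auto simp: lprod_snoc)
next
  case False
  then have "length u + k - 1 = k + (length u - 1)" by (cases u) auto
  then show ?thesis using assms False by (simp add: lprod_snoc tpow_mult tpow_tpow)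
qed

text \<open>
  Such products are the tensor factors of \<open>\<Delta>(P(u, v))\<close>, where \<open>u\<close> and \<open>v\<close> are split into \<open>u1\<close>, \<open>v1\<close> and
  words of lengths \<open>k\<close>, \<open>l\<close>. The conditions say that \<open>u\<close> and \<open>v\<close> are nonempty; \<open>u1\<close> and \<open>v1\<close> may be
  empty, and then multiplication by \<open>u(1)\<close> again adjusts the exponent.
\<close>

lemma tpow_pprod:
  assumes "set u1 \<subseteq> carrier A" "set v1 \<subseteq> carrier A" "length u1 + k > 0" "length v1 + l > 0"
  shows "tpow A (length v1 + l - 1 + k) (lprod u1) \<otimes> tpow A (length u1 + k - 1 + l) (lprod v1)
    = tpow A (k + l) (pprod (u1, v1))"
proof (cases "u1 = [] \<or> v1 = []")
  case True
  then show ?thesis using assms by (cases k; cases l) (auto simp: add.commute)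
next
  case False
  then have eq: "length v1 + l - 1 + k = k + l + (length v1 - 1)" "length u1 + k - 1 + l = k + l + (length u1 - 1)"
    by (cases u1; cases v1; simp)+
  show ?thesis unfolding eq using assms False by (simp add: pprod_nonempty tpow_mult tpow_tpow)
qed

text \<open>
  Appending a primitive letter \<open>s\<close> multiplies \<open>\<Delta>\<close> by \<open>u(1) \<otimes> s + s \<otimes> u(1)\<close>, up to powers of the twisting
  map: the letter joins either part of each splitting, and the other part is twisted once more.
\<close>

lemma \<Delta>_lprod:
  assumes "set u \<subseteq> primitives"
  shows "\<Delta> (lprod u) = lsum AA (\<lambda>(x, y). tpow A (length y) (lprod x) \<bowtie> tpow A (length x) (lprod y)) (word_coprod u)"
  using assms
proof (induction u rule: rev_induct)
  case Nil
  then show ?case by (simp add: \<Delta>_unit)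
next
  case (snoc s u)
  let ?f = "\<lambda>(x, y). tpow A (length y) (lprod x) \<bowtie> tpow A (length x) (lprod y)"
  have s: "s \<in> primitives" and u: "set u \<subseteq> primitives" using snoc.prems by auto
  show ?case
  proof (cases "u = []")
    case True
    then show ?thesis using s by (simp add: \<Delta>_primitive T.M.a_ac)
  next
    case False
    let ?y = "tpow A (length u - 1) s"
    have y: "?y \<in> primitives" by (rule primitive_tpow[OF s])
    have wc: "set x1 \<subseteq> carrier A" "set x2 \<subseteq> carrier A" "length x1 + length x2 = length u"
      if "(x1, x2) \<in> set (word_coprod u)" for x1 x2
      using set_word_coprod[OF that] length_word_coprod[OF that] u primitives_carrier by blast+
    have fc: "?f p \<in> carrier AA" if "p \<in> set (word_coprod u)" for p
      using that wc[of "fst p" "snd p"] by (simp add: case_prod_unfold)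
    let ?ws = "map (\<lambda>(x, y). (x @ [s], y)) (word_coprod u) @ map (\<lambda>(x, y). (x, y @ [s])) (word_coprod u)"
    have snoc_closed: "?f p \<in> carrier AA" if "p \<in> set (map (\<lambda>(x, y). (x @ [s], y)) (word_coprod u)) \<union>
        set (map (\<lambda>(x, y). (x, y @ [s])) (word_coprod u))" for p
      using that wc(1,2) s by (force simp: case_prod_unfold)
    have "\<Delta> (lprod (u @ [s])) = \<Delta> (lprod u) \<otimes>\<^bsub>AA\<^esub> \<Delta> ?y"
      using False u s primitives_carrier by (subst lprod_snoc) (simp add: subset_iff \<Delta>_mult)
    also have "\<dots> = lsum AA ?f (word_coprod u) \<otimes>\<^bsub>AA\<^esub> (\<one> \<bowtie> ?y \<oplus>\<^bsub>AA\<^esub> ?y \<bowtie> \<one>)"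
      using snoc.IH[OF u] \<Delta>_primitive[OF y] by simp
    also have "\<dots> = lsum AA (\<lambda>p. ?f p \<otimes>\<^bsub>AA\<^esub> (\<one> \<bowtie> ?y \<oplus>\<^bsub>AA\<^esub> ?y \<bowtie> \<one>)) (word_coprod u)"
      using y fc by (intro linear.lsum_image[OF T.linear_right]) auto
    also have "\<dots> = lsum AA (\<lambda>p. ?f (case p of (x1, x2) \<Rightarrow> (x1 @ [s], x2)) \<oplus>\<^bsub>AA\<^esub>
        ?f (case p of (x1, x2) \<Rightarrow> (x1, x2 @ [s]))) (word_coprod u)"
    proof (rule lsum_cong)
      fix p assume "p \<in> set (word_coprod u)"
      then obtain x1 x2 where p: "p = (x1, x2)" and x: "(x1, x2) \<in> set (word_coprod u)" by (metis surj_pair)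
      note w = wc[OF x]
      have len: "length u - 1 = length x1 + length x2 - 1" "length u - 1 = length x2 + length x1 - 1"
        "length x1 + length x2 > 0" "length x2 + length x1 > 0"
        using w(3) False by auto
      have "?f (x1, x2) \<otimes>\<^bsub>AA\<^esub> (\<one> \<bowtie> ?y \<oplus>\<^bsub>AA\<^esub> ?y \<bowtie> \<one>) =
          tpow A (Suc (length x2)) (lprod x1) \<bowtie> (tpow A (length x1) (lprod x2) \<otimes> ?y) \<oplus>\<^bsub>AA\<^esub>
          (tpow A (length x2) (lprod x1) \<otimes> ?y) \<bowtie> tpow A (Suc (length x1)) (lprod x2)"
        using w y by (simp add: T.mult_add_right TP.tensor_mult)
      also have "tpow A (length x1) (lprod x2) \<otimes> ?y = tpow A (length x1) (lprod (x2 @ [s]))"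
        unfolding len(2) using w s len by (intro tpow_lprod_snoc) auto
      also have "tpow A (length x2) (lprod x1) \<otimes> ?y = tpow A (length x2) (lprod (x1 @ [s]))"
        unfolding len(1) using w s len by (intro tpow_lprod_snoc) auto
      finally show "?f p \<otimes>\<^bsub>AA\<^esub> (\<one> \<bowtie> ?y \<oplus>\<^bsub>AA\<^esub> ?y \<bowtie> \<one>) =
          ?f (case p of (x1, x2) \<Rightarrow> (x1 @ [s], x2)) \<oplus>\<^bsub>AA\<^esub>
          ?f (case p of (x1, x2) \<Rightarrow> (x1, x2 @ [s]))"
        unfolding p using w s by (simp add: T.M.a_comm del: funpow.simps)
    qed
    also have "\<dots> = lsum AA (\<lambda>p. ?f (case p of (x1, x2) \<Rightarrow> (x1 @ [s], x2))) (word_coprod u) \<oplus>\<^bsub>AA\<^esub>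
        lsum AA (\<lambda>p. ?f (case p of (x1, x2) \<Rightarrow> (x1, x2 @ [s]))) (word_coprod u)"
      using wc s by (intro T.lsum_add; clarsimp)
    also have "\<dots> = lsum AA ?f ?ws"
      using T.lsum_append[of "map (\<lambda>(x, y). (x @ [s], y)) (word_coprod u)"
          "map (\<lambda>(x, y). (x, y @ [s])) (word_coprod u)" ?f, OF snoc_closed]
      by (simp add: o_def del: map_append)
    also have "\<dots> = lsum AA ?f (word_coprod (u @ [s]))"
      using snoc_closed by (intro T.lsum_mset) (simp_all only: word_coprod_snoc set_append)
    finally show ?thesis .
  qed
qed

lemma \<Delta>_tpow_lprod:
  assumes "set u \<subseteq> primitives"
  shows "\<Delta> (tpow A m (lprod u)) = lsum AA (\<lambda>(x, y). tpow A (m + length y) (lprod x) \<bowtie>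
    tpow A (m + length x) (lprod y)) (word_coprod u)"
proof -
  have u: "set u \<subseteq> carrier A" using assms by auto
  have w: "set (fst p) \<subseteq> carrier A" "set (snd p) \<subseteq> carrier A" if "p \<in> set (word_coprod u)" for p
    using set_word_coprod[of "fst p" "snd p" u] that u by auto
  show ?thesis unfolding \<Delta>_tpow[OF lprod_closed[OF u]] \<Delta>_lprod[OF assms] case_prod_unfold
    using w by (subst T.tp.lsum_image) (simp, intro lsum_cong, simp add: tensor_tpow tpow_tpow)
qed

lemma lsum_pair_coprod:
  "lsum V F (pair_coprod (u, v)) = lsum V (\<lambda>(x, y). F ((fst x, fst y), (snd x, snd y)))
     (List.product (word_coprod u) (word_coprod v))"
  by (simp add: pair_coprod_def o_def case_prod_unfold)

text \<open>
  Cocommutativity of the splitting: when a primitive factor is multiplied in, the terms in which it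
  goes to the left tensor factor are thereby indexed like those in which it goes to the right.
\<close>

lemma lsum_pair_coprod_sym:
  assumes p: "p \<in> words_over C"
    and f: "\<And>x y. x \<in> words_over C \<Longrightarrow> y \<in> words_over C \<Longrightarrow> f x y \<in> carrier AA"
    and g: "\<And>x y. x \<in> words_over C \<Longrightarrow> y \<in> words_over C \<Longrightarrow> g x y \<in> carrier AA"
  shows "lsum AA (\<lambda>(x, y). f x y \<oplus>\<^bsub>AA\<^esub> g y x) (pair_coprod p) =
    lsum AA (\<lambda>(x, y). f x y \<oplus>\<^bsub>AA\<^esub> g x y) (pair_coprod p)"
proof -
  have w: "fst r \<in> words_over C" "snd r \<in> words_over C" if "r \<in> set (pair_coprod p)" for r
    using pair_coprod_over[of "fst r" "snd r" p] that p by auto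
  have "lsum AA (\<lambda>(x, y). g y x) (pair_coprod p) = lsum AA (\<lambda>(x, y). g x y) (map prod.swap (pair_coprod p))"
    by (simp add: o_def case_prod_unfold)
  also have "\<dots> = lsum AA (\<lambda>(x, y). g x y) (pair_coprod p)"
    by (rule T.lsum_mset[OF pair_coprod_swap]) (auto simp: case_prod_unfold intro!: g dest: w)
  finally show ?thesis
    using w by (simp add: case_prod_unfold T.lsum_add f g)
qed

text \<open>
  Multiply the expansions of the two left-normed products. Only the case of two nonempty words
  involves a product.
\<close>

lemma \<Delta>_pprod:
  assumes p: "p \<in> words_over primitives"
  shows "\<Delta> (pprod p) = lsum AA (\<lambda>(x, y). tpow A (pair_size y) (pprod x) \<bowtie>
    tpow A (pair_size x) (pprod y)) (pair_coprod p)"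
proof -
  obtain u v where uv: "p = (u, v)" and u: "set u \<subseteq> primitives" and v: "set v \<subseteq> primitives"
    using p by (cases p) auto
  have c: "set u \<subseteq> carrier A" "set v \<subseteq> carrier A" using u v by auto
  have single: "List.product xs [y] = map (\<lambda>x. (x, y)) xs" for xs :: "('a list \<times> 'a list) list" and y :: "'a list \<times> 'a list"
    by (induction xs) auto
  show ?thesis
  proof (cases "u = [] \<or> v = []")
    case True
    then show ?thesis using u v unfolding uv
      by (auto simp: lsum_pair_coprod \<Delta>_lprod single o_def case_prod_unfold)
  next
    case False
    let ?f = "\<lambda>m (x, y). tpow A (m + length y) (lprod x) \<bowtie> tpow A (m + length x) (lprod y)"
    have w: "set (fst r) \<subseteq> carrier A" "set (snd r) \<subseteq> carrier A"
      if "r \<in> set (word_coprod w)" "set w \<subseteq> carrier A" for r w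
      using set_word_coprod[of "fst r" "snd r" w] that by auto
    have "\<Delta> (pprod p) = lsum AA (?f (length v - 1)) (word_coprod u) \<otimes>\<^bsub>AA\<^esub>
        lsum AA (?f (length u - 1)) (word_coprod v)"
      using False c by (simp add: uv pprod_nonempty \<Delta>_mult \<Delta>_tpow_lprod[OF u] \<Delta>_tpow_lprod[OF v])
    also have "\<dots> = lsum AA (\<lambda>(x, y). ?f (length v - 1) x \<otimes>\<^bsub>AA\<^esub> ?f (length u - 1) y)
        (List.product (word_coprod u) (word_coprod v))"
      using w c by (intro T.mult_lsum_lsum) (simp_all add: case_prod_unfold)
    also have "\<dots> = lsum AA (\<lambda>(x, y). tpow A (pair_size y) (pprod x) \<bowtie>
        tpow A (pair_size x) (pprod y)) (pair_coprod p)"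
      unfolding uv lsum_pair_coprod
    proof (rule lsum_cong)
      fix r assume r: "r \<in> set (List.product (word_coprod u) (word_coprod v))"
      obtain u1 u2 v1 v2 where r': "r = ((u1, u2), (v1, v2))" by (metis surj_pair)
      have wu: "(u1, u2) \<in> set (word_coprod u)" and wv: "(v1, v2) \<in> set (word_coprod v)"
        using r by (auto simp: r')
      have cc: "set u1 \<subseteq> carrier A" "set u2 \<subseteq> carrier A" "set v1 \<subseteq> carrier A" "set v2 \<subseteq> carrier A"
        using w[OF wu c(1)] w[OF wv c(2)] by auto
      have lu: "length u = length u1 + length u2" "length u = length u2 + length u1" "length u > 0"
        and lv: "length v = length v1 + length v2" "length v = length v2 + length v1" "length v > 0"
        using length_word_coprod[OF wu] length_word_coprod[OF wv] False by auto
      have 1: "tpow A (length v - 1 + length u2) (lprod u1) \<otimes> tpow A (length u - 1 + length v2) (lprod v1) =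
          tpow A (length u2 + length v2) (pprod (u1, v1))"
        unfolding lu(1) lv(1) using cc lu lv by (intro tpow_pprod) auto
      have 2: "tpow A (length v - 1 + length u1) (lprod u2) \<otimes> tpow A (length u - 1 + length v1) (lprod v2) =
          tpow A (length u1 + length v1) (pprod (u2, v2))"
        unfolding lu(2) lv(2) using cc lu lv by (intro tpow_pprod) auto
      show "(case r of (x, y) \<Rightarrow> ?f (length v - 1) x \<otimes>\<^bsub>AA\<^esub> ?f (length u - 1) y) =
        (case r of (x, y) \<Rightarrow> case ((fst x, fst y), (snd x, snd y)) of (x, y) \<Rightarrow>
          tpow A (pair_size y) (pprod x) \<bowtie> tpow A (pair_size x) (pprod y))"
        using cc by (simp add: r' TP.tensor_mult 1[simplified] 2[simplified])
    qed
    finally show ?thesis .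
  qed
qed

end

section \<open>The operations \<open>q\<close> on primitive elements\<close>

lemma (in homalg) morphism_hom_assoc:
  assumes "hom_algebra B" "hom_alg_morphism A B f" "a \<in> carrier A" "b \<in> carrier A" "c \<in> carrier A"
  shows "f (hom_assoc A a b c) = hom_assoc B (f a) (f b) (f c)"
proof -
  interpret B: homalg B by (rule homalg.intro) fact
  interpret f: linear A B f by (rule linearI[OF vec_space B.vec_space hom_alg_morphismD(1)[OF assms(2)]])
  show ?thesis using assms by (simp add: hom_assoc_def f.minus hom_alg_morphismD[OF assms(2)])
qed

text \<open>
  Hence a splitting of two words contributes to the coproduct of their associator with a primitive \<open>z\<close>
  only if, in the tensor factor that \<open>z\<close> goes to, both parts are nonempty.
\<close>

lemma (in unital_homalg) hom_assoc_unit: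
  "b \<in> carrier A \<Longrightarrow> c \<in> carrier A \<Longrightarrow> hom_assoc A \<one> b c = \<zero>"
  "b \<in> carrier A \<Longrightarrow> c \<in> carrier A \<Longrightarrow> hom_assoc A b \<one> c = \<zero>"
  by (simp_all add: hom_assoc_def twist_mult diff_eq_zero_iff)

lemma concat_split_filter:
  "[f u1 u2 v1 v2. (u1, u2) \<leftarrow> us, (v1, v2) \<leftarrow> vs, length u1 + length v1 > 0] =
   map (\<lambda>(x, y). f (fst x) (fst y) (snd x) (snd y))
     (filter (\<lambda>(x, y). pair_size x > 0) (map (\<lambda>((u1, u2), (v1, v2)). ((u1, v1), (u2, v2))) (List.product us vs)))"
proof (induction us)
  case (Cons u us)
  obtain u1 u2 where u: "u = (u1, u2)" by (cases u)
  have "concat (map (\<lambda>(v1, v2). if length u1 + length v1 > 0 then [f u1 u2 v1 v2] else []) vs) =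
    map (\<lambda>(x, y). f (fst x) (fst y) (snd x) (snd y))
     (filter (\<lambda>(x, y). pair_size x > 0) (map ((\<lambda>((u1, u2), (v1, v2)). ((u1, v1), (u2, v2))) \<circ> Pair u) vs))"
    by (induction vs) (auto simp: u)
  then show ?case using Cons by (simp add: u)
qed simp

text \<open>
  Both double sums are rearrangements of one sum over the threefold splittings.
\<close>

lemma (in vect) lsum_pair_coprod_coassoc:
  assumes p: "p \<in> words_over C"
    and f: "\<And>x y z. x \<in> words_over C \<Longrightarrow> y \<in> words_over C \<Longrightarrow> z \<in> words_over C \<Longrightarrow> f x y z \<in> carrier V"
  shows "lsum V (\<lambda>(a, z). lsum V (\<lambda>(x, y). f x y z) (pair_coprod a)) (pair_coprod p) =
    lsum V (\<lambda>(x, r). lsum V (\<lambda>(y, z). f x y z) (pair_coprod r)) (pair_coprod p)"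
proof -
  let ?L = "concat (map (\<lambda>(a, z). map (\<lambda>(x, y). (x, y, z)) (pair_coprod a)) (pair_coprod p))"
  let ?R = "concat (map (\<lambda>(x, r). map (\<lambda>(y, z). (x, y, z)) (pair_coprod r)) (pair_coprod p))"
  let ?f = "\<lambda>(x, y, z). f x y z"
  have l: "f (fst t) (snd t) (snd s) \<in> carrier V"
    if "s \<in> set (pair_coprod p)" "t \<in> set (pair_coprod (fst s))" for s t
    using that pair_coprod_over[of "fst s" "snd s" p C] pair_coprod_over[of "fst t" "snd t" "fst s" C] p
    by (intro f) simp_all
  have r: "f (fst s) (fst t) (snd t) \<in> carrier V"
    if "s \<in> set (pair_coprod p)" "t \<in> set (pair_coprod (snd s))" for s t
    using that pair_coprod_over[of "fst s" "snd s" p C] pair_coprod_over[of "fst t" "snd t" "snd s" C] p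
    by (intro f) simp_all
  have "lsum V (\<lambda>(a, z). lsum V (\<lambda>(x, y). f x y z) (pair_coprod a)) (pair_coprod p) = lsum V ?f ?L"
    unfolding map_concat map_map case_prod_unfold
    by (subst sum_terms_concat) (use l in \<open>force simp: o_def\<close>)+
  also have "\<dots> = lsum V ?f ?R"
    by (rule lsum_mset[OF pair_coprod_coassoc]) (use l in \<open>force simp: case_prod_unfold\<close>)
  also have "\<dots> = lsum V (\<lambda>(x, r). lsum V (\<lambda>(y, z). f x y z) (pair_coprod r)) (pair_coprod p)"
    unfolding map_concat map_map case_prod_unfold
    by (subst sum_terms_concat) (use r in \<open>force simp: o_def\<close>)+
  finally show ?thesis .
qed

context coproduct begin

abbreviation q :: "'a \<Rightarrow> 'a words \<Rightarrow> 'a" where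
  "q z p \<equiv> q_op A (fst p) (snd p) z"

text \<open>
  The associator that the recursion for \<open>q\<close> decomposes; \<open>q\<close> vanishes if \<open>u\<close> or \<open>v\<close> is empty, and
  so must this.
\<close>

definition prod_assoc :: "'a \<Rightarrow> 'a words \<Rightarrow> 'a" where
  "prod_assoc z = (\<lambda>(u, v). if u = [] \<or> v = [] then \<zero>
     else hom_assoc A (tpow A (length v - 1) (lprod u)) (tpow A (length u - 1) (lprod v))
       (tpow A (length u + length v - 2) z))"

text \<open>
  The summands of the decomposition of \<open>prod_assoc\<close>. With \<open>q\<close> itself as the value for the pair of empty
  words, \<open>q\<close> becomes one of the summands.
\<close>

definition q_term :: "'a \<Rightarrow> 'a words \<Rightarrow> 'a words \<Rightarrow> 'a" where
  "q_term z x y = (if x = ([], []) then q z y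
     else tpow A (pair_size y) (pprod x) \<otimes> tpow A (pair_size x - 1) (q z y))"

lemma q_empty: "fst p = [] \<or> snd p = [] \<Longrightarrow> q z p = \<zero>"
  by (subst q_op.simps) auto

lemma prod_assoc_closed [simp]:
  "p \<in> words_over (carrier A) \<Longrightarrow> z \<in> carrier A \<Longrightarrow> prod_assoc z p \<in> carrier A"
  by (cases p) (auto simp: prod_assoc_def)

lemma q_eq:
  assumes "fst p \<noteq> []" "snd p \<noteq> []"
  shows "q z p = prod_assoc z p \<ominus>
    lsum A (\<lambda>(x, y). q_term z x y) (filter (\<lambda>(x, y). pair_size x > 0) (pair_coprod p))"
proof -
  obtain u v where p: "p = (u, v)" by (cases p)
  let ?t = "\<lambda>u1 u2 v1 v2. tpow A (length u2 + length v2) (inner_prod A u1 v1) \<otimes>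
    tpow A (length u1 + length v1 - 1) (q_op A u2 v2 z)"
  have "q z p = prod_assoc z p \<ominus> sum_terms A
      [?t u1 u2 v1 v2. (u1, u2) \<leftarrow> word_coprod u, (v1, v2) \<leftarrow> word_coprod v, length u1 + length v1 > 0]"
    using assms unfolding p fst_conv snd_conv
    by (subst q_op.simps) (simp add: prod_assoc_def lprod_def)
  also have "\<dots> = prod_assoc z p \<ominus> lsum A (\<lambda>(x, y). ?t (fst x) (fst y) (snd x) (snd y))
      (filter (\<lambda>(x, y). pair_size x > 0) (pair_coprod p))"
    unfolding concat_split_filter by (simp add: p pair_coprod_def)
  also have "lsum A (\<lambda>(x, y). ?t (fst x) (fst y) (snd x) (snd y))
        (filter (\<lambda>(x, y). pair_size x > 0) (pair_coprod p)) =
      lsum A (\<lambda>(x, y). q_term z x y) (filter (\<lambda>(x, y). pair_size x > 0) (pair_coprod p))"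
    by (rule lsum_cong) (auto simp: q_term_def pprod_def pair_size_def)
  finally show ?thesis .
qed

lemma q_closed:
  assumes "p \<in> words_over (carrier A)" "z \<in> carrier A" shows "q z p \<in> carrier A"
  using assms(1)
proof (induction "pair_size p" arbitrary: p rule: less_induct)
  case less
  show ?case
  proof (cases "fst p = [] \<or> snd p = []")
    case True
    then show ?thesis by (simp add: q_empty)
  next
    case False
    have "q_term z x y \<in> carrier A" if xy: "(x, y) \<in> set (pair_coprod p)" "pair_size x > 0" for x y
    proof -
      have "q z y \<in> carrier A"
        using pair_coprod_size[OF xy(1)] xy(2) pair_coprod_over[OF xy(1) less.prems] by (intro less.hyps) auto
      then show ?thesis using pair_coprod_over[OF xy(1) less.prems] by (simp add: q_term_def)
    qed
    then have "lsum A (\<lambda>(x, y). q_term z x y) (filter (\<lambda>(x, y). pair_size x > 0) (pair_coprod p)) \<in> carrier A"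
      by (intro lsum_closed) auto
    then show ?thesis using False assms(2) less.prems by (simp add: q_eq)
  qed
qed

lemma q_term_closed [simp]:
  "x \<in> words_over (carrier A) \<Longrightarrow> y \<in> words_over (carrier A) \<Longrightarrow> z \<in> carrier A \<Longrightarrow> q_term z x y \<in> carrier A"
  by (simp add: q_term_def q_closed)

lemma add_diff_cancel:
  "a \<in> carrier A \<Longrightarrow> s \<in> carrier A \<Longrightarrow> s \<oplus> (a \<ominus> s) = a"
  by (metis M.a_comm M.a_inv_closed M.minus_eq M.r_neg2)

lemma prod_assoc_eq_sum:
  assumes p: "p \<in> words_over (carrier A)" and z: "z \<in> carrier A"
  shows "prod_assoc z p = lsum A (\<lambda>(x, y). q_term z x y) (pair_coprod p)"
proof (cases "fst p = [] \<or> snd p = []")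
  case True
  have "q_term z x y = \<zero>" if xy: "(x, y) \<in> set (pair_coprod p)" for x y
  proof -
    have "q z y = \<zero>" using True xy by (intro q_empty) (auto simp: set_pair_coprod)
    then show ?thesis using pair_coprod_over[OF xy p] by (simp add: q_term_def)
  qed
  then have "lsum A (\<lambda>(x, y). q_term z x y) (pair_coprod p) = \<zero>" by (intro lsum_zero) auto
  then show ?thesis using True by (auto simp: prod_assoc_def case_prod_unfold)
next
  case False
  obtain ps where ps: "pair_coprod p = ps @ [(([], []), p)]" "\<forall>(x, y)\<in>set ps. x \<noteq> ([], [])"
    using pair_coprod_last by blast
  have "pair_size x > 0 \<longleftrightarrow> x \<noteq> ([], [])" for x :: "'a words" by (cases x) auto
  then have "filter (\<lambda>(x, y). pair_size x > 0) ps = ps"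
    using ps(2) by (auto simp: filter_id_conv)
  then have flt: "filter (\<lambda>(x, y). pair_size x > 0) (pair_coprod p) = ps" by (simp add: ps(1))
  have c: "(case r of (x, y) \<Rightarrow> q_term z x y) \<in> carrier A" if "r \<in> set ps" for r
    using that pair_coprod_over[of "fst r" "snd r" p] p z by (simp add: ps(1) case_prod_unfold)
  have "prod_assoc z p = lsum A (\<lambda>(x, y). q_term z x y) ps \<oplus> q z p"
    unfolding q_eq[OF False[unfolded de_Morgan_disj, THEN conjunct1] False[unfolded de_Morgan_disj, THEN conjunct2]] flt
    using c p z by (intro add_diff_cancel[symmetric] lsum_closed) auto
  also have "\<dots> = lsum A (\<lambda>(x, y). q_term z x y) (ps @ [(([], []), p)])"
    using c q_closed[OF p z] by (subst lsum_append) (auto simp: q_term_def)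
  finally show ?thesis by (simp add: ps(1))
qed

text \<open>
  The counterpart of \<open>tpow_pprod\<close> for associators, with the same meaning of \<open>k\<close> and \<open>l\<close>: an associator of
  tensor factors of \<open>\<Delta>([u])\<close> and \<open>\<Delta>([v])\<close> with \<open>z\<close> is a twisted \<open>prod_assoc\<close>.
\<close>

lemma tpow_prod_assoc:
  assumes "set u \<subseteq> carrier A" "set v \<subseteq> carrier A" "z \<in> carrier A" "length u + k > 0" "length v + l > 0"
  shows "hom_assoc A (tpow A (length v + l - 1 + k) (lprod u)) (tpow A (length u + k - 1 + l) (lprod v))
      (tpow A (length u + k + (length v + l) - 2) z) = tpow A (k + l) (prod_assoc z (u, v))"
proof (cases "u = [] \<or> v = []")
  case True
  then show ?thesis using assms by (auto simp: prod_assoc_def hom_assoc_unit)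
next
  case False
  then have eq: "length v + l - 1 + k = k + l + (length v - 1)" "length u + k - 1 + l = k + l + (length u - 1)"
    "length u + k + (length v + l) - 2 = k + l + (length u + length v - 2)"
    by (cases u; cases v; simp)+
  show ?thesis unfolding eq using assms False by (simp add: prod_assoc_def tpow_hom_assoc tpow_tpow)
qed

lemma hom_assoc_tensor:
  assumes "a \<in> carrier A" "b \<in> carrier A" "a' \<in> carrier A" "b' \<in> carrier A" "c \<in> carrier A"
  shows "hom_assoc AA (a \<bowtie> a') (b \<bowtie> b') (\<one> \<bowtie> c) = twist A (a \<otimes> b) \<bowtie> hom_assoc A a' b' c"
    and "hom_assoc AA (a \<bowtie> a') (b \<bowtie> b') (c \<bowtie> \<one>) = hom_assoc A a b c \<bowtie> twist A (a' \<otimes> b')"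
  using assms linear.minus[OF linear_tens_right] linear.minus[OF linear_tens_left]
  by (simp_all add: hom_assoc_def TP.tensor_twist TP.tensor_mult twist_mult)

text \<open>
  The two kinds of terms of the coproduct of \<open>prod_assoc\<close>: \<open>z\<close> goes to the right, respectively left, tensor factor.
\<close>

definition assoc_left :: "'a \<Rightarrow> 'a words \<Rightarrow> 'a words \<Rightarrow> (('a \<times> 'a) \<Rightarrow>\<^sub>0 'k) set" where
  "assoc_left z x y = tpow A (pair_size y + 1) (pprod x) \<bowtie> tpow A (pair_size x) (prod_assoc z y)"

definition assoc_right :: "'a \<Rightarrow> 'a words \<Rightarrow> 'a words \<Rightarrow> (('a \<times> 'a) \<Rightarrow>\<^sub>0 'k) set" where
  "assoc_right z x y = tpow A (pair_size x) (prod_assoc z y) \<bowtie> tpow A (pair_size y + 1) (pprod x)"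

text \<open>
  Expand the associator of \<open>\<Delta>([u])\<close>, \<open>\<Delta>([v])\<close> and \<open>u(1) \<otimes> z + z \<otimes> u(1)\<close> by trilinearity. In the tensor factor
  that receives \<open>u(1)\<close> in place of \<open>z\<close>, both bracketings give the same twisted product, so that the
  difference is formed in the other factor only.
\<close>

lemma \<Delta>_prod_assoc:
  assumes p: "p \<in> words_over primitives" and z: "z \<in> primitives"
  shows "\<Delta> (prod_assoc z p) =
    lsum AA (\<lambda>(x, y). assoc_left z x y \<oplus>\<^bsub>AA\<^esub> assoc_right z x y) (pair_coprod p)"
proof -
  obtain u v where uv: "p = (u, v)" and u: "set u \<subseteq> primitives" and v: "set v \<subseteq> primitives"
    using p by (cases p) auto
  have c: "set u \<subseteq> carrier A" "set v \<subseteq> carrier A" "z \<in> carrier A" using u v z by auto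
  have pc: "p \<in> words_over (carrier A)" using c by (simp add: uv)
  show ?thesis
  proof (cases "u = [] \<or> v = []")
    case True
    have "assoc_left z x y \<oplus>\<^bsub>AA\<^esub> assoc_right z x y = \<zero>\<^bsub>AA\<^esub>" if xy: "(x, y) \<in> set (pair_coprod p)" for x y
    proof -
      have "prod_assoc z y = \<zero>" using True xy
        by (cases y) (auto simp: uv prod_assoc_def set_pair_coprod)
      then show ?thesis using pair_coprod_over[OF xy pc] by (simp add: assoc_left_def assoc_right_def)
    qed
    then have "lsum AA (\<lambda>(x, y). assoc_left z x y \<oplus>\<^bsub>AA\<^esub> assoc_right z x y) (pair_coprod p) = \<zero>\<^bsub>AA\<^esub>"
      by (intro T.lsum_zero) auto
    moreover have "prod_assoc z p = \<zero>" using True by (auto simp: uv prod_assoc_def)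
    ultimately show ?thesis by (simp add: D.zero)
  next
    case False
    let ?f = "\<lambda>m (x, y). tpow A (m + length y) (lprod x) \<bowtie> tpow A (m + length x) (lprod y)"
    let ?w = "tpow A (length u + length v - 2) z"
    let ?W = "\<one> \<bowtie> ?w \<oplus>\<^bsub>AA\<^esub> ?w \<bowtie> \<one>"
    have w: "set (fst r) \<subseteq> carrier A" "set (snd r) \<subseteq> carrier A"
      if "r \<in> set (word_coprod w)" "set w \<subseteq> carrier A" for r w
      using set_word_coprod[of "fst r" "snd r" w] that by auto
    have "\<Delta> (prod_assoc z p) = hom_assoc AA (lsum AA (?f (length v - 1)) (word_coprod u))
        (lsum AA (?f (length u - 1)) (word_coprod v)) ?W"
      using False c \<Delta>_primitive[OF primitive_tpow[OF z]]
      by (simp add: uv prod_assoc_def morphism_hom_assoc[OF T.hom_algebra \<Delta>] \<Delta>_tpow_lprod[OF u] \<Delta>_tpow_lprod[OF v])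
    also have "\<dots> = lsum AA (\<lambda>(x, y). hom_assoc AA (?f (length v - 1) x) (?f (length u - 1) y) ?W)
        (List.product (word_coprod u) (word_coprod v))"
      using w c by (intro T.hom_assoc_lsum) (simp_all add: case_prod_unfold)
    also have "\<dots> = lsum AA (\<lambda>(x, y). assoc_left z x y \<oplus>\<^bsub>AA\<^esub> assoc_right z y x) (pair_coprod p)"
      unfolding uv lsum_pair_coprod
    proof (rule lsum_cong)
      fix r assume r: "r \<in> set (List.product (word_coprod u) (word_coprod v))"
      obtain u1 u2 v1 v2 where r': "r = ((u1, u2), (v1, v2))" by (metis surj_pair)
      have wu: "(u1, u2) \<in> set (word_coprod u)" and wv: "(v1, v2) \<in> set (word_coprod v)"
        using r by (auto simp: r')
      have cc: "set u1 \<subseteq> carrier A" "set u2 \<subseteq> carrier A" "set v1 \<subseteq> carrier A" "set v2 \<subseteq> carrier A"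
        using w[OF wu c(1)] w[OF wv c(2)] by auto
      have lu: "length u = length u1 + length u2" "length u = length u2 + length u1" "length u > 0"
        and lv: "length v = length v1 + length v2" "length v = length v2 + length v1" "length v > 0"
        using length_word_coprod[OF wu] length_word_coprod[OF wv] False by auto
      let ?a = "tpow A (length v - 1 + length u2) (lprod u1)" and ?b = "tpow A (length u - 1 + length v2) (lprod v1)"
      let ?a' = "tpow A (length v - 1 + length u1) (lprod u2)" and ?b' = "tpow A (length u - 1 + length v1) (lprod v2)"
      have 1: "?a \<otimes> ?b = tpow A (length u2 + length v2) (pprod (u1, v1))"
        unfolding lu(1) lv(1) using cc lu lv by (intro tpow_pprod) auto
      have 2: "?a' \<otimes> ?b' = tpow A (length u1 + length v1) (pprod (u2, v2))"
        unfolding lu(2) lv(2) using cc lu lv by (intro tpow_pprod) auto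
      have 3: "hom_assoc A ?a ?b ?w = tpow A (length u2 + length v2) (prod_assoc z (u1, v1))"
        unfolding lu(1) lv(1) using cc lu lv c by (intro tpow_prod_assoc) auto
      have 4: "hom_assoc A ?a' ?b' ?w = tpow A (length u1 + length v1) (prod_assoc z (u2, v2))"
        unfolding lu(2) lv(2) using cc lu lv c by (intro tpow_prod_assoc) auto
      have "hom_assoc AA (?a \<bowtie> ?a') (?b \<bowtie> ?b') ?W =
          hom_assoc AA (?a \<bowtie> ?a') (?b \<bowtie> ?b') (\<one> \<bowtie> ?w) \<oplus>\<^bsub>AA\<^esub> hom_assoc AA (?a \<bowtie> ?a') (?b \<bowtie> ?b') (?w \<bowtie> \<one>)"
        using cc c by (intro linear_mapD(2)[OF T.linear_hom_assoc(3)]) auto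
      also have "\<dots> = assoc_left z (u1, v1) (u2, v2) \<oplus>\<^bsub>AA\<^esub> assoc_right z (u2, v2) (u1, v1)"
        using cc c by (subst hom_assoc_tensor, simp_all, subst hom_assoc_tensor, simp_all
            add: 1[simplified] 2[simplified] 3[simplified] 4[simplified] assoc_left_def assoc_right_def)
      finally show "(case r of (x, y) \<Rightarrow> hom_assoc AA (?f (length v - 1) x) (?f (length u - 1) y) ?W) =
        (case r of (x, y) \<Rightarrow> case ((fst x, fst y), (snd x, snd y)) of (x, y) \<Rightarrow>
          assoc_left z x y \<oplus>\<^bsub>AA\<^esub> assoc_right z y x)"
        by (simp add: r')
    qed
    also have "\<dots> = lsum AA (\<lambda>(x, y). assoc_left z x y \<oplus>\<^bsub>AA\<^esub> assoc_right z x y) (pair_coprod p)"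
      using c(3) by (intro lsum_pair_coprod_sym[OF pc]) (simp_all add: assoc_left_def assoc_right_def)
    finally show ?thesis .
  qed
qed

text \<open>
  What \<open>assoc_left\<close> and \<open>assoc_right\<close> become when \<open>prod_assoc\<close> is decomposed into its summands.
\<close>

definition term_left :: "'a \<Rightarrow> 'a words \<Rightarrow> 'a words \<Rightarrow> 'a words \<Rightarrow> (('a \<times> 'a) \<Rightarrow>\<^sub>0 'k) set" where
  "term_left z r x y = tpow A (pair_size x + pair_size y + 1) (pprod r) \<bowtie> tpow A (pair_size r) (q_term z x y)"

definition term_right :: "'a \<Rightarrow> 'a words \<Rightarrow> 'a words \<Rightarrow> 'a words \<Rightarrow> (('a \<times> 'a) \<Rightarrow>\<^sub>0 'k) set" where
  "term_right z r x y = tpow A (pair_size r) (q_term z x y) \<bowtie> tpow A (pair_size x + pair_size y + 1) (pprod r)"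

lemma term_closed [simp]:
  assumes "r \<in> words_over (carrier A)" "x \<in> words_over (carrier A)" "y \<in> words_over (carrier A)" "z \<in> carrier A"
  shows "term_left z r x y \<in> carrier AA" "term_right z r x y \<in> carrier AA"
  using assms by (simp_all add: term_left_def term_right_def)

lemma assoc_eq_sum_terms:
  assumes r: "r \<in> words_over (carrier A)" and p: "p \<in> words_over (carrier A)" and z: "z \<in> carrier A"
  shows "assoc_left z r p \<oplus>\<^bsub>AA\<^esub> assoc_right z r p =
    lsum AA (\<lambda>(x, y). term_left z r x y \<oplus>\<^bsub>AA\<^esub> term_right z r x y) (pair_coprod p)"
proof -
  let ?P = "tpow A (pair_size p + 1) (pprod r)"
  let ?t = "\<lambda>s. q_term z (fst s) (snd s)"
  have c: "?P \<in> carrier A" using r by simp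
  have w: "fst s \<in> words_over (carrier A)" "snd s \<in> words_over (carrier A)"
    "pair_size (fst s) + pair_size (snd s) = pair_size p"
    if "s \<in> set (pair_coprod p)" for s
    using pair_coprod_over[of "fst s" "snd s" p] pair_coprod_size[of "fst s" "snd s" p] that p by auto
  have t: "?t s \<in> carrier A" if "s \<in> set (pair_coprod p)" for s
    using w[OF that] z by simp
  have a: "tpow A (pair_size r) (prod_assoc z p) = lsum A (\<lambda>s. tpow A (pair_size r) (?t s)) (pair_coprod p)"
    unfolding prod_assoc_eq_sum[OF p z] case_prod_unfold by (rule tp.lsum_image) (rule t)
  have "assoc_left z r p = lsum AA (\<lambda>s. ?P \<bowtie> tpow A (pair_size r) (?t s)) (pair_coprod p)"
    unfolding assoc_left_def a by (rule linear.lsum_image[OF linear_tens_right[OF c]]) (simp add: t)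
  moreover have "assoc_right z r p = lsum AA (\<lambda>s. tpow A (pair_size r) (?t s) \<bowtie> ?P) (pair_coprod p)"
    unfolding assoc_right_def a by (rule linear.lsum_image[OF linear_tens_left[OF c]]) (simp add: t)
  moreover have "lsum AA (\<lambda>(x, y). term_left z r x y \<oplus>\<^bsub>AA\<^esub> term_right z r x y) (pair_coprod p) =
      lsum AA (\<lambda>s. ?P \<bowtie> tpow A (pair_size r) (?t s) \<oplus>\<^bsub>AA\<^esub> tpow A (pair_size r) (?t s) \<bowtie> ?P) (pair_coprod p)"
    by (rule lsum_cong) (simp add: case_prod_unfold term_left_def term_right_def w(3))
  ultimately show ?thesis
    using t c by (simp only: T.lsum_add TP.tensor_closed tp.closed)
qed

text \<open>
  The right-hand side has the same terms as \<open>assoc_eq_sum_terms\<close>, which is what makes the induction for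
  the primitivity of \<open>q\<close> close up by coassociativity.
\<close>

lemma \<Delta>_q_term:
  assumes r: "r \<in> words_over primitives" and y: "y \<in> words_over (carrier A)" and z: "z \<in> carrier A"
    and qy: "q z y \<in> primitives"
  shows "\<Delta> (q_term z r y) =
    lsum AA (\<lambda>(x, x'). term_left z x x' y \<oplus>\<^bsub>AA\<^esub> term_right z x x' y) (pair_coprod r)"
proof (cases "r = ([], [])")
  case True
  then show ?thesis using qy by (simp add: q_term_def term_left_def term_right_def \<Delta>_primitive)
next
  case False
  have rc: "r \<in> words_over (carrier A)" using r by (cases r) auto
  have r0: "pair_size r > 0" using False by (cases r) auto
  let ?c = "tpow A (pair_size r - 1) (q z y)"
  have c: "?c \<in> primitives" by (rule primitive_tpow[OF qy])
  let ?f = "\<lambda>(x, x'). tpow A (pair_size y + pair_size x') (pprod x) \<bowtie> tpow A (pair_size y + pair_size x) (pprod x')"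
  have w: "fst s \<in> words_over (carrier A)" "snd s \<in> words_over (carrier A)"
    "pair_size (fst s) + pair_size (snd s) = pair_size r"
    if "s \<in> set (pair_coprod r)" for s
    using pair_coprod_over[of "fst s" "snd s" r] pair_coprod_size[of "fst s" "snd s" r] that rc by auto
  have "\<Delta> (tpow A (pair_size y) (pprod r)) = lsum AA ?f (pair_coprod r)"
    unfolding \<Delta>_tpow[OF pprod_closed[OF rc]] \<Delta>_pprod[OF r] case_prod_unfold
    using w by (subst T.tp.lsum_image) (simp, intro lsum_cong, simp add: tensor_tpow tpow_tpow)
  then have "\<Delta> (q_term z r y) = lsum AA ?f (pair_coprod r) \<otimes>\<^bsub>AA\<^esub> (\<one> \<bowtie> ?c \<oplus>\<^bsub>AA\<^esub> ?c \<bowtie> \<one>)"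
    using False rc c by (simp add: q_term_def \<Delta>_mult \<Delta>_primitive)
  also have "\<dots> = lsum AA (\<lambda>s. ?f s \<otimes>\<^bsub>AA\<^esub> (\<one> \<bowtie> ?c \<oplus>\<^bsub>AA\<^esub> ?c \<bowtie> \<one>)) (pair_coprod r)"
    using c w by (intro linear.lsum_image[OF T.linear_right]) (simp_all add: case_prod_unfold)
  also have "\<dots> = lsum AA (\<lambda>(x, x'). term_left z x x' y \<oplus>\<^bsub>AA\<^esub> term_right z x' x y) (pair_coprod r)"
  proof (rule lsum_cong)
    fix s assume s: "s \<in> set (pair_coprod r)"
    obtain x x' where s': "s = (x, x')" by (cases s)
    have x: "x \<in> words_over (carrier A)" "x' \<in> words_over (carrier A)" and
      sz: "pair_size r = pair_size x + pair_size x'" "pair_size r = pair_size x' + pair_size x"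
      using w[OF s] by (auto simp: s')
    have key: "tpow A (pair_size y + pair_size a) (pprod b) \<otimes> ?c = tpow A (pair_size a) (q_term z b y)"
      if "b \<in> words_over (carrier A)" "pair_size r = pair_size a + pair_size b" for a b
    proof (cases "b = ([], [])")
      case True
      then have "Suc (pair_size r - 1) = pair_size a" using that(2) r0 by simp
      then have "tpow A (pair_size a) (q z y) = twist A ?c" by (metis twist_tpow)
      then show ?thesis using True c by (simp add: q_term_def)
    next
      case False
      then have "pair_size b > 0" by (cases b) auto
      then have eq: "pair_size r - 1 = pair_size a + (pair_size b - 1)" using that(2) by simp
      show ?thesis unfolding eq using False that(1) qy
        by (simp add: q_term_def tpow_mult tpow_tpow add.commute)
    qed
    have "?f s \<otimes>\<^bsub>AA\<^esub> (\<one> \<bowtie> ?c \<oplus>\<^bsub>AA\<^esub> ?c \<bowtie> \<one>) =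
        tpow A (pair_size y + pair_size x' + 1) (pprod x) \<bowtie> (tpow A (pair_size y + pair_size x) (pprod x') \<otimes> ?c) \<oplus>\<^bsub>AA\<^esub>
        (tpow A (pair_size y + pair_size x') (pprod x) \<otimes> ?c) \<bowtie> tpow A (pair_size y + pair_size x + 1) (pprod x')"
      using x c by (simp add: s' T.mult_add_right TP.tensor_mult)
    also have "\<dots> = term_left z x x' y \<oplus>\<^bsub>AA\<^esub> term_right z x' x y"
      unfolding key[OF x(1) sz(2)] key[OF x(2) sz(1)] term_left_def term_right_def
      by (simp add: add.commute)
    finally show "?f s \<otimes>\<^bsub>AA\<^esub> (\<one> \<bowtie> ?c \<oplus>\<^bsub>AA\<^esub> ?c \<bowtie> \<one>) =
        (case s of (x, x') \<Rightarrow> term_left z x x' y \<oplus>\<^bsub>AA\<^esub> term_right z x' x y)"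
      by (simp add: s')
  qed
  also have "\<dots> = lsum AA (\<lambda>(x, x'). term_left z x x' y \<oplus>\<^bsub>AA\<^esub> term_right z x x' y) (pair_coprod r)"
    using y z by (intro lsum_pair_coprod_sym[OF rc]) simp_all
  finally show ?thesis .
qed

text \<open>
  Both ways of computing the coproduct of \<open>prod_assoc\<close> agree in all summands that involve \<open>q\<close> on
  properly smaller pairs of words; what remains after cancelling them is the claim.
\<close>

lemma primitive_q:
  assumes "p \<in> words_over primitives" and z: "z \<in> primitives"
  shows "q z p \<in> primitives"
  using assms(1)
proof (induction "pair_size p" arbitrary: p rule: less_induct)
  case less
  note p = less.prems
  have pc: "p \<in> words_over (carrier A)" using p by (cases p) auto
  have zc: "z \<in> carrier A" using z by simp
  let ?g = "\<lambda>x y s. term_left z x y s \<oplus>\<^bsub>AA\<^esub> term_right z x y s"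
  obtain ps where ps: "pair_coprod p = ps @ [(([], []), p)]" "\<forall>(x, y)\<in>set ps. x \<noteq> ([], [])"
    using pair_coprod_last by blast
  have w: "fst s \<in> words_over primitives" "snd s \<in> words_over primitives"
    "fst s \<in> words_over (carrier A)" "snd s \<in> words_over (carrier A)"
    if "s \<in> set (pair_coprod p)" for s
    using pair_coprod_over[of "fst s" "snd s" p] that p pc by auto
  have tc: "q_term z (fst s) (snd s) \<in> carrier A" if "s \<in> set (pair_coprod p)" for s
    using w[OF that] zc by simp
  let ?S = "lsum AA (\<lambda>s. \<Delta> (q_term z (fst s) (snd s))) ps"
  have S: "?S \<in> carrier AA" using tc by (intro T.lsum_closed D.closed) (simp add: ps(1))
  have qc: "q z p \<in> carrier A" by (rule q_closed[OF pc zc])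
  have gc: "?g x y s \<in> carrier AA" if "x \<in> words_over (carrier A)" "y \<in> words_over (carrier A)"
    "s \<in> words_over (carrier A)" for x y s
    using that zc by simp
  have "\<Delta> (prod_assoc z p) = lsum AA (\<lambda>s. \<Delta> (q_term z (fst s) (snd s))) (pair_coprod p)"
    unfolding prod_assoc_eq_sum[OF pc zc] case_prod_unfold by (rule D.lsum_image) (rule tc)
  also have "\<dots> = ?S \<oplus>\<^bsub>AA\<^esub> \<Delta> (q z p)"
    using tc qc unfolding ps(1) by (subst T.lsum_append) (auto simp: q_term_def D.closed)
  finally have 1: "\<Delta> (prod_assoc z p) = ?S \<oplus>\<^bsub>AA\<^esub> \<Delta> (q z p)" .
  have "\<Delta> (prod_assoc z p) = lsum AA (\<lambda>(x, r). lsum AA (\<lambda>(y, s). ?g x y s) (pair_coprod r)) (pair_coprod p)"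
    unfolding \<Delta>_prod_assoc[OF p z]
    by (rule lsum_cong) (use w zc in \<open>simp add: case_prod_unfold assoc_eq_sum_terms\<close>)
  also have "\<dots> = lsum AA (\<lambda>(a, s). lsum AA (\<lambda>(x, y). ?g x y s) (pair_coprod a)) (pair_coprod p)"
    by (rule T.lsum_pair_coprod_coassoc[OF pc gc, symmetric])
  also have "\<dots> = lsum AA (\<lambda>(a, s). lsum AA (\<lambda>(x, y). ?g x y s) (pair_coprod a)) ps \<oplus>\<^bsub>AA\<^esub>
      (\<one> \<bowtie> q z p \<oplus>\<^bsub>AA\<^esub> q z p \<bowtie> \<one>)"
  proof -
    have "(case s of (a, s) \<Rightarrow> lsum AA (\<lambda>(x, y). ?g x y s) (pair_coprod a)) \<in> carrier AA"
      if "s \<in> set (pair_coprod p)" for s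
      unfolding case_prod_unfold using w[OF that]
      by (intro T.lsum_closed gc) (auto dest: pair_coprod_over)
    then have "lsum AA (\<lambda>(a, s). lsum AA (\<lambda>(x, y). ?g x y s) (pair_coprod a)) (pair_coprod p) =
        lsum AA (\<lambda>(a, s). lsum AA (\<lambda>(x, y). ?g x y s) (pair_coprod a)) ps \<oplus>\<^bsub>AA\<^esub>
        lsum AA (\<lambda>(a, s). lsum AA (\<lambda>(x, y). ?g x y s) (pair_coprod a)) [(([], []), p)]"
      unfolding ps(1) by (intro T.lsum_append) auto
    then show ?thesis using qc
      by (simp add: q_term_def term_left_def term_right_def)
  qed
  also have "lsum AA (\<lambda>(a, s). lsum AA (\<lambda>(x, y). ?g x y s) (pair_coprod a)) ps = ?S"
  proof (rule lsum_cong)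
    fix s assume s: "s \<in> set ps"
    then have s': "s \<in> set (pair_coprod p)" by (simp add: ps(1))
    have "fst s \<noteq> ([], [])" using ps(2) s by auto
    then have "pair_size (fst s) > 0" by (cases "fst s") auto
    then have "pair_size (snd s) < pair_size p" using pair_coprod_size[of "fst s" "snd s" p] s' by simp
    then have "q z (snd s) \<in> primitives" using w[OF s'] by (intro less.hyps) auto
    then show "(case s of (a, s) \<Rightarrow> lsum AA (\<lambda>(x, y). ?g x y s) (pair_coprod a)) = \<Delta> (q_term z (fst s) (snd s))"
      using w[OF s'] zc by (simp add: case_prod_unfold \<Delta>_q_term)
  qed
  finally have "?S \<oplus>\<^bsub>AA\<^esub> \<Delta> (q z p) = ?S \<oplus>\<^bsub>AA\<^esub> (\<one> \<bowtie> q z p \<oplus>\<^bsub>AA\<^esub> q z p \<bowtie> \<one>)"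
    using 1 by simp
  then have "\<Delta> (q z p) = \<one> \<bowtie> q z p \<oplus>\<^bsub>AA\<^esub> q z p \<bowtie> \<one>"
    using S qc by (subst (asm) T.M.add.l_cancel) (auto simp: D.closed)
  then show ?case using qc by (simp add: primitives_def del: primitives_carrier)
qed

end

section \<open>The ground field as a Hom-algebra\<close>

lemma ground_alg_simps [simp]:
  "carrier ground_alg = UNIV" "x \<otimes>\<^bsub>ground_alg\<^esub> y = x * y" "\<one>\<^bsub>ground_alg\<^esub> = 1" "\<zero>\<^bsub>ground_alg\<^esub> = 0"
  "x \<oplus>\<^bsub>ground_alg\<^esub> y = x + y" "c \<odot>\<^bsub>ground_alg\<^esub> x = c * x" "twist ground_alg x = x"
  by (simp_all add: ground_alg_def)

lemma tpow_ground_alg [simp]: "tpow ground_alg n x = x"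
  by (induction n) simp_all

lemma unitary_ground_alg: "unitary_hom_algebra (ground_alg :: ('k::field, 'k) hom_alg)"
proof -
  have "abelian_group (ground_alg :: ('k, 'k) hom_alg)"
    by (rule abelian_groupI) (auto intro!: exI[of _ "- _"])
  then have "vec_space (ground_alg :: ('k, 'k) hom_alg)"
    by (intro moduleI cring_from_type_algebra) (auto simp: algebra_simps)
  then show ?thesis
    by (auto simp: unitary_hom_algebra_def hom_algebra_def linear_map_def algebra_simps)
qed

lemma unital_homalg_ground: "unital_homalg (ground_alg :: ('k::field, 'k) hom_alg)"
  by (rule unital_homalg.intro[OF unitary_ground_alg])

lemma vec_space_ground: "vec_space (ground_alg :: ('k::field, 'k) hom_alg)"
  using unitary_ground_alg[where 'k = 'k] by (simp add: unitary_hom_algebra_def hom_algebra_def)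

lemma ground_alg_minus: "a \<ominus>\<^bsub>ground_alg\<^esub> b = a - (b :: 'k::field)"
proof -
  interpret ground: unital_homalg "ground_alg :: ('k, 'k) hom_alg" by (rule unital_homalg_ground)
  have "a \<ominus>\<^bsub>ground_alg\<^esub> b = a \<oplus>\<^bsub>ground_alg\<^esub> (- 1) \<odot>\<^bsub>ground_alg\<^esub> b"
    by (rule ground.diff_as_smult) simp_all
  also have "\<dots> = a - b" unfolding ground_alg_simps by (simp only: mult_minus1 add_uminus_conv_diff)
  finally show ?thesis .
qed

lemma hom_assoc_ground: "hom_assoc ground_alg a b c = (0 :: 'k::field)"
  by (simp add: hom_assoc_def ground_alg_minus mult.assoc)

section \<open>The relations of the enveloping algebra\<close>

lemma multilinear_closed:
  assumes "multilinear V n f" "n > 0" "length xs = n" "set xs \<subseteq> carrier V"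
  shows "f xs \<in> carrier V"
proof -
  have "linear_map V V (\<lambda>t. f (xs[0 := t]))"
    using assms unfolding multilinear_def by blast
  moreover have "xs ! 0 \<in> carrier V" using assms by (auto simp: subset_iff)
  ultimately have "f (xs[0 := xs ! 0]) \<in> carrier V" by (rule linear_mapD(1))
  then show ?thesis by (simp only: list_update_id)
qed

context coproduct begin

text \<open>
  The mixed terms of \<open>\<Delta>(xy)\<close> are symmetric in \<open>x\<close> and \<open>y\<close>, and so cancel in the commutator.
\<close>

lemma commutator_primitive:
  assumes x: "x \<in> primitives" and y: "y \<in> primitives"
  shows "x \<otimes> y \<ominus> y \<otimes> x \<in> primitives"
proof -
  let ?M = "(twist A x \<bowtie> twist A y) \<oplus>\<^bsub>AA\<^esub> (twist A y \<bowtie> twist A x)"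
  have \<Delta>_prod: "\<Delta> (a \<otimes> b) = (\<one> \<bowtie> (a \<otimes> b) \<oplus>\<^bsub>AA\<^esub> (a \<otimes> b) \<bowtie> \<one>) \<oplus>\<^bsub>AA\<^esub>
      ((twist A a \<bowtie> twist A b) \<oplus>\<^bsub>AA\<^esub> (twist A b \<bowtie> twist A a))"
    if "a \<in> primitives" "b \<in> primitives" for a b
    using that by (simp add: \<Delta>_mult \<Delta>_primitive T.mult_add_left T.mult_add_right TP.tensor_mult T.M.a_ac)
  have "\<Delta> (x \<otimes> y \<ominus> y \<otimes> x) =
      ((\<one> \<bowtie> (x \<otimes> y) \<oplus>\<^bsub>AA\<^esub> (x \<otimes> y) \<bowtie> \<one>) \<oplus>\<^bsub>AA\<^esub> ?M) \<ominus>\<^bsub>AA\<^esub> ((\<one> \<bowtie> (y \<otimes> x) \<oplus>\<^bsub>AA\<^esub> (y \<otimes> x) \<bowtie> \<one>) \<oplus>\<^bsub>AA\<^esub> ?M)"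
    using x y \<Delta>_prod[OF y x] by (simp add: D.minus \<Delta>_prod T.M.a_comm)
  also have "\<dots> = (\<one> \<bowtie> (x \<otimes> y) \<ominus>\<^bsub>AA\<^esub> \<one> \<bowtie> (y \<otimes> x)) \<oplus>\<^bsub>AA\<^esub> ((x \<otimes> y) \<bowtie> \<one> \<ominus>\<^bsub>AA\<^esub> (y \<otimes> x) \<bowtie> \<one>)"
    using x y by (simp add: T.add_diff_add T.diff_self)
  also have "\<dots> = \<one> \<bowtie> (x \<otimes> y \<ominus> y \<otimes> x) \<oplus>\<^bsub>AA\<^esub> (x \<otimes> y \<ominus> y \<otimes> x) \<bowtie> \<one>"
    using x y by (simp add: linear.minus[OF linear_tens_left] linear.minus[OF linear_tens_right])
  finally show ?thesis using x y by (simp add: primitives_def del: primitives_carrier) 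
qed

text \<open>
  The ground field is associative, so \<open>\<epsilon>\<close> kills every associator, and the recursion for \<open>q\<close> gives the
  claim by induction.
\<close>

lemma counit_q:
  assumes \<epsilon>: "hom_alg_morphism A ground_alg \<epsilon>"
    and "p \<in> words_over (carrier A)" and z: "z \<in> carrier A"
  shows "\<epsilon> (q z p) = 0"
  using assms(2)
proof (induction "pair_size p" arbitrary: p rule: less_induct)
  case less
  note p = less.prems
  interpret ground: unital_homalg "ground_alg :: ('k, 'k) hom_alg" by (rule unital_homalg_ground)
  interpret \<epsilon>: linear A ground_alg \<epsilon>
    by (rule linearI[OF vec_space vec_space_ground hom_alg_morphismD(1)[OF \<epsilon>]])
  show ?case
  proof (cases "fst p = [] \<or> snd p = []")
    case True
    then show ?thesis using \<epsilon>.zero by (simp add: q_empty)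
  next
    case False
    let ?ps = "filter (\<lambda>(x, y). pair_size x > 0) (pair_coprod p)"
    have w: "fst r \<in> words_over (carrier A)" "snd r \<in> words_over (carrier A)"
        "pair_size (snd r) < pair_size p" "fst r \<noteq> ([], [])"
      if "r \<in> set ?ps" for r
    proof -
      have r: "(fst r, snd r) \<in> set (pair_coprod p)" and r0: "pair_size (fst r) > 0"
        using that by (simp_all add: case_prod_unfold)
      show "fst r \<in> words_over (carrier A)" "snd r \<in> words_over (carrier A)"
        by (rule pair_coprod_over[OF r p])+
      show "pair_size (snd r) < pair_size p" using pair_coprod_size[OF r] r0 by linarith
      show "fst r \<noteq> ([], [])" using r0 by (cases "fst r") auto
    qed
    have "\<epsilon> (q_term z (fst r) (snd r)) = 0" if "r \<in> set ?ps" for r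
      using w[OF that] less.hyps[of "snd r"] z
      by (simp add: q_term_def hom_alg_morphismD(3)[OF \<epsilon>] hom_alg_morphism_tpow[OF \<epsilon> _ hom_algebra] q_closed)
    then have "\<epsilon> (lsum A (\<lambda>r. q_term z (fst r) (snd r)) ?ps) = 0"
      using w z ground.lsum_zero[of ?ps] by (subst \<epsilon>.lsum_image) auto
    moreover have "\<epsilon> (prod_assoc z p) = 0"
      using False p z
      by (cases p) (simp add: prod_assoc_def morphism_hom_assoc[OF ground.hom_algebra \<epsilon>] hom_assoc_ground)
    moreover have "lsum A (\<lambda>r. q_term z (fst r) (snd r)) ?ps \<in> carrier A"
      using w z by (intro lsum_closed) auto
    ultimately show ?thesis using False p z \<epsilon>.minus[of "prod_assoc z p"]
      by (simp add: q_eq case_prod_unfold ground_alg_minus)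
  qed
qed

end

context generators begin

lemma free_unique:
  assumes W: "hom_algebra W" and f: "hom_alg_morphism (free_hom_alg S) W f" and g: "hom_alg_morphism (free_hom_alg S) W g"
    and "f \<one>\<^bsub>free_hom_alg S\<^esub> = g \<one>\<^bsub>free_hom_alg S\<^esub>" "\<And>s. s \<in> carrier S \<Longrightarrow> f (free_gen S s) = g (free_gen S s)"
    and x: "x \<in> carrier (free_hom_alg S)"
  shows "f x = g x"
  using x by (induction rule: free_induct)
    (simp_all add: assms(4,5) hom_alg_morphismD[OF f] hom_alg_morphismD[OF g]
      linear_mapD[OF hom_alg_morphismD(1)[OF f]] linear_mapD[OF hom_alg_morphismD(1)[OF g]])

lemma ex_free_coproduct: "\<exists>\<Delta>. free_coproduct S \<Delta>"
proof -
  interpret TP: tensor_product F F by (rule tensor_product.intro[OF F.hom_algebra F.hom_algebra])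
  interpret T': unital_homalg "tensor_alg F F"
    by (rule unital_homalg.intro[OF unitary_tensor_alg[OF F.unitary F.unitary]])
  let ?g = "\<lambda>s. tensor F F \<one>\<^bsub>F\<^esub> (free_gen S s) \<oplus>\<^bsub>tensor_alg F F\<^esub> tensor F F (free_gen S s) \<one>\<^bsub>F\<^esub>"
  note gen = linear_mapD[OF linear_free_gen]
  have lin: "linear_map S (tensor_alg F F) ?g"
    by (auto simp: linear_map_def gen TP.tensor_add_left TP.tensor_add_right TP.tensor_smult_left
        TP.tensor_smult_right T'.smult_add_right T'.M.a_ac)
  have tw: "?g (twist S s) = twist (tensor_alg F F) (?g s)" if "s \<in> carrier S" for s
    using that by (simp add: T'.tw.add TP.tensor_twist twist_free_gen)
  obtain \<Delta> where "hom_alg_morphism F (tensor_alg F F) \<Delta>" "\<Delta> \<one>\<^bsub>F\<^esub> = \<one>\<^bsub>tensor_alg F F\<^esub>"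
      "\<And>s. s \<in> carrier S \<Longrightarrow> \<Delta> (free_gen S s) = ?g s"
    by (rule free_lift[OF T'.unitary lin tw]) blast+
  then have "free_coproduct S \<Delta>" by (simp add: free_coproduct_def Let_def TP.tensor_one)
  then show ?thesis by blast
qed

lemma ex_free_counit: "\<exists>\<epsilon>. free_counit S \<epsilon>"
proof -
  have lin: "linear_map S ground_alg (\<lambda>_. 0 :: 'k)" by (simp add: linear_map_def)
  obtain \<epsilon> where "hom_alg_morphism F ground_alg \<epsilon>" "\<epsilon> \<one>\<^bsub>F\<^esub> = \<one>\<^bsub>ground_alg\<^esub>"
      "\<And>s. s \<in> carrier S \<Longrightarrow> \<epsilon> (free_gen S s) = (0 :: 'k)"
    by (rule free_lift[OF unitary_ground_alg lin]) auto
  then have "free_counit S \<epsilon>" by (simp add: free_counit_def Let_def)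
  then show ?thesis by blast
qed

end

locale sabinin =
  fixes S :: "('k::field_char_0, 's, 'm) hom_sabinin_scheme" (structure)
  assumes sabinin: "hom_sabinin_algebra S"

sublocale sabinin \<subseteq> generators S
  using sabinin by (simp add: generators_def generators_axioms_def vect_iff hom_sabinin_algebra_def)

context sabinin begin

lemma bracket_closed:
  assumes "set w \<subseteq> carrier S" "a \<in> carrier S" "b \<in> carrier S" shows "bracket S w a b \<in> carrier S"
proof -
  have "multilinear S (length w + 2) (\<lambda>xs. bracket S (take (length w) xs) (xs ! length w) (xs ! (length w + 1)))"
    using sabinin by (simp only: hom_sabinin_algebra_def)
  from multilinear_closed[OF this, of "w @ [a, b]"] assms show ?thesis
    by (simp add: nth_append)
qed

lemma Phi_closed:
  assumes "set w \<subseteq> carrier S" "set v \<subseteq> carrier S" "length w > 0" "length v > 1"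
  shows "Phi S w v \<in> carrier S"
proof -
  have "multilinear S (length w + length v) (\<lambda>xs. Phi S (take (length w) xs) (drop (length w) xs))"
    using sabinin assms(3,4) by (simp only: hom_sabinin_algebra_def)
  from multilinear_closed[OF this, of "w @ v"] assms show ?thesis by simp
qed

lemma free_coproductD:
  assumes "free_coproduct S \<Delta>"
  shows "coproduct F \<Delta>" and "s \<in> carrier S \<Longrightarrow> free_gen S s \<in> coproduct.primitives F \<Delta>"
proof -
  show "coproduct F \<Delta>"
    using assms F.unitary
    by (simp add: coproduct_def coproduct_axioms_def unital_homalg_def free_coproduct_def Let_def)
  then interpret C: coproduct F \<Delta> .
  show "s \<in> carrier S \<Longrightarrow> free_gen S s \<in> C.primitives"
    using assms by (simp add: C.primitives_def free_coproduct_def Let_def del: C.primitives_carrier)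
qed

text \<open>
  The relations are linear combinations of generators, commutators of generators, and values of \<open>q\<close> on
  generators. This is used for the space of primitive elements and for the kernel of the counit.
\<close>

lemma enveloping_relations_subset:
  assumes N: "submodule N ring_of_type_algebra F"
    and gen: "\<And>s. s \<in> carrier S \<Longrightarrow> free_gen S s \<in> N"
    and comm: "\<And>a b. a \<in> carrier S \<Longrightarrow> b \<in> carrier S \<Longrightarrow>
      free_gen S a \<otimes>\<^bsub>F\<^esub> free_gen S b \<ominus>\<^bsub>F\<^esub> free_gen S b \<otimes>\<^bsub>F\<^esub> free_gen S a \<in> N"
    and q: "\<And>u v z. set u \<subseteq> free_gen S ` carrier S \<Longrightarrow> set v \<subseteq> free_gen S ` carrier S \<Longrightarrow>
      z \<in> free_gen S ` carrier S \<Longrightarrow> q_op F u v z \<in> N"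
  shows "enveloping_relations S \<subseteq> N"
proof
  note add = N[unfolded F.submodule_iff, THEN conjunct2, THEN conjunct2, THEN conjunct1, rule_format]
  note smult = N[unfolded F.submodule_iff, THEN conjunct2, THEN conjunct2, THEN conjunct2, rule_format]
  note diff = F.submodule_diff[OF N]
  fix x assume "x \<in> enveloping_relations S"
  then show "x \<in> N" unfolding enveloping_relations_def Let_def
  proof (elim UnE CollectE exE conjE, goal_cases)
    case (1 w a b)
    then have w: "set (map (free_gen S) w) \<subseteq> free_gen S ` carrier S" by auto
    have ab: "set [free_gen S a] \<subseteq> free_gen S ` carrier S" "set [free_gen S b] \<subseteq> free_gen S ` carrier S"
      using 1 by auto
    show ?case unfolding 1(1)
      using 1 ab by (intro diff add gen q w bracket_closed) auto
  next
    case (2 a b)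
    then show ?case unfolding 2(1) by (intro add comm gen bracket_closed) auto
  next
    case (3 w v)
    have "q_op F (permute_list \<sigma> (map (free_gen S) w)) (butlast (permute_list \<tau> (map (free_gen S) v)))
        (last (permute_list \<tau> (map (free_gen S) v))) \<in> N"
      if "\<sigma> permutes {..<length w}" "\<tau> permutes {..<length v}" for \<sigma> \<tau>
    proof -
      have "set (permute_list \<sigma> (map (free_gen S) w)) \<subseteq> free_gen S ` carrier S"
        using that(1) 3(4) by (subst set_permute_list) auto
      moreover have v: "set (permute_list \<tau> (map (free_gen S) v)) \<subseteq> free_gen S ` carrier S"
        using that(2) 3(5) by (subst set_permute_list) auto
      moreover have "permute_list \<tau> (map (free_gen S) v) \<noteq> []"
        using 3(3) by (metis length_map length_permute_list less_nat_zero_code list.size(3))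
      ultimately show ?thesis
        by (intro q) (auto dest: in_set_butlastD dest!: last_in_set)
    qed
    then show ?case unfolding 3(1)
      using 3 by (intro diff F.submodule_finsum[OF N] smult gen Phi_closed) auto
  qed
qed

lemma enveloping_relations_primitive:
  assumes \<Delta>: "free_coproduct S \<Delta>"
  shows "enveloping_relations S \<subseteq> coproduct.primitives F \<Delta>"
proof -
  interpret C: coproduct F \<Delta> by (rule free_coproductD(1)[OF \<Delta>])
  note gen = free_coproductD(2)[OF \<Delta>]
  have gens: "free_gen S ` carrier S \<subseteq> C.primitives" using gen by blast
  show ?thesis
  proof (rule enveloping_relations_subset[OF C.submodule_primitives gen])
    fix u v z assume "set u \<subseteq> free_gen S ` carrier S" "set v \<subseteq> free_gen S ` carrier S" "z \<in> free_gen S ` carrier S"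
    then have "(u, v) \<in> words_over C.primitives" "z \<in> C.primitives" using gens by auto
    from C.primitive_q[OF this] show "q_op F u v z \<in> C.primitives" unfolding fst_conv snd_conv .
  qed (assumption | rule C.commutator_primitive gen)+
qed

lemma counit_enveloping_relations:
  assumes \<epsilon>: "free_counit S \<epsilon>"
  shows "enveloping_relations S \<subseteq> {x \<in> carrier F. \<epsilon> x = 0}"
proof -
  obtain \<Delta> where \<Delta>: "free_coproduct S \<Delta>" using ex_free_coproduct by blast
  interpret C: coproduct F \<Delta> by (rule free_coproductD(1)[OF \<Delta>])
  have e: "hom_alg_morphism F ground_alg \<epsilon>" and g: "\<And>s. s \<in> carrier S \<Longrightarrow> \<epsilon> (free_gen S s) = 0"
    using \<epsilon> by (auto simp: free_counit_def Let_def)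
  interpret e: linear F ground_alg \<epsilon>
    by (rule linearI[OF F.vec_space vec_space_ground hom_alg_morphismD(1)[OF e]])
  have N: "submodule {x \<in> carrier F. \<epsilon> x = 0} ring_of_type_algebra F"
    using e.submodule_kernel unfolding ground_alg_simps .
  show ?thesis
  proof (rule enveloping_relations_subset[OF N])
    fix u v z assume uvz: "set u \<subseteq> free_gen S ` carrier S" "set v \<subseteq> free_gen S ` carrier S" "z \<in> free_gen S ` carrier S"
    then have "(u, v) \<in> words_over (carrier F)" "z \<in> carrier F" by auto
    from C.counit_q[OF e this] C.q_closed[OF this] show "q_op F u v z \<in> {x \<in> carrier F. \<epsilon> x = 0}"
      by simp
  next
    fix a b assume "a \<in> carrier S" "b \<in> carrier S"
    then show "free_gen S a \<otimes>\<^bsub>F\<^esub> free_gen S b \<ominus>\<^bsub>F\<^esub> free_gen S b \<otimes>\<^bsub>F\<^esub> free_gen S a \<in> {x \<in> carrier F. \<epsilon> x = 0}"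
      by (simp add: e.minus hom_alg_morphismD(3)[OF e] ground_alg_minus mult.commute)
  qed (simp add: g)
qed

section \<open>The enveloping algebra as a Hom-bialgebra\<close>

lemma ideal_enveloping: "hom_alg_ideal F (enveloping_ideal S)"
proof -
  obtain \<Delta> where \<Delta>: "free_coproduct S \<Delta>" using ex_free_coproduct by blast
  interpret C: coproduct F \<Delta> by (rule free_coproductD(1)[OF \<Delta>])
  have "enveloping_relations S \<subseteq> carrier F"
    using enveloping_relations_primitive[OF \<Delta>] C.primitives_carrier by blast
  then show ?thesis unfolding enveloping_ideal_def by (rule F.hom_alg_ideal_hull)
qed

sublocale U: quotient F "enveloping_ideal S"
  by unfold_locales (rule ideal_enveloping, rule F.ideal_twist_closed[OF ideal_enveloping])

abbreviation (input) U where "U \<equiv> U_hom S"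

lemma unitary_U_hom: "unitary_hom_algebra (U_hom S)"
  unfolding U_hom_def by (rule U.unitary_quot[OF F.unitary])

sublocale UH: unital_homalg "U_hom S"
  by (rule unital_homalg.intro[OF unitary_U_hom])

lemma U_proj_morphism: "hom_alg_morphism F U (U_proj S)"
  unfolding U_hom_def U_proj_def[abs_def] by (rule U.hom_alg_morphism_proj)

lemma U_proj_one: "U_proj S \<one>\<^bsub>F\<^esub> = \<one>\<^bsub>U\<^esub>"
  by (simp add: U_hom_def U_proj_def U.quot_one)

lemma U_carrier: "carrier U = U_proj S ` carrier F"
  by (simp add: U_hom_def U_proj_def[abs_def] U.quot_carrier)

lemma U_proj_relation: "x \<in> enveloping_relations S \<Longrightarrow> U_proj S x = \<zero>\<^bsub>U\<^esub>"
  using hull_inc[of x "enveloping_relations S" "hom_alg_ideal F"] U.coset_zero_iff[of x]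
  by (simp add: U_hom_def U_proj_def U.quot_zero enveloping_ideal_def[symmetric])

lemma U_lift:
  assumes W: "hom_algebra W" and f: "hom_alg_morphism F W f"
    and 0: "\<And>x. x \<in> enveloping_relations S \<Longrightarrow> f x = \<zero>\<^bsub>W\<^esub>"
  obtains g where "hom_alg_morphism U W g" "\<And>x. x \<in> carrier F \<Longrightarrow> g (U_proj S x) = f x"
proof -
  have "enveloping_relations S \<subseteq> carrier F"
    using U.ideal_carrier hull_subset[of "enveloping_relations S" "hom_alg_ideal F"]
    by (auto simp: enveloping_ideal_def)
  then have "enveloping_ideal S \<subseteq> {x \<in> carrier F. f x = \<zero>\<^bsub>W\<^esub>}"
    unfolding enveloping_ideal_def using 0
    by (intro hull_minimal ideal_kernel[OF F.hom_algebra W f]) auto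
  then have "\<And>x. x \<in> enveloping_ideal S \<Longrightarrow> f x = \<zero>\<^bsub>W\<^esub>" by auto
  from U.quot_lift[OF W f this] that show thesis
    unfolding U_hom_def U_proj_def by blast
qed

text \<open>
  Coproduct and counit descend to the quotient, where multiplicativity is inherited. The counit laws are
  equalities of morphisms out of the free algebra, hence only have to be checked on generators.
\<close>

lemma hom_bialgebra_U_hom:
  "\<exists>\<Delta> \<epsilon> \<Delta>' \<epsilon>'. free_coproduct S \<Delta> \<and> free_counit S \<epsilon> \<and>
    (\<forall>x\<in>carrier (free_hom_alg S).
       \<Delta>' (U_proj S x) = tensor_map (U_hom S) (U_hom S) (U_proj S) (U_proj S) (\<Delta> x) \<and>
       \<epsilon>' (U_proj S x) = \<epsilon> x) \<and>
    hom_bialgebra (U_hom S) \<Delta>' \<epsilon>'"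
proof -
  let ?K = "ground_alg :: ('k, 'k) hom_alg"
  let ?\<pi> = "U_proj S"
  obtain \<Delta> where \<Delta>: "free_coproduct S \<Delta>" using ex_free_coproduct by blast
  obtain \<epsilon> where \<epsilon>: "free_counit S \<epsilon>" using ex_free_counit by blast
  interpret C: coproduct F \<Delta> by (rule free_coproductD(1)[OF \<Delta>])
  interpret K: unital_homalg ?K by (rule unital_homalg_ground)
  interpret UU: unital_homalg "tensor_alg U U"
    by (rule unital_homalg.intro[OF unitary_tensor_alg[OF unitary_U_hom unitary_U_hom]])
  interpret UT: tensor_product U U by (rule tensor_product.intro[OF UH.hom_algebra UH.hom_algebra])
  interpret KU: tensor_product ?K U by (rule tensor_product.intro[OF K.hom_algebra UH.hom_algebra])
  interpret UK: tensor_product U ?K by (rule tensor_product.intro[OF UH.hom_algebra K.hom_algebra])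
  interpret KUa: unital_homalg "tensor_alg ?K U"
    by (rule unital_homalg.intro[OF unitary_tensor_alg[OF unitary_ground_alg unitary_U_hom]])
  interpret UKa: unital_homalg "tensor_alg U ?K"
    by (rule unital_homalg.intro[OF unitary_tensor_alg[OF unitary_U_hom unitary_ground_alg]])
  have e: "hom_alg_morphism F ?K \<epsilon>" and e1: "\<epsilon> \<one>\<^bsub>F\<^esub> = 1" and eg: "\<And>s. s \<in> carrier S \<Longrightarrow> \<epsilon> (free_gen S s) = 0"
    using \<epsilon> by (auto simp: free_counit_def Let_def)
  note \<pi> = hom_alg_morphismD[OF U_proj_morphism]
  let ?\<pi>\<pi> = "tensor_map U U ?\<pi> ?\<pi>"
  note tm = tensor_map_morphism[OF F.hom_algebra F.hom_algebra UH.hom_algebra UH.hom_algebra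
      U_proj_morphism U_proj_morphism]
  have prim: "?\<pi>\<pi> (\<Delta> x) = tensor U U \<one>\<^bsub>U\<^esub> (?\<pi> x) \<oplus>\<^bsub>tensor_alg U U\<^esub> tensor U U (?\<pi> x) \<one>\<^bsub>U\<^esub>"
    if "x \<in> C.primitives" for x
    using that by (simp add: C.\<Delta>_primitive linear_mapD(2)[OF hom_alg_morphismD(1)[OF tm(1)]] tm(2) U_proj_one)
  have "?\<pi>\<pi> (\<Delta> x) = \<zero>\<^bsub>tensor_alg U U\<^esub>" if "x \<in> enveloping_relations S" for x
  proof -
    have "x \<in> C.primitives" using enveloping_relations_primitive[OF \<Delta>] that by auto
    then show ?thesis
      using linear.zero[OF linearI[OF UH.vec_space UU.vec_space UT.linear_tensor_left[of "\<one>\<^bsub>U\<^esub>"]]]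
        linear.zero[OF linearI[OF UH.vec_space UU.vec_space UT.linear_tensor_right[of "\<one>\<^bsub>U\<^esub>"]]]
      by (simp add: prim U_proj_relation[OF that])
  qed
  from U_lift[OF UU.hom_algebra hom_alg_morphism_comp[OF C.\<Delta> tm(1)] this]
  obtain \<Delta>' where \<Delta>': "hom_alg_morphism U (tensor_alg U U) \<Delta>'"
    "\<And>x. x \<in> carrier F \<Longrightarrow> \<Delta>' (?\<pi> x) = ?\<pi>\<pi> (\<Delta> x)" by blast
  have "\<epsilon> x = \<zero>\<^bsub>?K\<^esub>" if "x \<in> enveloping_relations S" for x
    using counit_enveloping_relations[OF \<epsilon>] that by auto
  from U_lift[OF K.hom_algebra e this]
  obtain \<epsilon>' where \<epsilon>': "hom_alg_morphism U ?K \<epsilon>'"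
    "\<And>x. x \<in> carrier F \<Longrightarrow> \<epsilon>' (?\<pi> x) = \<epsilon> x" by blast
  have id: "hom_alg_morphism U U id" by (simp add: hom_alg_morphism_def linear_map_def)
  have \<Delta>'_gen: "\<Delta>' (?\<pi> (free_gen S s)) =
      tensor U U \<one>\<^bsub>U\<^esub> (?\<pi> (free_gen S s)) \<oplus>\<^bsub>tensor_alg U U\<^esub> tensor U U (?\<pi> (free_gen S s)) \<one>\<^bsub>U\<^esub>"
    if "s \<in> carrier S" for s
    using that by (simp add: \<Delta>'(2) prim free_coproductD(2)[OF \<Delta>])
  have \<Delta>'_one: "\<Delta>' (?\<pi> \<one>\<^bsub>F\<^esub>) = tensor U U \<one>\<^bsub>U\<^esub> \<one>\<^bsub>U\<^esub>"
    using \<Delta>'(2)[of "\<one>\<^bsub>F\<^esub>"] by (simp add: C.\<Delta>_unit tm(2) U_proj_one)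
  have \<epsilon>'_one: "\<epsilon>' \<one>\<^bsub>U\<^esub> = 1" using \<epsilon>'(2)[of "\<one>\<^bsub>F\<^esub>"] e1 by (simp add: U_proj_one)
  have \<epsilon>'_gen: "\<epsilon>' (?\<pi> (free_gen S s)) = 0" if "s \<in> carrier S" for s
    using that by (simp add: \<epsilon>'(2) eg)
  note l = tensor_map_morphism[OF UH.hom_algebra UH.hom_algebra K.hom_algebra UH.hom_algebra \<epsilon>'(1) id]
  note r = tensor_map_morphism[OF UH.hom_algebra UH.hom_algebra UH.hom_algebra K.hom_algebra id \<epsilon>'(1)]
  have zl: "tensor ?K U 0 y = \<zero>\<^bsub>tensor_alg ?K U\<^esub>" if "y \<in> carrier U" for y
    using linear.zero[OF linearI[OF K.vec_space KUa.vec_space KU.linear_tensor_left[OF that]]] by simp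
  have zr: "tensor U ?K y 0 = \<zero>\<^bsub>tensor_alg U ?K\<^esub>" if "y \<in> carrier U" for y
    using linear.zero[OF linearI[OF K.vec_space UKa.vec_space UK.linear_tensor_right[OF that]]] by simp
  have left: "tensor_map ?K U \<epsilon>' id (\<Delta>' (?\<pi> x)) = tensor ?K U 1 (?\<pi> x)" if "x \<in> carrier F" for x
  proof (rule free_unique[OF KUa.hom_algebra _ _ _ _ that])
    show "hom_alg_morphism F (tensor_alg ?K U) (\<lambda>x. tensor_map ?K U \<epsilon>' id (\<Delta>' (?\<pi> x)))"
      by (intro hom_alg_morphism_comp[OF hom_alg_morphism_comp[OF U_proj_morphism \<Delta>'(1)] l(1)])
    have lin: "linear_map U (tensor_alg ?K U) (\<lambda>y. tensor ?K U 1 y)"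
      using KU.linear_tensor_right[of 1] by simp
    show "hom_alg_morphism F (tensor_alg ?K U) (\<lambda>x. tensor ?K U 1 (?\<pi> x))"
      using linear_map_comp[OF \<pi>(1) lin]
      by (auto simp: hom_alg_morphism_def KU.tensor_mult KU.tensor_twist \<pi>)
    show "tensor_map ?K U \<epsilon>' id (\<Delta>' (?\<pi> \<one>\<^bsub>F\<^esub>)) = tensor ?K U 1 (?\<pi> \<one>\<^bsub>F\<^esub>)"
      by (simp add: \<Delta>'_one l(2) \<epsilon>'_one) (simp add: U_proj_one)
    show "tensor_map ?K U \<epsilon>' id (\<Delta>' (?\<pi> (free_gen S s))) = tensor ?K U 1 (?\<pi> (free_gen S s))"
      if "s \<in> carrier S" for s
      using that by (simp add: \<Delta>'_gen \<pi>(2) linear_mapD(2)[OF hom_alg_morphismD(1)[OF l(1)]] l(2)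
          \<epsilon>'_one \<epsilon>'_gen zl)
  qed
  have right: "tensor_map U ?K id \<epsilon>' (\<Delta>' (?\<pi> x)) = tensor U ?K (?\<pi> x) 1" if "x \<in> carrier F" for x
  proof (rule free_unique[OF UKa.hom_algebra _ _ _ _ that])
    show "hom_alg_morphism F (tensor_alg U ?K) (\<lambda>x. tensor_map U ?K id \<epsilon>' (\<Delta>' (?\<pi> x)))"
      by (intro hom_alg_morphism_comp[OF hom_alg_morphism_comp[OF U_proj_morphism \<Delta>'(1)] r(1)])
    have lin: "linear_map U (tensor_alg U ?K) (\<lambda>y. tensor U ?K y 1)"
      using UK.linear_tensor_left[of 1] by simp
    show "hom_alg_morphism F (tensor_alg U ?K) (\<lambda>x. tensor U ?K (?\<pi> x) 1)"
      using linear_map_comp[OF \<pi>(1) lin]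
      by (auto simp: hom_alg_morphism_def UK.tensor_mult UK.tensor_twist \<pi>)
    show "tensor_map U ?K id \<epsilon>' (\<Delta>' (?\<pi> \<one>\<^bsub>F\<^esub>)) = tensor U ?K (?\<pi> \<one>\<^bsub>F\<^esub>) 1"
      by (simp add: \<Delta>'_one r(2) \<epsilon>'_one) (simp add: U_proj_one)
    show "tensor_map U ?K id \<epsilon>' (\<Delta>' (?\<pi> (free_gen S s))) = tensor U ?K (?\<pi> (free_gen S s)) 1"
      if "s \<in> carrier S" for s
      using that by (simp add: \<Delta>'_gen \<pi>(2) linear_mapD(2)[OF hom_alg_morphismD(1)[OF r(1)]] r(2)
          \<epsilon>'_one \<epsilon>'_gen zr)
  qed
  have "hom_bialgebra U \<Delta>' \<epsilon>'"
    unfolding hom_bialgebra_def counitary_hom_coalgebra_def hom_coalgebra_def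
    using unitary_U_hom UH.vec_space UH.linear_twist \<Delta>'(1) \<epsilon>'(1) left right
    by (auto simp: hom_alg_morphismD(1,4)[OF \<Delta>'(1)] hom_alg_morphismD(1)[OF \<epsilon>'(1)] tensor_map_twist U_carrier)
  then show ?thesis using \<Delta> \<epsilon> \<Delta>'(2) \<epsilon>'(2) by blast
qed

end

theorem theorem3p18:
  fixes S :: "('k::field_char_0, 's) hom_sabinin"
  assumes "hom_sabinin_algebra S"
  shows "\<exists>\<Delta> \<epsilon> \<Delta>' \<epsilon>'.
    free_coproduct S \<Delta> \<and> free_counit S \<epsilon> \<and>
    (\<forall>x\<in>carrier (free_hom_alg S).
       \<Delta>' (U_proj S x) = tensor_map (U_hom S) (U_hom S) (U_proj S) (U_proj S) (\<Delta> x) \<and>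
       \<epsilon>' (U_proj S x) = \<epsilon> x) \<and>
    hom_bialgebra (U_hom S) \<Delta>' \<epsilon>'"
  by (rule sabinin.hom_bialgebra_U_hom[OF sabinin.intro[OF assms]])

end
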